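(* Let $G$ be a compact, connected Lie group acting on a manifold $M$, and let $E_\infty$ be the final page of the spectral sequence of the Cartan model. If $\dim H^*(M)<\infty$, then the ranks of the $S(\mathfrak g^* )^G$-modules $E_\infty^{\mathrm{even}}$ and $H_G^{\mathrm{even}}(M)$ coincide, and likewise the ranks of the $S(\mathfrak g^* )^G$-modules $E_\infty^{\mathrm{odd}}$ and $H_G^{\mathrm{odd}}(M)$ coincide.
   Context: Manifolds and actions are smooth; $H^*(M)$ is de Rham cohomology over $\mathbb R$. $S(\mathfrak g^* )^G$ is the algebra of $\mathrm{Ad}$-invariant real polynomials on the Lie algebra $\mathfrak g$ of $G$, with $S^k(\mathfrak g^* )^G$ in degree $2k$; it is an integral domain (a polynomial ring), and the rank of a finitely generated module $A$ over it is the dimension of the localization of $A$ at all nonzero elements over the fraction field. Cartan model: $C_G(M)=(S(\mathfrak g^* )\otimes\Omega(M))^G$, i.e. polynomial maps $\omega:\mathfrak g\to\Omega(M)$ with $\omega(\mathrm{Ad}_gX)=(g^{-1})^*(\omega(X))$, with differential $(d_G\omega)(X)=d(\omega(X))-i_{\overline X}(\omega(X))$, $\overline X_p=\frac{d}{dt}|_{t=0}\exp(tX)\cdot p$, graded by $C^n_G(M)=\bigoplus_{2k+l=n}(S^k(\mathfrak g^* )\otimes\Omega^l(M))^G$; $H^*_G(M)=H^*(C_G(M),d_G)$, an $S(\mathfrak g^* )^G$-algebra via $f\mapsto f\otimes1$. Spectral sequence: put $C^{2k,q}=(S^k(\mathfrak g^* )\otimes\Omega^q(M))^G$, $C^{l,q}=0$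 for $l$ odd, and $F^pC_G(M)=\bigoplus_{l\ge p,\,q\ge0}C^{l,q}$. The associated first-quadrant spectral sequence has final page $E_\infty^{p,q}\cong F^pH^{p+q}_G(M)/F^{p+1}H^{p+q}_G(M)$, where $F^pH^n_G(M)=\mathrm{im}(H^n(F^pC_G(M))\to H^n_G(M))$. Its $S(\mathfrak g^* )^G$-module structure is induced by multiplication, $f\in S^k(\mathfrak g^* )^G$ mapping $F^pH^n_G/F^{p+1}H^n_G$ to $F^{p+2k}H^{n+2k}_G/F^{p+2k+1}H^{n+2k}_G$. "Even" and "odd" refer to the total degree $p+q$ on $E_\infty$ and to the degree on $H^*_G(M)$. *)

theory Defs
  imports
    "HOL-Analysis.Analysis"
    "HOL-Algebra.Group_Action"
    "HOL-Algebra.AbelCoset"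
    "Jordan_Normal_Form.Missing_VectorSpace"
begin

section \<open>Smooth manifolds\<close>

text \<open>
  Charts take values in the topological space \<^const>\<open>Euclidean_space\<close> \<open>n\<close> of sequences vanishing
  from index \<open>n\<close> on; this allows every dimension \<open>n\<close>, including \<open>n = 0\<close>.
\<close>

definition partial_deriv :: "nat \<Rightarrow> ((nat \<Rightarrow> real) \<Rightarrow> real) \<Rightarrow> (nat \<Rightarrow> real) \<Rightarrow> real" where
  "partial_deriv i f x = deriv (\<lambda>t. f (x(i := t))) (x i)"

text \<open>
  \<open>C\<^sup>\<infinity>\<close> on an open subset \<open>V\<close> of \<open>\<real>\<^sup>n\<close>: all iterated partial derivatives exist and are continuous.
\<close>

definition smooth_on :: "nat \<Rightarrow> (nat \<Rightarrow> real) set \<Rightarrow> ((nat \<Rightarrow> real) \<Rightarrow> real) \<Rightarrow> bool" where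
  "smooth_on n V f \<longleftrightarrow>
     (\<forall>is \<in> lists {..<n}.
        continuous_map (subtopology (Euclidean_space n) V) euclidean (foldr partial_deriv is f) \<and>
        (\<forall>i<n. \<forall>x\<in>V. (\<lambda>t. foldr partial_deriv is f (x(i := t))) differentiable (at (x i))))"

record 'a mfd =
  mtop :: "'a topology"
  mdim :: nat
  atlas :: "('a set \<times> ('a \<Rightarrow> nat \<Rightarrow> real)) set"

abbreviation points :: "'a mfd \<Rightarrow> 'a set" where
  "points M \<equiv> topspace (mtop M)"

definition smooth_manifold :: "'a mfd \<Rightarrow> bool" where
  "smooth_manifold M \<longleftrightarrow>
     Hausdorff_space (mtop M) \<and> second_countable (mtop M) \<and>
     (\<forall>(U, \<phi>) \<in> atlas M.
        openin (mtop M) U \<and> openin (Euclidean_space (mdim M)) (\<phi> ` U) \<and>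
        homeomorphic_map (subtopology (mtop M) U)
          (subtopology (Euclidean_space (mdim M)) (\<phi> ` U)) \<phi>) \<and>
     (\<Union>(U, \<phi>) \<in> atlas M. U) = points M \<and>
     (\<forall>(U, \<phi>) \<in> atlas M. \<forall>(V, \<psi>) \<in> atlas M. \<forall>i < mdim M.
        smooth_on (mdim M) (\<phi> ` (U \<inter> V)) (\<lambda>x. \<psi> (inv_into U \<phi> x) i))"

definition smooth_map :: "'a mfd \<Rightarrow> 'b mfd \<Rightarrow> ('a \<Rightarrow> 'b) \<Rightarrow> bool" where
  "smooth_map M N F \<longleftrightarrow>
     continuous_map (mtop M) (mtop N) F \<and>
     (\<forall>(U, \<phi>) \<in> atlas M. \<forall>(V, \<psi>) \<in> atlas N. \<forall>i < mdim N.
        smooth_on (mdim M) (\<phi> ` (U \<inter> F -` V)) (\<lambda>x. \<psi> (F (inv_into U \<phi> x)) i))"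

definition prod_mfd :: "'a mfd \<Rightarrow> 'b mfd \<Rightarrow> ('a \<times> 'b) mfd" where
  "prod_mfd M N =
     \<lparr>mtop = prod_topology (mtop M) (mtop N),
      mdim = mdim M + mdim N,
      atlas = {(U \<times> V, \<lambda>(x, y) i. if i < mdim M then \<phi> x i else \<psi> y (i - mdim M)) | U \<phi> V \<psi>.
                 (U, \<phi>) \<in> atlas M \<and> (V, \<psi>) \<in> atlas N}\<rparr>"


section \<open>Functions, vector fields and differential forms\<close>

text \<open>
  Everything is extended by \<open>0\<close> outside its natural domain, so that equality of HOL functions is
  equality of the mathematical objects.  The value of \<open>X\<close> at \<open>f\<close> and \<open>p\<close> is the derivative of \<open>f\<close>
  in direction \<open>X\<^sub>p\<close>.
\<close>

type_synonym 'a vf = "('a \<Rightarrow> real) \<Rightarrow> 'a \<Rightarrow> real"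
type_synonym 'a form = "'a vf list \<Rightarrow> 'a \<Rightarrow> real"

definition smooth_functions :: "'a mfd \<Rightarrow> ('a \<Rightarrow> real) set" where
  "smooth_functions M =
     {f. (\<forall>p. p \<notin> points M \<longrightarrow> f p = 0) \<and>
         (\<forall>(U, \<phi>) \<in> atlas M. smooth_on (mdim M) (\<phi> ` U) (\<lambda>x. f (inv_into U \<phi> x)))}"

text \<open>Vector fields are the derivations of the algebra of smooth functions.\<close>

definition vector_fields :: "'a mfd \<Rightarrow> 'a vf set" where
  "vector_fields M =
     {X. (\<forall>f. f \<notin> smooth_functions M \<longrightarrow> X f = (\<lambda>p. 0)) \<and>
         (\<forall>f \<in> smooth_functions M. X f \<in> smooth_functions M) \<and>
         (\<forall>f \<in> smooth_functions M. \<forall>g \<in> smooth_functions M. \<forall>a b.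
            X (\<lambda>p. a * f p + b * g p) = (\<lambda>p. a * X f p + b * X g p)) \<and>
         (\<forall>f \<in> smooth_functions M. \<forall>g \<in> smooth_functions M.
            X (\<lambda>p. f p * g p) = (\<lambda>p. f p * X g p + g p * X f p))}"

definition lie_bracket :: "'a vf \<Rightarrow> 'a vf \<Rightarrow> 'a vf" where
  "lie_bracket X Y = (\<lambda>f p. X (Y f) p - Y (X f) p)"

text \<open>
  \<open>\<Omega>\<^sup>q(M)\<close>: alternating, \<open>C\<^sup>\<infinity>(M)\<close>-multilinear functions of \<open>q\<close> vector fields with values in \<open>C\<^sup>\<infinity>(M)\<close>.
  The arguments form a list, so that an inhomogeneous form is again a function on lists, whose
  component of degree \<open>q\<close> is its restriction to lists of length \<open>q\<close>.
\<close>

definition forms :: "'a mfd \<Rightarrow> nat \<Rightarrow> 'a form set" where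
  "forms M q =
     {\<omega>. (\<forall>Ys. \<not> (length Ys = q \<and> set Ys \<subseteq> vector_fields M) \<longrightarrow> \<omega> Ys = (\<lambda>p. 0)) \<and>
         (\<forall>Ys. \<omega> Ys \<in> smooth_functions M) \<and>
         (\<forall>Ys Y Z. \<forall>f \<in> smooth_functions M. \<forall>g \<in> smooth_functions M. \<forall>i < q.
            length Ys = q \<and> set Ys \<subseteq> vector_fields M \<and> Y \<in> vector_fields M \<and> Z \<in> vector_fields M \<longrightarrow>
            \<omega> (Ys[i := (\<lambda>h p. f p * Y h p + g p * Z h p)]) =
              (\<lambda>p. f p * \<omega> (Ys[i := Y]) p + g p * \<omega> (Ys[i := Z]) p)) \<and>
         (\<forall>Ys i j. length Ys = q \<and> i < j \<and> j < q \<and> Ys ! i = Ys ! j \<longrightarrow> \<omega> Ys = (\<lambda>p. 0))}"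

text \<open>
  The invariant formula
  \<open>d\<omega>(Y\<^sub>0,\<dots>,Y\<^sub>q) = \<Sum>\<^sub>i (-1)\<^sup>i Y\<^sub>i(\<omega>(\<dots>,Y\<^sub>i omitted,\<dots>)) + \<Sum>\<^sub>i\<^sub><\<^sub>j (-1)\<^sup>i\<^sup>+\<^sup>j \<omega>([Y\<^sub>i,Y\<^sub>j],\<dots>,Y\<^sub>i,Y\<^sub>j omitted,\<dots>)\<close>.
\<close>

definition ext_deriv :: "'a mfd \<Rightarrow> 'a form \<Rightarrow> 'a form" where
  "ext_deriv M \<omega> = (\<lambda>Ys p. if set Ys \<subseteq> vector_fields M then
      (\<Sum>i<length Ys. (- 1) ^ i * (Ys ! i) (\<omega> (nths Ys (- {i}))) p) +
      (\<Sum>(i, j) \<in> {(i, j). i < j \<and> j < length Ys}.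
          (- 1) ^ (i + j) * \<omega> (lie_bracket (Ys ! i) (Ys ! j) # nths Ys (- {i, j})) p)
    else 0)"

definition contraction :: "'a vf \<Rightarrow> 'a form \<Rightarrow> 'a form" where
  "contraction X \<omega> = (\<lambda>Ys. \<omega> (X # Ys))"

text \<open>Pushforward of vector fields and pullback of forms along a diffeomorphism \<open>\<phi>\<close> of \<open>M\<close>.\<close>

definition fun_pullback :: "'a mfd \<Rightarrow> ('a \<Rightarrow> 'a) \<Rightarrow> ('a \<Rightarrow> real) \<Rightarrow> 'a \<Rightarrow> real" where
  "fun_pullback M \<phi> f = (\<lambda>p. if p \<in> points M then f (\<phi> p) else 0)"

definition pushforward :: "'a mfd \<Rightarrow> ('a \<Rightarrow> 'a) \<Rightarrow> 'a vf \<Rightarrow> 'a vf" where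
  "pushforward M \<phi> Y = (\<lambda>f p. if f \<in> smooth_functions M \<and> p \<in> points M
      then Y (fun_pullback M \<phi> f) (inv_into (points M) \<phi> p) else 0)"

definition form_pullback :: "'a mfd \<Rightarrow> ('a \<Rightarrow> 'a) \<Rightarrow> 'a form \<Rightarrow> 'a form" where
  "form_pullback M \<phi> \<omega> = (\<lambda>Ys p. if set Ys \<subseteq> vector_fields M \<and> p \<in> points M
      then \<omega> (map (pushforward M \<phi>) Ys) (\<phi> p) else 0)"


section \<open>Lie groups and smooth actions\<close>

record 'g lie_group_data = "'g monoid" +
  mfd_of :: "'g mfd"

definition lie_group :: "'g lie_group_data \<Rightarrow> bool" where
  "lie_group G \<longleftrightarrow>
     group G \<and> smooth_manifold (mfd_of G) \<and> carrier G = points (mfd_of G) \<and>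
     smooth_map (prod_mfd (mfd_of G) (mfd_of G)) (mfd_of G) (\<lambda>(x, y). x \<otimes>\<^bsub>G\<^esub> y) \<and>
     smooth_map (mfd_of G) (mfd_of G) (\<lambda>x. inv\<^bsub>G\<^esub> x)"

text \<open>The Lie algebra consists of the left-invariant vector fields.\<close>

definition lie_algebra :: "'g lie_group_data \<Rightarrow> 'g vf set" where
  "lie_algebra G =
     {X \<in> vector_fields (mfd_of G). \<forall>g \<in> carrier G. pushforward (mfd_of G) (\<lambda>x. g \<otimes>\<^bsub>G\<^esub> x) X = X}"

definition Ad :: "'g lie_group_data \<Rightarrow> 'g \<Rightarrow> 'g vf \<Rightarrow> 'g vf" where
  "Ad G g X = pushforward (mfd_of G) (\<lambda>x. g \<otimes>\<^bsub>G\<^esub> x \<otimes>\<^bsub>G\<^esub> inv\<^bsub>G\<^esub> g) X"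

text \<open>\<open>exp X\<close> is the value at time \<open>1\<close> of the integral curve of \<open>X\<close> through the identity.\<close>

definition lie_exp :: "'g lie_group_data \<Rightarrow> 'g vf \<Rightarrow> 'g" where
  "lie_exp G X =
     (THE \<gamma> :: real \<Rightarrow> 'g. \<gamma> 0 = \<one>\<^bsub>G\<^esub> \<and> (\<forall>t. \<gamma> t \<in> carrier G) \<and>
        (\<forall>f \<in> smooth_functions (mfd_of G). \<forall>t.
           ((\<lambda>s. f (\<gamma> s)) has_real_derivative X f (\<gamma> t)) (at t))) 1"

definition smooth_action :: "'g lie_group_data \<Rightarrow> 'm mfd \<Rightarrow> ('g \<Rightarrow> 'm \<Rightarrow> 'm) \<Rightarrow> bool" where
  "smooth_action G M act \<longleftrightarrow>
     group_action G (points M) act \<and> smooth_map (prod_mfd (mfd_of G) M) M (\<lambda>(g, p). act g p)"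

definition fundamental_vf ::
    "'g lie_group_data \<Rightarrow> 'm mfd \<Rightarrow> ('g \<Rightarrow> 'm \<Rightarrow> 'm) \<Rightarrow> 'g vf \<Rightarrow> 'm vf" where
  "fundamental_vf G M act X = (\<lambda>f p. if f \<in> smooth_functions M \<and> p \<in> points M
      then deriv (\<lambda>t. f (act (lie_exp G (\<lambda>h x. t * X h x)) p)) 0 else 0)"


section \<open>Invariant polynomials on the Lie algebra\<close>

definition lie_dual :: "'g lie_group_data \<Rightarrow> ('g vf \<Rightarrow> real) set" where
  "lie_dual G =
     {\<alpha>. (\<forall>X. X \<notin> lie_algebra G \<longrightarrow> \<alpha> X = 0) \<and>
         (\<forall>X \<in> lie_algebra G. \<forall>Y \<in> lie_algebra G. \<forall>a b.
            \<alpha> (\<lambda>f p. a * X f p + b * Y f p) = a * \<alpha> X + b * \<alpha> Y)}"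

text \<open>\<open>S\<^sup>k(\<gg>\<^sup>*)\<close>, as homogeneous polynomial functions on \<open>\<gg>\<close>.\<close>

definition sym_power :: "'g lie_group_data \<Rightarrow> nat \<Rightarrow> ('g vf \<Rightarrow> real) set" where
  "sym_power G k =
     {(\<lambda>X. if X \<in> lie_algebra G then \<Sum>j<N. c j * (\<Prod>i<k. \<alpha> j i X) else 0) |
        (N :: nat) c \<alpha>. \<forall>j<N. \<forall>i<k. \<alpha> j i \<in> lie_dual G}"

definition inv_poly_ring :: "'g lie_group_data \<Rightarrow> ('g vf \<Rightarrow> real) ring" where
  "inv_poly_ring G =
     \<lparr>carrier = {(\<lambda>X. \<Sum>k<N. c k X) | (N :: nat) c. \<forall>k<N. c k \<in> sym_power G k} \<inter>
                {f. \<forall>g \<in> carrier G. \<forall>X \<in> lie_algebra G. f (Ad G g X) = f X},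
      monoid.mult = (\<lambda>f h X. f X * h X),
      one = (\<lambda>X. if X \<in> lie_algebra G then 1 else 0),
      zero = (\<lambda>X. 0),
      add = (\<lambda>f h X. f X + h X)\<rparr>"

definition hom_component :: "'g lie_group_data \<Rightarrow> ('g vf \<Rightarrow> real) \<Rightarrow> nat \<Rightarrow> 'g vf \<Rightarrow> real" where
  "hom_component G f =
     (THE c. (\<forall>k. c k \<in> sym_power G k) \<and> finite {k. c k \<noteq> (\<lambda>X. 0)} \<and>
             f = (\<lambda>X. \<Sum>k | c k \<noteq> (\<lambda>X. 0). c k X))"


section \<open>Quotients, graded sums and ranks of modules\<close>

text \<open>
  Only the additive group and the scalar multiplication of a module record are used; its fields
  \<^const>\<open>monoid.mult\<close> and \<^const>\<open>one\<close> are filled with dummies.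
\<close>

definition coset_smult :: "('r, 'a) module \<Rightarrow> 'a set \<Rightarrow> 'r \<Rightarrow> 'a set \<Rightarrow> 'a set" where
  "coset_smult V D a A = (\<Union>x\<in>A. D +>\<^bsub>V\<^esub> (a \<odot>\<^bsub>V\<^esub> x))"

definition quotient_space :: "('r, 'a) module \<Rightarrow> 'a set \<Rightarrow> 'a set \<Rightarrow> ('r, 'a set) module" where
  "quotient_space V Z D =
     \<lparr>carrier = (\<lambda>z. D +>\<^bsub>V\<^esub> z) ` Z,
      monoid.mult = (\<lambda>A B. D), one = D, zero = D,
      add = set_add V, smult = coset_smult V D\<rparr>"

text \<open>
  Let \<open>Q i\<close> be subquotients of \<open>V\<close> such that multiplication by a scalar \<open>a\<close> of degree \<open>k\<close> maps
  \<open>Q (src k i)\<close> to \<open>Q i\<close>, and let \<open>hc a k\<close> be the component of degree \<open>k\<close> of the scalar \<open>a\<close>.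
  This is the direct sum of those \<open>Q i\<close> for which \<open>P i\<close> holds.
\<close>

definition graded_sum ::
    "('r, 'a) module \<Rightarrow> 'r \<Rightarrow> ('r \<Rightarrow> nat \<Rightarrow> 'r) \<Rightarrow> ('i \<Rightarrow> ('r, 'a set) module) \<Rightarrow>
     (nat \<Rightarrow> 'i \<Rightarrow> 'i) \<Rightarrow> ('i \<Rightarrow> bool) \<Rightarrow> ('r, 'i \<Rightarrow> 'a set) module" where
  "graded_sum V z hc Q src P =
     \<lparr>carrier = {e. (\<forall>i. e i \<in> carrier (Q i)) \<and> finite {i. e i \<noteq> \<zero>\<^bsub>Q i\<^esub>} \<and>
                    (\<forall>i. \<not> P i \<longrightarrow> e i = \<zero>\<^bsub>Q i\<^esub>)},
      monoid.mult = (\<lambda>d e i. \<zero>\<^bsub>Q i\<^esub>), one = (\<lambda>i. \<zero>\<^bsub>Q i\<^esub>), zero = (\<lambda>i. \<zero>\<^bsub>Q i\<^esub>),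
      add = (\<lambda>d e i. d i \<oplus>\<^bsub>Q i\<^esub> e i),
      smult = (\<lambda>a e i. \<Oplus>\<^bsub>Q i\<^esub>k \<in> {k. hc a k \<noteq> z}. coset_smult V (\<zero>\<^bsub>Q i\<^esub>) (hc a k) (e (src k i)))\<rparr>"

text \<open>Localization of an \<open>R\<close>-module at all nonzero elements of the domain \<open>R\<close>.\<close>

definition loc_rel :: "'r ring \<Rightarrow> ('r, 'a) module \<Rightarrow> (('a \<times> 'r) \<times> ('a \<times> 'r)) set" where
  "loc_rel R A =
     {((m, s), (n, t)). m \<in> carrier A \<and> n \<in> carrier A \<and>
        s \<in> carrier R - {\<zero>\<^bsub>R\<^esub>} \<and> t \<in> carrier R - {\<zero>\<^bsub>R\<^esub>} \<and>
        (\<exists>u \<in> carrier R - {\<zero>\<^bsub>R\<^esub>}. u \<odot>\<^bsub>A\<^esub> (t \<odot>\<^bsub>A\<^esub> m) = u \<odot>\<^bsub>A\<^esub> (s \<odot>\<^bsub>A\<^esub> n))}"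

abbreviation loc_class :: "'r ring \<Rightarrow> ('r, 'a) module \<Rightarrow> 'a \<Rightarrow> 'r \<Rightarrow> ('a \<times> 'r) set" where
  "loc_class R A m s \<equiv> loc_rel R A `` {(m, s)}"

definition localization ::
    "'r ring \<Rightarrow> ('r, 'a) module \<Rightarrow> (('r \<times> 'r) set, ('a \<times> 'r) set) module" where
  "localization R A =
     \<lparr>carrier = (carrier A \<times> (carrier R - {\<zero>\<^bsub>R\<^esub>})) // loc_rel R A,
      monoid.mult = (\<lambda>C D. loc_class R A \<zero>\<^bsub>A\<^esub> \<one>\<^bsub>R\<^esub>),
      one = loc_class R A \<zero>\<^bsub>A\<^esub> \<one>\<^bsub>R\<^esub>,
      zero = loc_class R A \<zero>\<^bsub>A\<^esub> \<one>\<^bsub>R\<^esub>,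
      add = (\<lambda>C D. \<Union>(m, s)\<in>C. \<Union>(n, t)\<in>D.
               loc_class R A (t \<odot>\<^bsub>A\<^esub> m \<oplus>\<^bsub>A\<^esub> s \<odot>\<^bsub>A\<^esub> n) (s \<otimes>\<^bsub>R\<^esub> t)),
      smult = (\<lambda>C D. \<Union>(a, s)\<in>C. \<Union>(m, t)\<in>D. loc_class R A (a \<odot>\<^bsub>A\<^esub> m) (s \<otimes>\<^bsub>R\<^esub> t))\<rparr>"

definition self_module :: "'r ring \<Rightarrow> ('r, 'r) module" where
  "self_module R =
     \<lparr>carrier = carrier R, monoid.mult = monoid.mult R, one = \<one>\<^bsub>R\<^esub>,
      zero = \<zero>\<^bsub>R\<^esub>, add = add R, smult = monoid.mult R\<rparr>"

definition fraction_field :: "'r ring \<Rightarrow> ('r \<times> 'r) set ring" where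
  "fraction_field R =
     \<lparr>carrier = carrier (localization R (self_module R)),
      monoid.mult = smult (localization R (self_module R)),
      one = loc_class R (self_module R) \<one>\<^bsub>R\<^esub> \<one>\<^bsub>R\<^esub>,
      zero = zero (localization R (self_module R)),
      add = add (localization R (self_module R))\<rparr>"

definition module_rank :: "'r ring \<Rightarrow> ('r, 'a) module \<Rightarrow> enat" where
  "module_rank R A =
     (if vectorspace.fin_dim (fraction_field R) (localization R A)
      then enat (vectorspace.dim (fraction_field R) (localization R A)) else \<infinity>)"


section \<open>De Rham cohomology\<close>

definition real_ring :: "real ring" where
  "real_ring = \<lparr>carrier = UNIV, monoid.mult = (*), one = 1, zero = 0, add = (+)\<rparr>"

definition form_space :: "(real, 'm form) module" where
  "form_space =
     \<lparr>carrier = UNIV, monoid.mult = (\<lambda>\<omega> \<eta> Ys p. 0), one = (\<lambda>Ys p. 0), zero = (\<lambda>Ys p. 0),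
      add = (\<lambda>\<omega> \<eta> Ys p. \<omega> Ys p + \<eta> Ys p), smult = (\<lambda>a \<omega> Ys p. a * \<omega> Ys p)\<rparr>"

definition total_forms :: "'m mfd \<Rightarrow> 'm form set" where
  "total_forms M = {(\<lambda>Ys p. \<Sum>q<N. w q Ys p) | (N :: nat) w. \<forall>q<N. w q \<in> forms M q}"

definition de_rham_cohomology :: "'m mfd \<Rightarrow> (real, 'm form set) module" where
  "de_rham_cohomology M =
     quotient_space form_space {\<omega> \<in> total_forms M. ext_deriv M \<omega> = (\<lambda>Ys p. 0)}
       (ext_deriv M ` total_forms M)"


section \<open>The Cartan model\<close>

type_synonym ('g, 'm) cform = "'g vf \<Rightarrow> 'm form"

definition cform_space :: "('g vf \<Rightarrow> real, ('g, 'm) cform) module" where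
  "cform_space =
     \<lparr>carrier = UNIV, monoid.mult = (\<lambda>\<omega> \<eta> X Ys p. 0), one = (\<lambda>X Ys p. 0), zero = (\<lambda>X Ys p. 0),
      add = (\<lambda>\<omega> \<eta> X Ys p. \<omega> X Ys p + \<eta> X Ys p), smult = (\<lambda>f \<omega> X Ys p. f X * \<omega> X Ys p)\<rparr>"

context
  fixes G :: "'g lie_group_data" and M :: "'m mfd" and act :: "'g \<Rightarrow> 'm \<Rightarrow> 'm"
begin

text \<open>\<open>(S\<^sup>k(\<gg>\<^sup>*) \<otimes> \<Omega>\<^sup>q(M))\<^sup>G\<close>, which is placed in bidegree \<open>(2k, q)\<close>.\<close>

definition cartan :: "nat \<Rightarrow> nat \<Rightarrow> ('g, 'm) cform set" where
  "cartan k q =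
     {(\<lambda>X Ys p. \<Sum>j<N. f j X * v j Ys p) | (N :: nat) f v.
        \<forall>j<N. f j \<in> sym_power G k \<and> v j \<in> forms M q} \<inter>
     {\<omega>. \<forall>g \<in> carrier G. \<forall>X \<in> lie_algebra G.
        \<omega> (Ad G g X) = form_pullback M (act (inv\<^bsub>G\<^esub> g)) (\<omega> X)}"

definition cartan_diff :: "('g, 'm) cform \<Rightarrow> ('g, 'm) cform" where
  "cartan_diff \<omega> = (\<lambda>X Ys p. ext_deriv M (\<omega> X) Ys p
                            - contraction (fundamental_vf G M act X) (\<omega> X) Ys p)"

text \<open>
  \<open>F\<^sup>pC\<^sup>n\<^sub>G(M)\<close>, the sum of the spaces in bidegrees \<open>(2k, n - 2k)\<close> with \<open>p \<le> 2k \<le> n\<close>.  Degrees are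
  integers; the space is \<open>0\<close> for \<open>n < 0\<close>.
\<close>

definition cartan_filt :: "int \<Rightarrow> int \<Rightarrow> ('g, 'm) cform set" where
  "cartan_filt p n =
     {(\<lambda>X Ys x. \<Sum>k | p \<le> 2 * int k \<and> 2 * int k \<le> n. w k X Ys x) | w.
        \<forall>k. p \<le> 2 * int k \<and> 2 * int k \<le> n \<longrightarrow> w k \<in> cartan k (nat (n - 2 * int k))}"

definition cartan_deg :: "int \<Rightarrow> ('g, 'm) cform set" where
  "cartan_deg n = cartan_filt 0 n"

definition equiv_cohomology :: "int \<Rightarrow> ('g vf \<Rightarrow> real, ('g, 'm) cform set) module" where
  "equiv_cohomology n =
     quotient_space cform_space {\<omega> \<in> cartan_deg n. cartan_diff \<omega> = (\<lambda>X Ys p. 0)}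
       (cartan_diff ` cartan_deg (n - 1))"

definition equiv_cohomology_sum ::
    "(int \<Rightarrow> bool) \<Rightarrow> ('g vf \<Rightarrow> real, int \<Rightarrow> ('g, 'm) cform set) module" where
  "equiv_cohomology_sum P =
     graded_sum cform_space (\<lambda>X. 0) (hom_component G) equiv_cohomology (\<lambda>k n. n - 2 * int k) P"

text \<open>
  The pages of the spectral sequence of the filtered complex:
  \<open>Z\<^sub>r\<^sup>p\<^sup>,\<^sup>q = {x \<in> F\<^sup>pC\<^sup>p\<^sup>+\<^sup>q. dx \<in> F\<^sup>p\<^sup>+\<^sup>rC\<^sup>p\<^sup>+\<^sup>q\<^sup>+\<^sup>1}\<close> and
  \<open>E\<^sub>r\<^sup>p\<^sup>,\<^sup>q = Z\<^sub>r\<^sup>p\<^sup>,\<^sup>q / (Z\<^sub>r\<^sub>-\<^sub>1\<^sup>p\<^sup>+\<^sup>1\<^sup>,\<^sup>q\<^sup>-\<^sup>1 + d Z\<^sub>r\<^sub>-\<^sub>1\<^sup>p\<^sup>-\<^sup>r\<^sup>+\<^sup>1\<^sup>,\<^sup>q\<^sup>+\<^sup>r\<^sup>-\<^sup>2)\<close>.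
\<close>

definition ss_cycles :: "int \<Rightarrow> int \<Rightarrow> int \<Rightarrow> ('g, 'm) cform set" where
  "ss_cycles r p q = {x \<in> cartan_filt p (p + q). cartan_diff x \<in> cartan_filt (p + r) (p + q + 1)}"

definition ss_page :: "int \<Rightarrow> int \<Rightarrow> int \<Rightarrow> ('g vf \<Rightarrow> real, ('g, 'm) cform set) module" where
  "ss_page r p q =
     quotient_space cform_space (ss_cycles r p q)
       (ss_cycles (r - 1) (p + 1) (q - 1) <+>\<^bsub>cform_space\<^esub>
        cartan_diff ` ss_cycles (r - 1) (p - r + 1) (q + r - 2))"

definition E_inf :: "int \<Rightarrow> int \<Rightarrow> ('g vf \<Rightarrow> real, ('g, 'm) cform set) module" where
  "E_inf p q = ss_page (\<bar>p\<bar> + \<bar>q\<bar> + 2) p q"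

text \<open>In each bidegree the pages are eventually constant, with value \<open>E_inf\<close>.\<close>

lemma cartan_filt_above: "n < p \<Longrightarrow> cartan_filt p n = {\<lambda>X Ys x. 0}"
proof -
  assume "n < p"
  then have "(p \<le> 2 * int k \<and> 2 * int k \<le> n) = False" for k by auto
  then show ?thesis by (simp only: cartan_filt_def) simp
qed

lemma cartan_filt_nonpos: "p \<le> 0 \<Longrightarrow> cartan_filt p n = cartan_filt 0 n"
proof -
  assume "p \<le> 0"
  then have "(p \<le> 2 * int k) = (0 \<le> 2 * int k)" for k by linarith
  then show ?thesis by (simp only: cartan_filt_def)
qed

lemma ss_page_stable:
  assumes "r \<ge> \<bar>p\<bar> + \<bar>q\<bar> + 2"
  shows "ss_page r p q = E_inf p q"
proof -
  have 1: "ss_cycles s a b = {x \<in> cartan_filt a (a + b). cartan_diff x = (\<lambda>X Ys x. 0)}"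
    if "s \<ge> b + 2" for s a b
    using that by (simp add: ss_cycles_def cartan_filt_above)
  have 2: "ss_cycles (s - 1) (p - s + 1) (q + s - 2) =
      {x \<in> cartan_filt 0 (p + q - 1). cartan_diff x \<in> cartan_filt p (p + q)}"
    if "s \<ge> \<bar>p\<bar> + \<bar>q\<bar> + 2" for s
  proof -
    have e: "(p - s + 1) + (q + s - 2) = p + q - 1" "(p - s + 1) + (s - 1) = p" "p + q - 1 + 1 = p + q"
      by simp_all
    have "cartan_filt (p - s + 1) (p + q - 1) = cartan_filt 0 (p + q - 1)"
      using that by (intro cartan_filt_nonpos) linarith
    then show ?thesis unfolding ss_cycles_def e by simp
  qed
  let ?s = "\<bar>p\<bar> + \<bar>q\<bar> + 2"
  have "ss_cycles r p q = ss_cycles ?s p q"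
    "ss_cycles (r - 1) (p + 1) (q - 1) = ss_cycles (?s - 1) (p + 1) (q - 1)"
    using assms by (simp_all add: 1)
  then show ?thesis
    unfolding ss_page_def E_inf_def by (simp only: 2 [OF assms] 2 [OF order_refl])
qed

definition E_inf_sum ::
    "(int \<Rightarrow> bool) \<Rightarrow> ('g vf \<Rightarrow> real, int \<times> int \<Rightarrow> ('g, 'm) cform set) module" where
  "E_inf_sum P =
     graded_sum cform_space (\<lambda>X. 0) (hom_component G) (\<lambda>(p, q). E_inf p q)
       (\<lambda>k (p, q). (p - 2 * int k, q)) (\<lambda>(p, q). P (p + q))"

end

end

theory Submission
  imports Defs
begin

text \<open>
  Multiplication by an invariant polynomial of degree \<open>k\<close> raises both the filtration degree \<open>p\<close> and
  the total degree \<open>n\<close> by \<open>2k\<close>, so it preserves the fibre degree \<open>q = n - p\<close>.  The classes in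
  \<open>H\<^sub>G(M)\<close> that are represented in each degree \<open>n\<close> by a cocycle of \<open>F\<^sup>n\<^sup>-\<^sup>qC\<^sup>n\<^sub>G(M)\<close> therefore form a
  submodule \<open>A\<^sub>q\<close> over \<open>S(\<gg>\<^sup>*)\<^sup>G\<close>.  These submodules increase with \<open>q\<close> and exhaust the module, and
  \<open>A\<^sub>q / A\<^sub>q\<^sub>-\<^sub>1\<close> is the row of \<open>E\<^sub>\<infinity>\<close> in fibre degree \<open>q\<close>.  Since rank is additive, both ranks are the
  sum of the ranks of the rows.  Parity of the total degree is preserved throughout, which gives the
  even and the odd statement.

  Additivity is proved by counting, which treats finite and infinite rank alike.  A rank basis of a
  module over a domain is an independent family whose span has a torsion quotient; its image in the
  localization is a basis, so the rank is its cardinality (\<open>module_rank_eq_card\<close>).  Zorn's lemma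
  gives a rank basis of every row.  In \<open>E\<^sub>\<infinity>\<close>, which is the direct sum of its rows, the union of these
  is a rank basis; lifted to cocycles, the same index set gives a rank basis of \<open>H\<^sub>G(M)\<close>.  Both
  facts are instances of \<open>rank_basis_of_filtration\<close>.

  Two ingredients are not formal.  The invariant polynomials form a domain because the restriction of
  a polynomial function to a line is a polynomial in one variable.  The unit of this ring is the
  function equal to \<open>1\<close> on \<open>\<gg>\<close> and to \<open>0\<close> elsewhere, and its invariance says that \<open>Ad\<close> maps \<open>\<gg>\<close> to
  itself; this needs smooth functions to stay smooth under composition with translations, hence the
  chain rule.
\<close>

section \<open>Localization of a module over a domain\<close>

lemma UN_constant_pairs:
  assumes "c \<in> C" "d \<in> D"
    and "\<And>m s n t. (m, s) \<in> C \<Longrightarrow> (n, t) \<in> D \<Longrightarrow> f m s n t = E"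
  shows "(\<Union>(m, s)\<in>C. \<Union>(n, t)\<in>D. f m s n t) = E"
proof -
  have "(\<Union>(m, s)\<in>C. \<Union>(n, t)\<in>D. f m s n t) = (\<Union>c\<in>C. \<Union>d\<in>D. E)"
    using assms(3) by (intro SUP_cong refl) (auto simp: split_beta)
  then show ?thesis
    using assms(1,2) by auto
qed

locale module_over_domain = module R M + domain R
  for R :: "'a ring" and M :: "('a, 'c) module" (structure)
begin

abbreviation nonzeros where "nonzeros \<equiv> carrier R - {\<zero>\<^bsub>R\<^esub>}"

lemma nonzeros_mult: "s \<in> nonzeros \<Longrightarrow> t \<in> nonzeros \<Longrightarrow> s \<otimes>\<^bsub>R\<^esub> t \<in> nonzeros"
  using integral by auto

lemma one_nonzero: "\<one>\<^bsub>R\<^esub> \<in> nonzeros"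
  by auto

lemmas smult_normalize = smult_assoc1 [symmetric] smult_r_distr R.m_ac

lemma loc_rel_iff:
  "((m, s), (n, t)) \<in> loc_rel R M \<longleftrightarrow>
     m \<in> carrier M \<and> n \<in> carrier M \<and> s \<in> nonzeros \<and> t \<in> nonzeros \<and>
     (\<exists>u \<in> nonzeros. u \<odot> (t \<odot> m) = u \<odot> (s \<odot> n))"
  by (simp add: loc_rel_def)

lemma loc_relI:
  assumes "m \<in> carrier M" "n \<in> carrier M" "s \<in> nonzeros" "t \<in> nonzeros" "t \<odot> m = s \<odot> n"
  shows "((m, s), (n, t)) \<in> loc_rel R M"
  unfolding loc_rel_iff using assms one_nonzero by (intro conjI bexI [of _ "\<one>\<^bsub>R\<^esub>"]) auto

text \<open>
  The factors \<open>u\<close> and \<open>v\<close> that witness the two relations need not be cancellable in a module with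
  torsion, but their product with the middle denominator \<open>t\<close> witnesses the composite.
\<close>

lemma loc_rel_trans:
  assumes "((m, s), (n, t)) \<in> loc_rel R M" "((n, t), (x, w)) \<in> loc_rel R M"
  shows "((m, s), (x, w)) \<in> loc_rel R M"
proof -
  from assms(1) obtain u where u: "u \<in> nonzeros" "u \<odot> (t \<odot> m) = u \<odot> (s \<odot> n)"
    and c: "m \<in> carrier M" "n \<in> carrier M" "s \<in> nonzeros" "t \<in> nonzeros"
    unfolding loc_rel_iff by blast
  from assms(2) obtain v where v: "v \<in> nonzeros" "v \<odot> (w \<odot> n) = v \<odot> (t \<odot> x)"
    and d: "x \<in> carrier M" "w \<in> nonzeros"
    unfolding loc_rel_iff by blast
  let ?z = "u \<otimes>\<^bsub>R\<^esub> v \<otimes>\<^bsub>R\<^esub> t"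
  have "?z \<odot> (w \<odot> m) = (v \<otimes>\<^bsub>R\<^esub> w) \<odot> (u \<odot> (t \<odot> m))"
    using u(1) v(1) c d by (simp add: smult_normalize)
  also have "\<dots> = (u \<otimes>\<^bsub>R\<^esub> s) \<odot> (v \<odot> (w \<odot> n))"
    unfolding u(2) using u(1) v(1) c d by (simp add: smult_normalize)
  also have "\<dots> = ?z \<odot> (s \<odot> x)"
    unfolding v(2) using u(1) v(1) c d by (simp add: smult_normalize)
  finally have "?z \<odot> (w \<odot> m) = ?z \<odot> (s \<odot> x)" .
  moreover have "?z \<in> nonzeros"
    using u(1) v(1) c(4) by (intro nonzeros_mult)
  ultimately show ?thesis
    unfolding loc_rel_iff using c d by blast
qed

lemma equiv_loc_rel: "equiv (carrier M \<times> nonzeros) (loc_rel R M)"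
proof (rule equivI)
  show "loc_rel R M \<subseteq> (carrier M \<times> nonzeros) \<times> (carrier M \<times> nonzeros)"
    by (auto simp: loc_rel_def)
  show "refl_on (carrier M \<times> nonzeros) (loc_rel R M)"
    by (auto intro!: refl_onI loc_relI)
  show "sym (loc_rel R M)"
  proof (rule symI)
    fix x y assume "(x, y) \<in> loc_rel R M"
    then show "(y, x) \<in> loc_rel R M"
      by (cases x, cases y) (simp only: loc_rel_iff, metis)
  qed
  show "trans (loc_rel R M)"
    by (rule transI) (metis loc_rel_trans surj_pair)
qed

lemma loc_class_eq_iff:
  assumes "m \<in> carrier M" "s \<in> nonzeros" "n \<in> carrier M" "t \<in> nonzeros"
  shows "loc_class R M m s = loc_class R M n t \<longleftrightarrow> (\<exists>u \<in> nonzeros. u \<odot> (t \<odot> m) = u \<odot> (s \<odot> n))"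
  using eq_equiv_class_iff [OF equiv_loc_rel, of "(m, s)" "(n, t)"] assms by (simp add: loc_rel_iff)

lemma loc_class_eqI:
  assumes "m \<in> carrier M" "s \<in> nonzeros" "n \<in> carrier M" "t \<in> nonzeros" "t \<odot> m = s \<odot> n"
  shows "loc_class R M m s = loc_class R M n t"
  using assms one_nonzero by (subst loc_class_eq_iff) auto

lemma self_in_loc_class: "m \<in> carrier M \<Longrightarrow> s \<in> nonzeros \<Longrightarrow> (m, s) \<in> loc_class R M m s"
  by (auto intro!: loc_relI)

lemma loc_class_mem_iff: "(n, t) \<in> loc_class R M m s \<longleftrightarrow> ((m, s), (n, t)) \<in> loc_rel R M"
  by simp

lemma carrier_localization:
  "carrier (localization R M) = {loc_class R M m s | m s. m \<in> carrier M \<and> s \<in> nonzeros}"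
  by (auto simp: localization_def quotient_def)

lemma loc_class_closed:
  "m \<in> carrier M \<Longrightarrow> s \<in> nonzeros \<Longrightarrow> loc_class R M m s \<in> carrier (localization R M)"
  unfolding carrier_localization by blast

lemma localization_cases:
  assumes "x \<in> carrier (localization R M)"
  obtains m s where "m \<in> carrier M" "s \<in> nonzeros" "x = loc_class R M m s"
  using assms unfolding carrier_localization by blast

lemma loc_add:
  assumes m: "m \<in> carrier M" "s \<in> nonzeros" and n: "n \<in> carrier M" "t \<in> nonzeros"
  shows "loc_class R M m s \<oplus>\<^bsub>localization R M\<^esub> loc_class R M n t =
         loc_class R M (t \<odot> m \<oplus> s \<odot> n) (s \<otimes>\<^bsub>R\<^esub> t)"
proof -
  have *: "loc_class R M (t' \<odot> m' \<oplus> s' \<odot> n') (s' \<otimes>\<^bsub>R\<^esub> t') =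
      loc_class R M (t \<odot> m \<oplus> s \<odot> n) (s \<otimes>\<^bsub>R\<^esub> t)"
    if "(m', s') \<in> loc_class R M m s" "(n', t') \<in> loc_class R M n t" for m' s' n' t'
  proof -
    from that(1) obtain u where u: "u \<in> nonzeros" "u \<odot> (s' \<odot> m) = u \<odot> (s \<odot> m')"
      and c: "m' \<in> carrier M" "s' \<in> nonzeros"
      unfolding loc_class_mem_iff loc_rel_iff by blast
    from that(2) obtain v where v: "v \<in> nonzeros" "v \<odot> (t' \<odot> n) = v \<odot> (t \<odot> n')"
      and d: "n' \<in> carrier M" "t' \<in> nonzeros"
      unfolding loc_class_mem_iff loc_rel_iff by blast
    have "(u \<otimes>\<^bsub>R\<^esub> v) \<odot> ((s \<otimes>\<^bsub>R\<^esub> t) \<odot> (t' \<odot> m' \<oplus> s' \<odot> n')) =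
        (v \<otimes>\<^bsub>R\<^esub> t \<otimes>\<^bsub>R\<^esub> t') \<odot> (u \<odot> (s \<odot> m')) \<oplus> (u \<otimes>\<^bsub>R\<^esub> s \<otimes>\<^bsub>R\<^esub> s') \<odot> (v \<odot> (t \<odot> n'))"
      using u(1) v(1) m n c d by (simp add: smult_normalize)
    also have "\<dots> = (u \<otimes>\<^bsub>R\<^esub> v) \<odot> ((s' \<otimes>\<^bsub>R\<^esub> t') \<odot> (t \<odot> m \<oplus> s \<odot> n))"
      unfolding u(2) [symmetric] v(2) [symmetric]
      using u(1) v(1) m n c d by (simp add: smult_normalize)
    finally have e: "(u \<otimes>\<^bsub>R\<^esub> v) \<odot> ((s \<otimes>\<^bsub>R\<^esub> t) \<odot> (t' \<odot> m' \<oplus> s' \<odot> n')) =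
      (u \<otimes>\<^bsub>R\<^esub> v) \<odot> ((s' \<otimes>\<^bsub>R\<^esub> t') \<odot> (t \<odot> m \<oplus> s \<odot> n))" .
    have cc: "t' \<odot> m' \<oplus> s' \<odot> n' \<in> carrier M" "t \<odot> m \<oplus> s \<odot> n \<in> carrier M"
      using m n c d by auto
    show ?thesis
      using e nonzeros_mult [OF u(1) v(1)]
        loc_class_eq_iff [OF cc(1) nonzeros_mult [OF c(2) d(2)] cc(2) nonzeros_mult [OF m(2) n(2)]]
      by blast
  qed
  have "loc_class R M m s \<oplus>\<^bsub>localization R M\<^esub> loc_class R M n t =
     (\<Union>(m', s')\<in>loc_class R M m s. \<Union>(n', t')\<in>loc_class R M n t.
        loc_class R M (t' \<odot> m' \<oplus> s' \<odot> n') (s' \<otimes>\<^bsub>R\<^esub> t'))"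
    by (simp add: localization_def)
  also have "\<dots> = loc_class R M (t \<odot> m \<oplus> s \<odot> n) (s \<otimes>\<^bsub>R\<^esub> t)"
    by (rule UN_constant_pairs [OF self_in_loc_class [OF m] self_in_loc_class [OF n] *])
  finally show ?thesis .
qed

lemma loc_zero: "\<zero>\<^bsub>localization R M\<^esub> = loc_class R M \<zero> \<one>\<^bsub>R\<^esub>"
  by (simp add: localization_def)

text \<open>
  This is how a relation between elements of the localization is brought back to the module.
\<close>

lemma loc_class_zero_iff:
  assumes "m \<in> carrier M" "s \<in> nonzeros"
  shows "loc_class R M m s = \<zero>\<^bsub>localization R M\<^esub> \<longleftrightarrow> (\<exists>u \<in> nonzeros. u \<odot> m = \<zero>)"
  unfolding loc_zero using assms by (subst loc_class_eq_iff) auto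

lemma abelian_group_localization: "abelian_group (localization R M)"
proof (rule abelian_groupI)
  let ?L = "localization R M"
  show "\<zero>\<^bsub>?L\<^esub> \<in> carrier ?L"
    unfolding loc_zero by (intro loc_class_closed) auto
  fix x assume "x \<in> carrier ?L"
  then obtain m s where x: "m \<in> carrier M" "s \<in> nonzeros" "x = loc_class R M m s"
    by (rule localization_cases)
  show "\<zero>\<^bsub>?L\<^esub> \<oplus>\<^bsub>?L\<^esub> x = x"
    unfolding loc_zero x(3) using x(1,2) one_nonzero by (subst loc_add) auto
  have "loc_class R M (\<ominus> m) s \<oplus>\<^bsub>?L\<^esub> x = \<zero>\<^bsub>?L\<^esub>"
  proof -
    have "s \<odot> (\<ominus> m) \<oplus> s \<odot> m = \<zero>"
      using x M.l_neg by (simp add: smult_r_minus)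
    then have "loc_class R M (\<ominus> m) s \<oplus>\<^bsub>?L\<^esub> x = loc_class R M \<zero> (s \<otimes>\<^bsub>R\<^esub> s)"
      unfolding x(3) using x(1,2) by (subst loc_add) auto
    also have "\<dots> = \<zero>\<^bsub>?L\<^esub>"
      using x nonzeros_mult [OF x(2) x(2)] one_nonzero by (subst loc_class_zero_iff) auto
    finally show ?thesis .
  qed
  then show "\<exists>y\<in>carrier ?L. y \<oplus>\<^bsub>?L\<^esub> x = \<zero>\<^bsub>?L\<^esub>"
    using loc_class_closed [of "\<ominus> m" s] x by blast
  fix y assume "y \<in> carrier ?L"
  then obtain n t where y: "n \<in> carrier M" "t \<in> nonzeros" "y = loc_class R M n t"
    by (rule localization_cases)
  show "x \<oplus>\<^bsub>?L\<^esub> y \<in> carrier ?L"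
    unfolding x(3) y(3) using x(1,2) y(1,2) nonzeros_mult [OF x(2) y(2)]
    by (subst loc_add) (auto intro!: loc_class_closed)
  show "x \<oplus>\<^bsub>?L\<^esub> y = y \<oplus>\<^bsub>?L\<^esub> x"
    unfolding x(3) y(3) using x(1,2) y(1,2) by (simp add: loc_add R.m_comm M.a_comm)
  fix z assume "z \<in> carrier ?L"
  then obtain k r where z: "k \<in> carrier M" "r \<in> nonzeros" "z = loc_class R M k r"
    by (rule localization_cases)
  have "loc_class R M m s \<oplus>\<^bsub>?L\<^esub> loc_class R M n t \<oplus>\<^bsub>?L\<^esub> loc_class R M k r =
      loc_class R M (r \<odot> (t \<odot> m \<oplus> s \<odot> n) \<oplus> (s \<otimes>\<^bsub>R\<^esub> t) \<odot> k) (s \<otimes>\<^bsub>R\<^esub> t \<otimes>\<^bsub>R\<^esub> r)"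
    using x(1,2) y(1,2) z(1,2) nonzeros_mult [OF x(2) y(2)]
    by (simp add: loc_add del: Diff_iff) (subst loc_add, auto)
  also have "\<dots> = loc_class R M ((t \<otimes>\<^bsub>R\<^esub> r) \<odot> m \<oplus> s \<odot> (r \<odot> n \<oplus> t \<odot> k)) (s \<otimes>\<^bsub>R\<^esub> (t \<otimes>\<^bsub>R\<^esub> r))"
    using x(1,2) y(1,2) z(1,2) by (simp add: smult_normalize M.a_ac)
  also have "\<dots> = loc_class R M m s \<oplus>\<^bsub>?L\<^esub> (loc_class R M n t \<oplus>\<^bsub>?L\<^esub> loc_class R M k r)"
    using x(1,2) y(1,2) z(1,2) nonzeros_mult [OF y(2) z(2)]
    by (simp add: loc_add del: Diff_iff) (subst loc_add, auto)
  finally show "x \<oplus>\<^bsub>?L\<^esub> y \<oplus>\<^bsub>?L\<^esub> z = x \<oplus>\<^bsub>?L\<^esub> (y \<oplus>\<^bsub>?L\<^esub> z)"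
    unfolding x(3) y(3) z(3) .
qed

end

text \<open>
  The fraction field is the localization of the ring as a module over itself, so its operations are
  instances of those of a general localization.
\<close>

lemma self_module_over_domain:
  assumes "domain R"
  shows "module_over_domain R (self_module R)"
proof -
  interpret domain R by (rule assms)
  have "abelian_group (self_module R)"
  proof (rule abelian_groupI)
    fix x assume "x \<in> carrier (self_module R)"
    then show "\<exists>y\<in>carrier (self_module R). y \<oplus>\<^bsub>self_module R\<^esub> x = \<zero>\<^bsub>self_module R\<^esub>"
      using l_neg [of x] a_inv_closed [of x] by (auto simp: self_module_def)
  qed (auto simp: self_module_def a_ac)
  then have "module R (self_module R)"
    by (intro moduleI is_cring) (auto simp: self_module_def l_distr r_distr m_ac)
  then show ?thesis
    by (simp add: module_over_domain_def domain_axioms)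
qed

context module_over_domain
begin

abbreviation frac :: "'a \<Rightarrow> 'a \<Rightarrow> ('a \<times> 'a) set" where
  "frac a s \<equiv> loc_class R (self_module R) a s"

interpretation self: module_over_domain R "self_module R"
  by (rule self_module_over_domain) (rule domain_axioms)

lemma self_module_simps:
  "carrier (self_module R) = carrier R" "smult (self_module R) = monoid.mult R"
  "add (self_module R) = add R" "zero (self_module R) = \<zero>\<^bsub>R\<^esub>"
  by (simp_all add: self_module_def)

lemma fraction_field_simps:
  "carrier (fraction_field R) = carrier (localization R (self_module R))"
  "add (fraction_field R) = add (localization R (self_module R))"
  "zero (fraction_field R) = zero (localization R (self_module R))"
  "one (fraction_field R) = frac \<one>\<^bsub>R\<^esub> \<one>\<^bsub>R\<^esub>"
  "monoid.mult (fraction_field R) = smult (localization R (self_module R))"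
  by (simp_all add: fraction_field_def)

lemma frac_eq_iff:
  assumes "a \<in> carrier R" "s \<in> nonzeros" "b \<in> carrier R" "t \<in> nonzeros"
  shows "frac a s = frac b t \<longleftrightarrow> t \<otimes>\<^bsub>R\<^esub> a = s \<otimes>\<^bsub>R\<^esub> b"
proof -
  have "(\<exists>u \<in> nonzeros. u \<otimes>\<^bsub>R\<^esub> (t \<otimes>\<^bsub>R\<^esub> a) = u \<otimes>\<^bsub>R\<^esub> (s \<otimes>\<^bsub>R\<^esub> b)) \<longleftrightarrow> t \<otimes>\<^bsub>R\<^esub> a = s \<otimes>\<^bsub>R\<^esub> b"
    using assms one_nonzero m_lcancel by (metis DiffD1 DiffD2 R.m_closed insertI1)
  then show ?thesis
    using assms by (subst self.loc_class_eq_iff) (auto simp: self_module_simps)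
qed

lemma loc_smult:
  assumes a: "a \<in> carrier R" "s \<in> nonzeros" and m: "m \<in> carrier M" "t \<in> nonzeros"
  shows "frac a s \<odot>\<^bsub>localization R M\<^esub> loc_class R M m t = loc_class R M (a \<odot> m) (s \<otimes>\<^bsub>R\<^esub> t)"
proof -
  have *: "loc_class R M (a' \<odot> m') (s' \<otimes>\<^bsub>R\<^esub> t') = loc_class R M (a \<odot> m) (s \<otimes>\<^bsub>R\<^esub> t)"
    if "(a', s') \<in> frac a s" "(m', t') \<in> loc_class R M m t" for a' s' m' t'
  proof -
    from that(1) obtain u where u: "u \<in> nonzeros" "u \<otimes>\<^bsub>R\<^esub> (s' \<otimes>\<^bsub>R\<^esub> a) = u \<otimes>\<^bsub>R\<^esub> (s \<otimes>\<^bsub>R\<^esub> a')"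
      and c: "a' \<in> carrier R" "s' \<in> nonzeros"
      unfolding self.loc_class_mem_iff self.loc_rel_iff self_module_simps by blast
    from that(2) obtain v where v: "v \<in> nonzeros" "v \<odot> (t' \<odot> m) = v \<odot> (t \<odot> m')"
      and d: "m' \<in> carrier M" "t' \<in> nonzeros"
      unfolding loc_class_mem_iff loc_rel_iff by blast
    have "(u \<otimes>\<^bsub>R\<^esub> v) \<odot> ((s \<otimes>\<^bsub>R\<^esub> t) \<odot> (a' \<odot> m')) = (u \<otimes>\<^bsub>R\<^esub> (s \<otimes>\<^bsub>R\<^esub> a')) \<odot> (v \<odot> (t \<odot> m'))"
      using u(1) v(1) a m c d by (simp add: smult_normalize)
    also have "\<dots> = (u \<otimes>\<^bsub>R\<^esub> v) \<odot> ((s' \<otimes>\<^bsub>R\<^esub> t') \<odot> (a \<odot> m))"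
      unfolding u(2) [symmetric] v(2) [symmetric]
      using u(1) v(1) a m c d by (simp add: smult_normalize)
    finally have e: "(u \<otimes>\<^bsub>R\<^esub> v) \<odot> ((s \<otimes>\<^bsub>R\<^esub> t) \<odot> (a' \<odot> m')) =
      (u \<otimes>\<^bsub>R\<^esub> v) \<odot> ((s' \<otimes>\<^bsub>R\<^esub> t') \<odot> (a \<odot> m))" .
    have cc: "a' \<odot> m' \<in> carrier M" "a \<odot> m \<in> carrier M"
      using a m c d by auto
    show ?thesis
      using e nonzeros_mult [OF u(1) v(1)]
        loc_class_eq_iff [OF cc(1) nonzeros_mult [OF c(2) d(2)] cc(2) nonzeros_mult [OF a(2) m(2)]]
      by blast
  qed
  have "frac a s \<odot>\<^bsub>localization R M\<^esub> loc_class R M m t =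
     (\<Union>(a', s')\<in>frac a s. \<Union>(m', t')\<in>loc_class R M m t. loc_class R M (a' \<odot> m') (s' \<otimes>\<^bsub>R\<^esub> t'))"
    by (simp add: localization_def)
  also have "\<dots> = loc_class R M (a \<odot> m) (s \<otimes>\<^bsub>R\<^esub> t)"
    using a by (intro UN_constant_pairs [OF self.self_in_loc_class self_in_loc_class [OF m] *])
      (auto simp: self_module_simps)
  finally show ?thesis .
qed

lemma frac_add:
  assumes "a \<in> carrier R" "s \<in> nonzeros" "b \<in> carrier R" "t \<in> nonzeros"
  shows "frac a s \<oplus>\<^bsub>fraction_field R\<^esub> frac b t = frac (t \<otimes>\<^bsub>R\<^esub> a \<oplus>\<^bsub>R\<^esub> s \<otimes>\<^bsub>R\<^esub> b) (s \<otimes>\<^bsub>R\<^esub> t)"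
  using self.loc_add [of a s b t] assms by (simp add: fraction_field_simps self_module_simps)

lemma frac_closed: "a \<in> carrier R \<Longrightarrow> s \<in> nonzeros \<Longrightarrow> frac a s \<in> carrier (fraction_field R)"
  unfolding fraction_field_simps by (rule self.loc_class_closed) (auto simp: self_module_simps)

lemma fraction_field_cases:
  assumes "x \<in> carrier (fraction_field R)"
  obtains a s where "a \<in> carrier R" "s \<in> nonzeros" "x = frac a s"
  using assms unfolding fraction_field_simps
  by (metis self.localization_cases self_module_simps(1))

end

context module_over_domain
begin

\<comment> \<open>The interpretation is repeated to obtain \<open>loc_smult\<close> for the ring as a module over itself.\<close>
interpretation self: module_over_domain R "self_module R"
  by (rule self_module_over_domain) (rule domain_axioms)

lemma frac_mult:
  assumes "a \<in> carrier R" "s \<in> nonzeros" "b \<in> carrier R" "t \<in> nonzeros"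
  shows "frac a s \<otimes>\<^bsub>fraction_field R\<^esub> frac b t = frac (a \<otimes>\<^bsub>R\<^esub> b) (s \<otimes>\<^bsub>R\<^esub> t)"
  using self.loc_smult [of a s b t] assms by (simp add: fraction_field_simps self_module_simps)

lemma frac_zero_iff:
  assumes "a \<in> carrier R" "s \<in> nonzeros"
  shows "frac a s = \<zero>\<^bsub>fraction_field R\<^esub> \<longleftrightarrow> a = \<zero>\<^bsub>R\<^esub>"
  using assms one_nonzero unfolding fraction_field_simps self.loc_zero self_module_simps
  by (subst frac_eq_iff) auto

lemma field_fraction_field: "field (fraction_field R)"
proof -
  let ?K = "fraction_field R"
  have ab: "abelian_group ?K"
  proof -
    interpret L: abelian_group "localization R (self_module R)"
      by (rule self.abelian_group_localization)
    show ?thesis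
    proof (rule abelian_groupI, unfold fraction_field_simps)
      show "\<exists>y\<in>carrier (localization R (self_module R)).
          y \<oplus>\<^bsub>localization R (self_module R)\<^esub> x = \<zero>\<^bsub>localization R (self_module R)\<^esub>"
        if "x \<in> carrier (localization R (self_module R))" for x
        using that L.l_neg [of x] L.a_inv_closed [of x] by blast
    qed (rule L.a_closed L.zero_closed L.a_assoc L.a_comm L.l_zero; assumption)+
  qed
  have mon: "comm_monoid ?K"
  proof (rule comm_monoidI)
    show "\<one>\<^bsub>?K\<^esub> \<in> carrier ?K"
      unfolding fraction_field_simps(4) by (rule frac_closed) auto
    fix x assume "x \<in> carrier ?K"
    then obtain a s where x: "a \<in> carrier R" "s \<in> nonzeros" "x = frac a s"
      by (rule fraction_field_cases)
    show "\<one>\<^bsub>?K\<^esub> \<otimes>\<^bsub>?K\<^esub> x = x"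
      unfolding fraction_field_simps(4) x(3) using x(1,2) one_nonzero by (subst frac_mult) auto
    fix y assume "y \<in> carrier ?K"
    then obtain b t where y: "b \<in> carrier R" "t \<in> nonzeros" "y = frac b t"
      by (rule fraction_field_cases)
    show "x \<otimes>\<^bsub>?K\<^esub> y \<in> carrier ?K"
      unfolding x(3) y(3) using x(1,2) y(1,2) nonzeros_mult [OF x(2) y(2)]
      by (subst frac_mult) (auto intro!: frac_closed)
    show "x \<otimes>\<^bsub>?K\<^esub> y = y \<otimes>\<^bsub>?K\<^esub> x"
      unfolding x(3) y(3) using x(1,2) y(1,2) by (simp add: frac_mult R.m_comm)
    fix z assume "z \<in> carrier ?K"
    then obtain c r where z: "c \<in> carrier R" "r \<in> nonzeros" "z = frac c r"
      by (rule fraction_field_cases)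
    show "x \<otimes>\<^bsub>?K\<^esub> y \<otimes>\<^bsub>?K\<^esub> z = x \<otimes>\<^bsub>?K\<^esub> (y \<otimes>\<^bsub>?K\<^esub> z)"
      unfolding x(3) y(3) z(3)
      using x(1,2) y(1,2) z(1,2) nonzeros_mult [OF x(2) y(2)] nonzeros_mult [OF y(2) z(2)]
      by (simp add: frac_mult R.m_assoc del: Diff_iff) (simp add: R.m_assoc)
  qed
  have cr: "cring ?K"
  proof (rule cringI [OF ab mon])
    fix x y z assume "x \<in> carrier ?K" "y \<in> carrier ?K" "z \<in> carrier ?K"
    then obtain a s b t c r where x: "a \<in> carrier R" "s \<in> nonzeros" "x = frac a s"
      and y: "b \<in> carrier R" "t \<in> nonzeros" "y = frac b t"
      and z: "c \<in> carrier R" "r \<in> nonzeros" "z = frac c r"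
      by (meson fraction_field_cases)
    note nz = nonzeros_mult [OF x(2) y(2)] nonzeros_mult [OF y(2) z(2)] nonzeros_mult [OF x(2) z(2)]
    have "(x \<oplus>\<^bsub>?K\<^esub> y) \<otimes>\<^bsub>?K\<^esub> z = frac ((t \<otimes>\<^bsub>R\<^esub> a \<oplus>\<^bsub>R\<^esub> s \<otimes>\<^bsub>R\<^esub> b) \<otimes>\<^bsub>R\<^esub> c) (s \<otimes>\<^bsub>R\<^esub> t \<otimes>\<^bsub>R\<^esub> r)"
      unfolding x(3) y(3) z(3) using x(1,2) y(1,2) z(1,2) nz
      by (simp add: frac_add del: Diff_iff) (subst frac_mult, auto)
    also have "\<dots> = frac (t \<otimes>\<^bsub>R\<^esub> r \<otimes>\<^bsub>R\<^esub> (a \<otimes>\<^bsub>R\<^esub> c) \<oplus>\<^bsub>R\<^esub> s \<otimes>\<^bsub>R\<^esub> r \<otimes>\<^bsub>R\<^esub> (b \<otimes>\<^bsub>R\<^esub> c)) (s \<otimes>\<^bsub>R\<^esub> r \<otimes>\<^bsub>R\<^esub> (t \<otimes>\<^bsub>R\<^esub> r))"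
    proof (subst frac_eq_iff)
      show "s \<otimes>\<^bsub>R\<^esub> r \<otimes>\<^bsub>R\<^esub> (t \<otimes>\<^bsub>R\<^esub> r) \<otimes>\<^bsub>R\<^esub> ((t \<otimes>\<^bsub>R\<^esub> a \<oplus>\<^bsub>R\<^esub> s \<otimes>\<^bsub>R\<^esub> b) \<otimes>\<^bsub>R\<^esub> c) =
        s \<otimes>\<^bsub>R\<^esub> t \<otimes>\<^bsub>R\<^esub> r \<otimes>\<^bsub>R\<^esub> (t \<otimes>\<^bsub>R\<^esub> r \<otimes>\<^bsub>R\<^esub> (a \<otimes>\<^bsub>R\<^esub> c) \<oplus>\<^bsub>R\<^esub> s \<otimes>\<^bsub>R\<^esub> r \<otimes>\<^bsub>R\<^esub> (b \<otimes>\<^bsub>R\<^esub> c))"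
        using x(1,2) y(1,2) z(1,2) by (simp add: R.l_distr R.r_distr R.m_ac)
    qed (use x(1,2) y(1,2) z(1,2) nz nonzeros_mult in \<open>auto simp del: Diff_iff simp: DiffD1\<close>)
    also have "\<dots> = x \<otimes>\<^bsub>?K\<^esub> z \<oplus>\<^bsub>?K\<^esub> y \<otimes>\<^bsub>?K\<^esub> z"
      unfolding x(3) y(3) z(3) using x(1,2) y(1,2) z(1,2) nz
      by (simp add: frac_mult del: Diff_iff) (subst frac_add, auto)
    finally show "(x \<oplus>\<^bsub>?K\<^esub> y) \<otimes>\<^bsub>?K\<^esub> z = x \<otimes>\<^bsub>?K\<^esub> z \<oplus>\<^bsub>?K\<^esub> y \<otimes>\<^bsub>?K\<^esub> z" .
  qed
  interpret K: cring ?K by (rule cr)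
  show ?thesis
  proof (rule K.cring_fieldI2)
    show "\<zero>\<^bsub>?K\<^esub> \<noteq> \<one>\<^bsub>?K\<^esub>"
      using frac_zero_iff [OF R.one_closed one_nonzero] unfolding fraction_field_simps(4) by auto
    fix x assume "x \<in> carrier ?K" "x \<noteq> \<zero>\<^bsub>?K\<^esub>"
    then obtain a s where x: "a \<in> carrier R" "s \<in> nonzeros" "x = frac a s"
      by (meson fraction_field_cases)
    have a: "a \<in> nonzeros"
      using x \<open>x \<noteq> _\<close> frac_zero_iff by auto
    have "frac a s \<otimes>\<^bsub>?K\<^esub> frac s a = frac \<one>\<^bsub>R\<^esub> \<one>\<^bsub>R\<^esub>"
      using a x(1,2) one_nonzero nonzeros_mult [OF x(2) a]
      by (subst frac_mult) (auto simp: frac_eq_iff R.m_comm simp del: Image_singleton_iff)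
    then show "\<exists>y\<in>carrier ?K. x \<otimes>\<^bsub>?K\<^esub> y = \<one>\<^bsub>?K\<^esub>"
      unfolding fraction_field_simps(4) x(3) using frac_closed [of s a] a x(2) by auto
  qed
qed

lemma vectorspace_localization: "vectorspace (fraction_field R) (localization R M)"
proof -
  let ?K = "fraction_field R" and ?L = "localization R M"
  interpret K: field ?K by (rule field_fraction_field)
  have "module ?K ?L"
  proof (rule moduleI [OF K.is_cring abelian_group_localization])
    fix x v assume "x \<in> carrier ?K" "v \<in> carrier ?L"
    then obtain a s m t where x: "a \<in> carrier R" "s \<in> nonzeros" "x = frac a s"
      and v: "m \<in> carrier M" "t \<in> nonzeros" "v = loc_class R M m t"
      by (meson fraction_field_cases localization_cases)
    show "x \<odot>\<^bsub>?L\<^esub> v \<in> carrier ?L"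
      unfolding x(3) v(3) using x(1,2) v(1,2) nonzeros_mult [OF x(2) v(2)]
      by (subst loc_smult) (auto intro!: loc_class_closed)
  next
    fix x y v assume "x \<in> carrier ?K" "y \<in> carrier ?K" "v \<in> carrier ?L"
    then obtain a s b r m t where x: "a \<in> carrier R" "s \<in> nonzeros" "x = frac a s"
      and y: "b \<in> carrier R" "r \<in> nonzeros" "y = frac b r"
      and v: "m \<in> carrier M" "t \<in> nonzeros" "v = loc_class R M m t"
      by (meson fraction_field_cases localization_cases)
    note nz = nonzeros_mult [OF x(2) y(2)] nonzeros_mult [OF x(2) v(2)] nonzeros_mult [OF y(2) v(2)]
    note nz3 = nonzeros_mult [OF nz(1) v(2)] nonzeros_mult [OF nz(2,3)]
    show "(x \<otimes>\<^bsub>?K\<^esub> y) \<odot>\<^bsub>?L\<^esub> v = x \<odot>\<^bsub>?L\<^esub> (y \<odot>\<^bsub>?L\<^esub> v)"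
      unfolding x(3) y(3) v(3) using x(1,2) y(1,2) v(1,2) nz
      by (simp add: frac_mult loc_smult smult_assoc1 R.m_assoc del: Diff_iff)
        (simp add: frac_mult loc_smult smult_assoc1 R.m_assoc)
    have "(x \<oplus>\<^bsub>?K\<^esub> y) \<odot>\<^bsub>?L\<^esub> v = loc_class R M ((r \<otimes>\<^bsub>R\<^esub> a \<oplus>\<^bsub>R\<^esub> s \<otimes>\<^bsub>R\<^esub> b) \<odot> m) (s \<otimes>\<^bsub>R\<^esub> r \<otimes>\<^bsub>R\<^esub> t)"
      unfolding x(3) y(3) v(3) using x(1,2) y(1,2) v(1,2) nz
      by (simp add: frac_add del: Diff_iff) (subst loc_smult, auto)
    also have "\<dots> = loc_class R M ((r \<otimes>\<^bsub>R\<^esub> t) \<odot> (a \<odot> m) \<oplus> (s \<otimes>\<^bsub>R\<^esub> t) \<odot> (b \<odot> m)) (s \<otimes>\<^bsub>R\<^esub> t \<otimes>\<^bsub>R\<^esub> (r \<otimes>\<^bsub>R\<^esub> t))"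
    proof (rule loc_class_eqI [OF _ nz3(1) _ nz3(2)])
      show "(s \<otimes>\<^bsub>R\<^esub> t \<otimes>\<^bsub>R\<^esub> (r \<otimes>\<^bsub>R\<^esub> t)) \<odot> ((r \<otimes>\<^bsub>R\<^esub> a \<oplus>\<^bsub>R\<^esub> s \<otimes>\<^bsub>R\<^esub> b) \<odot> m) =
        (s \<otimes>\<^bsub>R\<^esub> r \<otimes>\<^bsub>R\<^esub> t) \<odot> ((r \<otimes>\<^bsub>R\<^esub> t) \<odot> (a \<odot> m) \<oplus> (s \<otimes>\<^bsub>R\<^esub> t) \<odot> (b \<odot> m))"
        using x(1,2) y(1,2) v(1,2) by (simp add: smult_normalize smult_l_distr)
    qed (use x(1,2) y(1,2) v(1,2) in auto)
    also have "\<dots> = x \<odot>\<^bsub>?L\<^esub> v \<oplus>\<^bsub>?L\<^esub> y \<odot>\<^bsub>?L\<^esub> v"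
      unfolding x(3) y(3) v(3) using x(1,2) y(1,2) v(1,2) nz
      by (simp add: loc_smult del: Diff_iff) (subst loc_add, auto)
    finally show "(x \<oplus>\<^bsub>?K\<^esub> y) \<odot>\<^bsub>?L\<^esub> v = x \<odot>\<^bsub>?L\<^esub> v \<oplus>\<^bsub>?L\<^esub> y \<odot>\<^bsub>?L\<^esub> v" .
  next
    fix x v w assume "x \<in> carrier ?K" "v \<in> carrier ?L" "w \<in> carrier ?L"
    then obtain a s m t n r where x: "a \<in> carrier R" "s \<in> nonzeros" "x = frac a s"
      and v: "m \<in> carrier M" "t \<in> nonzeros" "v = loc_class R M m t"
      and w: "n \<in> carrier M" "r \<in> nonzeros" "w = loc_class R M n r"
      by (meson fraction_field_cases localization_cases)
    note nz = nonzeros_mult [OF x(2) v(2)] nonzeros_mult [OF x(2) w(2)] nonzeros_mult [OF v(2) w(2)]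
    note nz3 = nonzeros_mult [OF x(2) nz(3)] nonzeros_mult [OF nz(1,2)]
    have "x \<odot>\<^bsub>?L\<^esub> (v \<oplus>\<^bsub>?L\<^esub> w) = loc_class R M (a \<odot> (r \<odot> m \<oplus> t \<odot> n)) (s \<otimes>\<^bsub>R\<^esub> (t \<otimes>\<^bsub>R\<^esub> r))"
      unfolding x(3) v(3) w(3) using x(1,2) v(1,2) w(1,2) nz
      by (simp add: loc_add del: Diff_iff) (subst loc_smult, auto)
    also have "\<dots> = loc_class R M ((s \<otimes>\<^bsub>R\<^esub> r) \<odot> (a \<odot> m) \<oplus> (s \<otimes>\<^bsub>R\<^esub> t) \<odot> (a \<odot> n)) (s \<otimes>\<^bsub>R\<^esub> t \<otimes>\<^bsub>R\<^esub> (s \<otimes>\<^bsub>R\<^esub> r))"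
    proof (rule loc_class_eqI [OF _ nz3(1) _ nz3(2)])
      show "(s \<otimes>\<^bsub>R\<^esub> t \<otimes>\<^bsub>R\<^esub> (s \<otimes>\<^bsub>R\<^esub> r)) \<odot> (a \<odot> (r \<odot> m \<oplus> t \<odot> n)) =
        (s \<otimes>\<^bsub>R\<^esub> (t \<otimes>\<^bsub>R\<^esub> r)) \<odot> ((s \<otimes>\<^bsub>R\<^esub> r) \<odot> (a \<odot> m) \<oplus> (s \<otimes>\<^bsub>R\<^esub> t) \<odot> (a \<odot> n))"
        using x(1,2) v(1,2) w(1,2) by (simp add: smult_normalize)
    qed (use x(1,2) v(1,2) w(1,2) in auto)
    also have "\<dots> = x \<odot>\<^bsub>?L\<^esub> v \<oplus>\<^bsub>?L\<^esub> x \<odot>\<^bsub>?L\<^esub> w"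
      unfolding x(3) v(3) w(3) using x(1,2) v(1,2) w(1,2) nz
      by (simp add: loc_smult del: Diff_iff) (subst loc_add, auto)
    finally show "x \<odot>\<^bsub>?L\<^esub> (v \<oplus>\<^bsub>?L\<^esub> w) = x \<odot>\<^bsub>?L\<^esub> v \<oplus>\<^bsub>?L\<^esub> x \<odot>\<^bsub>?L\<^esub> w" .
  next
    fix v assume "v \<in> carrier ?L"
    then obtain m t where v: "m \<in> carrier M" "t \<in> nonzeros" "v = loc_class R M m t"
      by (meson localization_cases)
    show "\<one>\<^bsub>?K\<^esub> \<odot>\<^bsub>?L\<^esub> v = v"
      unfolding fraction_field_simps(4) v(3) using v(1,2) one_nonzero by (subst loc_smult) auto
  qed
  then show ?thesis
    by (simp add: vectorspace_def K.field_axioms)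
qed

end

section \<open>Rank bases\<close>

text \<open>
  Families are used instead of sets because the same index set will carry rank bases of two
  different modules.
\<close>

definition independent_family ::
    "'r ring \<Rightarrow> ('r, 'a) module \<Rightarrow> 'i set \<Rightarrow> ('i \<Rightarrow> 'a) \<Rightarrow> bool" where
  "independent_family R A I b \<longleftrightarrow> b \<in> I \<rightarrow> carrier A \<and>
     (\<forall>J c. finite J \<and> J \<subseteq> I \<and> c \<in> J \<rightarrow> carrier R \<and> (\<Oplus>\<^bsub>A\<^esub>j\<in>J. c j \<odot>\<^bsub>A\<^esub> b j) = \<zero>\<^bsub>A\<^esub> \<longrightarrow>
        (\<forall>j\<in>J. c j = \<zero>\<^bsub>R\<^esub>))"

text \<open>
  The span need not be the whole module, but the quotient by it is torsion and disappears in the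
  localization.
\<close>

definition rank_basis :: "'r ring \<Rightarrow> ('r, 'a) module \<Rightarrow> 'i set \<Rightarrow> ('i \<Rightarrow> 'a) \<Rightarrow> bool" where
  "rank_basis R A I b \<longleftrightarrow> independent_family R A I b \<and>
     (\<forall>x\<in>carrier A. \<exists>r\<in>carrier R - {\<zero>\<^bsub>R\<^esub>}. r \<odot>\<^bsub>A\<^esub> x \<in> module.span R A (b ` I))"

lemma independent_familyD:
  assumes "independent_family R A I b" "finite J" "J \<subseteq> I" "c \<in> J \<rightarrow> carrier R"
    "(\<Oplus>\<^bsub>A\<^esub>j\<in>J. c j \<odot>\<^bsub>A\<^esub> b j) = \<zero>\<^bsub>A\<^esub>" "j \<in> J"
  shows "c j = \<zero>\<^bsub>R\<^esub>"
  using assms unfolding independent_family_def by blast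

context module_over_domain
begin

interpretation V: vectorspace "fraction_field R" "localization R M"
  by (rule vectorspace_localization)

abbreviation loc_map :: "'c \<Rightarrow> ('c \<times> 'a) set" where
  "loc_map m \<equiv> loc_class R M m \<one>\<^bsub>R\<^esub>"

lemma loc_map_closed: "m \<in> carrier M \<Longrightarrow> loc_map m \<in> carrier (localization R M)"
  by (rule loc_class_closed) auto

lemma loc_map_add:
  "m \<in> carrier M \<Longrightarrow> n \<in> carrier M \<Longrightarrow>
    loc_map (m \<oplus> n) = loc_map m \<oplus>\<^bsub>localization R M\<^esub> loc_map n"
  using one_nonzero by (simp add: loc_add del: Diff_iff)

lemma loc_map_smult:
  "a \<in> carrier R \<Longrightarrow> m \<in> carrier M \<Longrightarrow>
    loc_map (a \<odot> m) = frac a \<one>\<^bsub>R\<^esub> \<odot>\<^bsub>localization R M\<^esub> loc_map m"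
  using one_nonzero by (simp add: loc_smult del: Diff_iff)

lemma loc_class_eq_smult:
  assumes "m \<in> carrier M" "s \<in> nonzeros"
  shows "loc_class R M m s = frac \<one>\<^bsub>R\<^esub> s \<odot>\<^bsub>localization R M\<^esub> loc_map m"
  using assms one_nonzero by (simp add: loc_smult del: Diff_iff) (simp add: Diff_iff)

lemma loc_map_finsum:
  assumes "finite J" "f \<in> J \<rightarrow> carrier M"
  shows "loc_map (\<Oplus>j\<in>J. f j) = (\<Oplus>\<^bsub>localization R M\<^esub>j\<in>J. loc_map (f j))"
  using assms
proof (induction J rule: finite_induct)
  case empty
  then show ?case by (simp add: loc_zero)
next
  case (insert j J)
  then have "(\<lambda>j. loc_map (f j)) \<in> J \<rightarrow> carrier (localization R M)" "loc_map (f j) \<in> carrier (localization R M)"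
    using loc_map_closed by (auto simp del: Image_singleton_iff)
  moreover have "f \<in> J \<rightarrow> carrier M" "f j \<in> carrier M"
    using insert.prems by auto
  ultimately show ?case
    using insert.hyps insert.IH by (simp add: loc_map_add M.finsum_closed)
qed

text \<open>
  With a common denominator, a linear relation over the fraction field becomes one over the ring.
\<close>

lemma clear_denominators:
  assumes "finite J" "k \<in> J \<rightarrow> carrier (fraction_field R)"
  shows "\<exists>s \<in> nonzeros. \<exists>c \<in> J \<rightarrow> carrier R. \<forall>j\<in>J. frac s \<one>\<^bsub>R\<^esub> \<otimes>\<^bsub>fraction_field R\<^esub> k j = frac (c j) \<one>\<^bsub>R\<^esub>"
  using assms
proof (induction J rule: finite_induct)
  case empty
  then show ?case using one_nonzero by auto
next
  case (insert j J)
  then have "k \<in> J \<rightarrow> carrier (fraction_field R)"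
    by auto
  then obtain s c where s: "s \<in> nonzeros" and c: "c \<in> J \<rightarrow> carrier R"
    and e: "\<And>i. i \<in> J \<Longrightarrow> frac s \<one>\<^bsub>R\<^esub> \<otimes>\<^bsub>fraction_field R\<^esub> k i = frac (c i) \<one>\<^bsub>R\<^esub>"
    using insert.IH by blast
  obtain a t where a: "a \<in> carrier R" "t \<in> nonzeros" "k j = frac a t"
    using insert.prems fraction_field_cases by (metis PiE insertI1)
  have st: "s \<otimes>\<^bsub>R\<^esub> t \<in> nonzeros"
    by (rule nonzeros_mult [OF s a(2)])
  let ?c = "\<lambda>i. if i = j then s \<otimes>\<^bsub>R\<^esub> a else t \<otimes>\<^bsub>R\<^esub> c i"
  have "?c \<in> insert j J \<rightarrow> carrier R"
    using s a c by (auto simp: Pi_iff)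
  moreover have "frac (s \<otimes>\<^bsub>R\<^esub> t) \<one>\<^bsub>R\<^esub> \<otimes>\<^bsub>fraction_field R\<^esub> k i = frac (?c i) \<one>\<^bsub>R\<^esub>" if "i \<in> insert j J" for i
  proof (cases "i = j")
    case True
    have "frac (s \<otimes>\<^bsub>R\<^esub> t) \<one>\<^bsub>R\<^esub> \<otimes>\<^bsub>fraction_field R\<^esub> frac a t = frac (s \<otimes>\<^bsub>R\<^esub> t \<otimes>\<^bsub>R\<^esub> a) t"
      using s a(1,2) st one_nonzero by (subst frac_mult) auto
    also have "\<dots> = frac (s \<otimes>\<^bsub>R\<^esub> a) \<one>\<^bsub>R\<^esub>"
      using s a(1,2) st one_nonzero by (subst frac_eq_iff) (auto simp: R.m_ac)
    finally show ?thesis using True a(3) by simp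
  next
    case False
    then have i: "i \<in> J" using that by auto
    obtain b r where b: "b \<in> carrier R" "r \<in> nonzeros" "k i = frac b r"
      using insert.prems i fraction_field_cases by (metis PiE insertI2)
    have ci: "c i \<in> carrier R" using c i by auto
    have "frac s \<one>\<^bsub>R\<^esub> \<otimes>\<^bsub>fraction_field R\<^esub> frac b r = frac (s \<otimes>\<^bsub>R\<^esub> b) r"
      using b(1,2) s one_nonzero by (subst frac_mult) auto
    then have "frac (s \<otimes>\<^bsub>R\<^esub> b) r = frac (c i) \<one>\<^bsub>R\<^esub>"
      using e [OF i] b(3) by simp
    then have "s \<otimes>\<^bsub>R\<^esub> b = r \<otimes>\<^bsub>R\<^esub> c i"
      using s b(1,2) ci one_nonzero by (subst (asm) frac_eq_iff) auto
    then have "t \<otimes>\<^bsub>R\<^esub> (s \<otimes>\<^bsub>R\<^esub> b) = t \<otimes>\<^bsub>R\<^esub> (r \<otimes>\<^bsub>R\<^esub> c i)"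
      by simp
    then have "s \<otimes>\<^bsub>R\<^esub> t \<otimes>\<^bsub>R\<^esub> b = r \<otimes>\<^bsub>R\<^esub> (t \<otimes>\<^bsub>R\<^esub> c i)"
      using s a(1,2) b(1,2) ci by (simp add: R.m_ac)
    then have "frac (s \<otimes>\<^bsub>R\<^esub> t \<otimes>\<^bsub>R\<^esub> b) r = frac (t \<otimes>\<^bsub>R\<^esub> c i) \<one>\<^bsub>R\<^esub>"
      using s a(1,2) b(1,2) ci one_nonzero by (subst frac_eq_iff) auto
    moreover have "frac (s \<otimes>\<^bsub>R\<^esub> t) \<one>\<^bsub>R\<^esub> \<otimes>\<^bsub>fraction_field R\<^esub> frac b r = frac (s \<otimes>\<^bsub>R\<^esub> t \<otimes>\<^bsub>R\<^esub> b) r"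
      using s a(1,2) b(1,2) st one_nonzero by (subst frac_mult) auto
    ultimately show ?thesis using False b(3) by simp
  qed
  ultimately show ?case
    by (intro bexI [OF _ st] bexI [of _ ?c] ballI)
qed

text \<open>
  A relation over the fraction field, multiplied by a common denominator \<open>s\<close>, is the image of an
  element \<open>\<Sum> c\<^sub>j b\<^sub>j\<close> of the module.  That element dies in the localization, so some nonzero \<open>u\<close> kills
  it; hence \<open>u c\<^sub>j = 0\<close> for all \<open>j\<close>, and \<open>c\<^sub>j = 0\<close> in a domain.
\<close>

lemma loc_map_independent:
  assumes b: "independent_family R M I b"
    and J: "finite J" "J \<subseteq> I" and k: "k \<in> J \<rightarrow> carrier (fraction_field R)"
    and z: "(\<Oplus>\<^bsub>localization R M\<^esub>j\<in>J. k j \<odot>\<^bsub>localization R M\<^esub> loc_map (b j)) = \<zero>\<^bsub>localization R M\<^esub>"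
    and j: "j \<in> J"
  shows "k j = \<zero>\<^bsub>fraction_field R\<^esub>"
proof -
  let ?K = "fraction_field R" and ?L = "localization R M"
  obtain s c where s: "s \<in> nonzeros" and c: "c \<in> J \<rightarrow> carrier R"
    and e: "\<And>i. i \<in> J \<Longrightarrow> frac s \<one>\<^bsub>R\<^esub> \<otimes>\<^bsub>?K\<^esub> k i = frac (c i) \<one>\<^bsub>R\<^esub>"
    using clear_denominators [OF J(1) k] by blast
  have bM: "b i \<in> carrier M" if "i \<in> J" for i
    using b J that by (auto simp: independent_family_def)
  have sK: "frac s \<one>\<^bsub>R\<^esub> \<in> carrier ?K"
    using s one_nonzero by (intro frac_closed) auto
  have kb: "(\<lambda>j. k j \<odot>\<^bsub>?L\<^esub> loc_map (b j)) \<in> J \<rightarrow> carrier ?L"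
    using k loc_map_closed [OF bM] V.smult_closed by blast
  have cb: "(\<lambda>j. c j \<odot> b j) \<in> J \<rightarrow> carrier M"
    using c bM by auto
  have "loc_map (\<Oplus>j\<in>J. c j \<odot> b j) = (\<Oplus>\<^bsub>?L\<^esub>j\<in>J. loc_map (c j \<odot> b j))"
    by (rule loc_map_finsum [OF J(1) cb])
  also have "\<dots> = (\<Oplus>\<^bsub>?L\<^esub>j\<in>J. frac s \<one>\<^bsub>R\<^esub> \<odot>\<^bsub>?L\<^esub> (k j \<odot>\<^bsub>?L\<^esub> loc_map (b j)))"
  proof (rule V.M.finsum_cong', rule refl)
    show "(\<lambda>j. frac s \<one>\<^bsub>R\<^esub> \<odot>\<^bsub>?L\<^esub> (k j \<odot>\<^bsub>?L\<^esub> loc_map (b j))) \<in> J \<rightarrow> carrier ?L"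
      using kb sK V.smult_closed by (fastforce simp del: Image_singleton_iff)
    fix i assume i: "i \<in> J"
    have "k i \<in> carrier ?K" "c i \<in> carrier R" using k c i by auto
    then show "loc_map (c i \<odot> b i) = frac s \<one>\<^bsub>R\<^esub> \<odot>\<^bsub>?L\<^esub> (k i \<odot>\<^bsub>?L\<^esub> loc_map (b i))"
      using loc_map_smult [of "c i" "b i"] bM [OF i] e [OF i, symmetric]
        V.smult_assoc1 [OF sK _ loc_map_closed [OF bM [OF i]], of "k i"] by simp
  qed
  also have "\<dots> = frac s \<one>\<^bsub>R\<^esub> \<odot>\<^bsub>?L\<^esub> (\<Oplus>\<^bsub>?L\<^esub>j\<in>J. k j \<odot>\<^bsub>?L\<^esub> loc_map (b j))"
    by (rule V.finsum_smult_ldistr [OF J(1) sK kb, symmetric])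
  also have "\<dots> = \<zero>\<^bsub>?L\<^esub>"
    unfolding z using sK by (rule V.smult_r_null)
  finally obtain u where u: "u \<in> nonzeros" "u \<odot> (\<Oplus>j\<in>J. c j \<odot> b j) = \<zero>"
    using M.finsum_closed [OF cb] one_nonzero by (subst (asm) loc_class_zero_iff) auto
  have "(\<Oplus>j\<in>J. (u \<otimes>\<^bsub>R\<^esub> c j) \<odot> b j) = (\<Oplus>j\<in>J. u \<odot> (c j \<odot> b j))"
    using u(1) c bM by (intro M.finsum_cong') (auto simp: smult_assoc1 Pi_iff)
  also have "\<dots> = \<zero>"
    using finsum_smult_ldistr [OF J(1) _ cb, of u] u by simp
  finally have "(\<Oplus>j\<in>J. (u \<otimes>\<^bsub>R\<^esub> c j) \<odot> b j) = \<zero>" .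
  then have "u \<otimes>\<^bsub>R\<^esub> c j = \<zero>\<^bsub>R\<^esub>"
    using u(1) c by (intro independent_familyD [OF b J, where c = "\<lambda>j. u \<otimes>\<^bsub>R\<^esub> c j"] j) auto
  then have "c j = \<zero>\<^bsub>R\<^esub>"
    using integral [of u "c j"] u(1) c j by auto
  then have "frac s \<one>\<^bsub>R\<^esub> \<otimes>\<^bsub>?K\<^esub> k j = \<zero>\<^bsub>?K\<^esub>"
    using e [OF j] frac_zero_iff [of "\<zero>\<^bsub>R\<^esub>" "\<one>\<^bsub>R\<^esub>"] one_nonzero by simp
  moreover have "frac s \<one>\<^bsub>R\<^esub> \<noteq> \<zero>\<^bsub>?K\<^esub>"
    using s one_nonzero by (subst frac_zero_iff) auto
  moreover have "k j \<in> carrier ?K" using k j by auto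
  ultimately show ?thesis
    using field.axioms(1) [OF field_fraction_field] sK by (metis domain.integral)
qed

lemma loc_map_injective:
  assumes b: "independent_family R M I b"
  shows "inj_on (\<lambda>i. loc_map (b i)) I"
proof (rule inj_onI, rule ccontr)
  let ?K = "fraction_field R" and ?L = "localization R M"
  fix i j assume ij: "i \<in> I" "j \<in> I" "loc_map (b i) = loc_map (b j)" "i \<noteq> j"
  \<comment> \<open>Two equal images would satisfy the relation with coefficients \<open>1\<close> and \<open>-1\<close>.\<close>
  let ?k = "\<lambda>l. if l = i then \<one>\<^bsub>?K\<^esub> else \<ominus>\<^bsub>?K\<^esub> \<one>\<^bsub>?K\<^esub>"
  have c: "loc_map (b i) \<in> carrier ?L" "loc_map (b j) \<in> carrier ?L"
    using b ij by (auto simp: independent_family_def simp del: Image_singleton_iff intro!: loc_map_closed)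
  have "(\<Oplus>\<^bsub>?L\<^esub>l\<in>{i, j}. ?k l \<odot>\<^bsub>?L\<^esub> loc_map (b l)) =
      \<one>\<^bsub>?K\<^esub> \<odot>\<^bsub>?L\<^esub> loc_map (b i) \<oplus>\<^bsub>?L\<^esub> (\<ominus>\<^bsub>?K\<^esub> \<one>\<^bsub>?K\<^esub>) \<odot>\<^bsub>?L\<^esub> loc_map (b j)"
    using c ij(4) by (subst V.M.finsum_insert) (auto simp del: Image_singleton_iff)
  also have "\<dots> = \<zero>\<^bsub>?L\<^esub>"
    using c ij(3) by (simp add: V.smult_l_minus V.M.r_neg)
  finally have "?k i = \<zero>\<^bsub>?K\<^esub>"
    using ij by (intro loc_map_independent [OF b, where J = "{i, j}"]) auto
  then show False by simp
qed

text \<open>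
  The image of a rank basis is linearly independent by \<open>loc_map_independent\<close>, and it spans because
  every fraction \<open>m/s\<close> equals \<open>(r m)/(s r)\<close> with \<open>r m\<close> in the span of the family.
\<close>

theorem module_rank_eq_card:
  assumes b: "rank_basis R M I b"
  shows "module_rank R M = (if finite I then enat (card I) else \<infinity>)"
proof -
  let ?K = "fraction_field R" and ?L = "localization R M"
  let ?b = "\<lambda>i. loc_map (b i)"
  let ?B = "?b ` I"
  have ind: "independent_family R M I b"
    using b by (simp add: rank_basis_def)
  have bM: "b ` I \<subseteq> carrier M"
    using ind by (auto simp: independent_family_def)
  have inj: "inj_on ?b I"
    by (rule loc_map_injective [OF ind])
  have BL: "?B \<subseteq> carrier ?L"
    using bM loc_map_closed by blast
  have li: "\<not> V.lin_dep ?B"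
  proof
    assume "V.lin_dep ?B"
    then obtain A a v where A: "finite A" "A \<subseteq> ?B" "a \<in> A \<rightarrow> carrier ?K"
      "V.lincomb a A = \<zero>\<^bsub>?L\<^esub>" "v \<in> A" "a v \<noteq> \<zero>\<^bsub>?K\<^esub>"
      unfolding V.lin_dep_def by blast
    obtain J where J: "J \<subseteq> I" "A = ?b ` J"
      using A(2) by (meson subset_imageE)
    have injJ: "inj_on ?b J"
      using inj J(1) by (rule inj_on_subset)
    then have fin: "finite J"
      using A(1) J(2) finite_imageD by blast
    have "(\<Oplus>\<^bsub>?L\<^esub>j\<in>J. a (?b j) \<odot>\<^bsub>?L\<^esub> ?b j) = (\<Oplus>\<^bsub>?L\<^esub>v\<in>A. a v \<odot>\<^bsub>?L\<^esub> v)"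
      unfolding J(2)
    proof (rule V.M.finsum_reindex [symmetric, OF _ injJ])
      show "(\<lambda>v. a v \<odot>\<^bsub>?L\<^esub> v) \<in> ?b ` J \<rightarrow> carrier ?L"
        using A(3) BL J V.smult_closed by blast
    qed
    also have "\<dots> = \<zero>\<^bsub>?L\<^esub>"
      using A(4) by (simp add: V.lincomb_def)
    finally have "a (?b j) = \<zero>\<^bsub>?K\<^esub>" if "j \<in> J" for j
      using A(3) that J fin by (intro loc_map_independent [OF ind fin J(1), where k = "\<lambda>j. a (?b j)"]) auto
    then show False
      using A(5,6) J(2) by auto
  qed
  have gen: "V.gen_set ?B"
  proof
    show "V.span ?B \<subseteq> carrier ?L"
      by (rule V.span_is_subset2 [OF BL])
    have sub: "LinearCombinations.submodule ?K (V.span ?B) ?L"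
      by (rule V.span_is_submodule [OF BL])
    have "LinearCombinations.submodule R {x \<in> carrier M. loc_map x \<in> V.span ?B} M"
    proof (rule LinearCombinations.submodule.intro)
      show "module R M" by (rule module_axioms)
      show "\<zero> \<in> {x \<in> carrier M. loc_map x \<in> V.span ?B}"
        using LinearCombinations.submodule.zero_closed [OF sub] by (simp add: loc_zero)
    next
      fix v w assume vw: "v \<in> {x \<in> carrier M. loc_map x \<in> V.span ?B}" "w \<in> {x \<in> carrier M. loc_map x \<in> V.span ?B}"
      then show "v \<oplus> w \<in> {x \<in> carrier M. loc_map x \<in> V.span ?B}"
        using LinearCombinations.submodule.m_closed [OF sub] by (simp add: loc_map_add)
    next
      fix c v assume "c \<in> carrier R" "v \<in> {x \<in> carrier M. loc_map x \<in> V.span ?B}"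
      then show "c \<odot> v \<in> {x \<in> carrier M. loc_map x \<in> V.span ?B}"
        using LinearCombinations.submodule.smult_closed [OF sub frac_closed, of c "\<one>\<^bsub>R\<^esub>"] one_nonzero
        by (simp add: loc_map_smult)
    qed auto
    moreover have "b ` I \<subseteq> {x \<in> carrier M. loc_map x \<in> V.span ?B}"
      using bM V.in_own_span [OF BL] by auto
    ultimately have sp: "span (b ` I) \<subseteq> {x \<in> carrier M. loc_map x \<in> V.span ?B}"
      by (intro span_is_subset)
    show "carrier ?L \<subseteq> V.span ?B"
    proof
      fix y assume "y \<in> carrier ?L"
      then obtain m s where y: "m \<in> carrier M" "s \<in> nonzeros" "y = loc_class R M m s"
        by (rule localization_cases)
      obtain r where r: "r \<in> nonzeros" "r \<odot> m \<in> span (b ` I)"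
        using b y(1) unfolding rank_basis_def by blast
      have "y = loc_class R M (r \<odot> m) (s \<otimes>\<^bsub>R\<^esub> r)"
        unfolding y(3) using y(1,2) r(1) nonzeros_mult [OF y(2) r(1)]
        by (intro loc_class_eqI) (auto simp: smult_normalize)
      also have "\<dots> = frac \<one>\<^bsub>R\<^esub> (s \<otimes>\<^bsub>R\<^esub> r) \<odot>\<^bsub>?L\<^esub> loc_map (r \<odot> m)"
        using y(1) r(1) nonzeros_mult [OF y(2) r(1)] by (intro loc_class_eq_smult) auto
      also have "\<dots> \<in> V.span ?B"
        using r sp nonzeros_mult [OF y(2) r(1)]
        by (intro LinearCombinations.submodule.smult_closed [OF sub] frac_closed) auto
      finally show "y \<in> V.span ?B" .
    qed
  qed
  show ?thesis
  proof (cases "finite I")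
    case True
    then have "V.fin_dim"
      unfolding V.fin_dim_def using BL gen by blast
    moreover have "V.dim = card I"
      using True V.dim_basis [of ?B] li gen BL card_image [OF inj] by (simp add: V.basis_def)
    ultimately show ?thesis
      using True by (simp add: module_rank_def)
  next
    case False
    then have "infinite ?B"
      using inj finite_imageD by blast
    then have "\<not> V.fin_dim"
      using V.fin_dim_li_fin [OF _ _ BL] li by blast
    then show ?thesis
      using False by (simp add: module_rank_def)
  qed
qed

end

section \<open>Ranks of filtered modules\<close>

context module_over_domain
begin

lemma submodule_uminus:
  assumes "LinearCombinations.submodule R P M" "x \<in> P"
  shows "\<ominus> x \<in> P"
proof -
  have "x \<in> carrier M"
    using LinearCombinations.submodule.subset [OF assms(1)] assms(2) by blast
  then have "\<ominus> x = (\<ominus>\<^bsub>R\<^esub> \<one>\<^bsub>R\<^esub>) \<odot> x"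
    by (simp add: smult_l_minus)
  also have "\<dots> \<in> P"
    using LinearCombinations.submodule.smult_closed [OF assms(1) _ assms(2)] by simp
  finally show ?thesis .
qed

text \<open>
  By Zorn's lemma there is a maximal independent subset \<open>B\<close>.  If \<open>x\<close> is not in \<open>B\<close>, then adding \<open>x\<close> creates a
  relation.  The coefficient of \<open>x\<close> in it is nonzero because \<open>B\<close> is independent, so it provides
  the multiple of \<open>x\<close> in the span.
\<close>

lemma maximal_independent_subset_exists:
  assumes S: "S \<subseteq> carrier M"
  shows "\<exists>B \<subseteq> S. independent_family R M B (\<lambda>x. x) \<and> (\<forall>x\<in>S. \<exists>r\<in>nonzeros. r \<odot> x \<in> span B)"
proof -
  let ?A = "{B. B \<subseteq> S \<and> independent_family R M B (\<lambda>x. x)}"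
  have "\<exists>B\<in>?A. \<forall>X\<in>?A. B \<subseteq> X \<longrightarrow> X = B"
  proof (rule subset_Zorn')
    fix C assume C: "subset.chain ?A C"
    then have sub: "C \<subseteq> ?A"
      by (simp add: subset_chain_def)
    have "independent_family R M (\<Union>C) (\<lambda>x. x)"
      unfolding independent_family_def
    proof (intro conjI allI impI)
      show "(\<lambda>x. x) \<in> \<Union>C \<rightarrow> carrier M"
        using sub S by auto
      fix J c
      assume J: "finite J \<and> J \<subseteq> \<Union>C \<and> c \<in> J \<rightarrow> carrier R \<and> (\<Oplus>j\<in>J. c j \<odot> j) = \<zero>"
      show "\<forall>j\<in>J. c j = \<zero>\<^bsub>R\<^esub>"
      proof (cases "C = {}")
        case True
        then show ?thesis using J by auto
      next
        case False
        obtain B where B: "B \<in> C" "J \<subseteq> B"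
          using finite_subset_Union_chain [of J C ?A] J False C by blast
        then have "independent_family R M B (\<lambda>x. x)"
          using sub by auto
        then show ?thesis
          using B J unfolding independent_family_def by blast
      qed
    qed
    then show "\<Union>C \<in> ?A"
      using sub by auto
  qed
  then obtain B where B: "B \<subseteq> S" "independent_family R M B (\<lambda>x. x)"
    and max: "\<And>X. X \<subseteq> S \<Longrightarrow> independent_family R M X (\<lambda>x. x) \<Longrightarrow> B \<subseteq> X \<Longrightarrow> X = B"
    by auto
  have BM: "B \<subseteq> carrier M"
    using B(1) S by auto
  have sub: "LinearCombinations.submodule R (span B) M"
    by (rule span_is_submodule [OF BM])
  have "\<exists>r\<in>nonzeros. r \<odot> x \<in> span B" if x: "x \<in> S" for x
  proof (cases "x \<in> B")
    case True
    then have "x \<in> span B" "x \<in> carrier M"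
      using in_own_span [OF BM] BM by blast+
    then have "\<one>\<^bsub>R\<^esub> \<odot> x \<in> span B"
      by simp
    then show ?thesis using one_nonzero by blast
  next
    case False
    then have "\<not> independent_family R M (insert x B) (\<lambda>x. x)"
      using max [of "insert x B"] x B(1) by auto
    then obtain J c j where J: "finite J" "J \<subseteq> insert x B" and c: "c \<in> J \<rightarrow> carrier R"
      and z: "(\<Oplus>j\<in>J. c j \<odot> j) = \<zero>" and j: "j \<in> J" "c j \<noteq> \<zero>\<^bsub>R\<^esub>"
      unfolding independent_family_def using BM x S by auto
    let ?y = "\<Oplus>j\<in>J - {x}. c j \<odot> j"
    have J': "finite (J - {x})" "J - {x} \<subseteq> B" "c \<in> J - {x} \<rightarrow> carrier R"
      using J c by auto
    have y: "?y \<in> span B"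
      unfolding span_def lincomb_def using J' by blast
    then have yM: "?y \<in> carrier M"
      using span_is_subset2 [OF BM] by blast
    have xJ: "x \<in> J"
    proof (rule ccontr)
      assume "x \<notin> J"
      then show False
        using independent_familyD [OF B(2) J(1) _ c z j(1)] J j(2) by auto
    qed
    have cx: "c x \<in> carrier R" "x \<in> carrier M"
      using c xJ x S by auto
    have "(\<Oplus>j\<in>insert x (J - {x}). c j \<odot> j) = c x \<odot> x \<oplus> ?y"
      using J' cx BM by (intro M.finsum_insert) (auto simp: Pi_iff)
    then have e: "c x \<odot> x \<oplus> ?y = \<zero>"
      using z xJ by (simp add: insert_absorb)
    have "c x \<noteq> \<zero>\<^bsub>R\<^esub>"
    proof
      assume 0: "c x = \<zero>\<^bsub>R\<^esub>"
      then have "?y = \<zero>"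
        using e cx yM by simp
      then have "c j = \<zero>\<^bsub>R\<^esub>"
        using independent_familyD [OF B(2) J', of j] j(1) 0 by (cases "j = x") simp_all
      then show False using j by simp
    qed
    moreover have "c x \<odot> x \<in> span B"
      using submodule_uminus [OF sub y] M.minus_equality [OF e yM] cx by simp
    ultimately show ?thesis
      using cx by blast
  qed
  then show ?thesis using B by blast
qed

lemma torsion_closure_submodule:
  assumes P: "LinearCombinations.submodule R P M"
  shows "LinearCombinations.submodule R {x \<in> carrier M. \<exists>r\<in>nonzeros. r \<odot> x \<in> P} M" (is "LinearCombinations.submodule R ?T M")
proof (rule LinearCombinations.submodule.intro)
  show "module R M" by (rule module_axioms)
  show "\<zero> \<in> ?T"
    using one_nonzero LinearCombinations.submodule.zero_closed [OF P]
    by (auto intro!: bexI [of _ "\<one>\<^bsub>R\<^esub>"])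
next
  fix v w assume "v \<in> ?T" "w \<in> ?T"
  then obtain r s where v: "v \<in> carrier M" "r \<in> nonzeros" "r \<odot> v \<in> P"
    and w: "w \<in> carrier M" "s \<in> nonzeros" "s \<odot> w \<in> P" by blast
  have "(r \<otimes>\<^bsub>R\<^esub> s) \<odot> (v \<oplus> w) = s \<odot> (r \<odot> v) \<oplus> r \<odot> (s \<odot> w)"
    using v(1,2) w(1,2) by (simp add: smult_normalize)
  also have "\<dots> \<in> P"
    using LinearCombinations.submodule.m_closed [OF P
        LinearCombinations.submodule.smult_closed [OF P _ v(3), of s]
        LinearCombinations.submodule.smult_closed [OF P _ w(3), of r]] v(2) w(2) by auto
  finally show "v \<oplus> w \<in> ?T"
    using v(1) w(1) nonzeros_mult [OF v(2) w(2)] by blast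
next
  fix c v assume c: "c \<in> carrier R" and "v \<in> ?T"
  then obtain r where v: "v \<in> carrier M" "r \<in> nonzeros" "r \<odot> v \<in> P" by blast
  have "r \<odot> (c \<odot> v) = c \<odot> (r \<odot> v)"
    using v(1,2) c by (simp add: smult_normalize)
  also have "\<dots> \<in> P"
    by (rule LinearCombinations.submodule.smult_closed [OF P c v(3)])
  finally show "c \<odot> v \<in> ?T"
    using v(1,2) c by blast
qed auto

end

lemma finsum_module_hom:
  assumes N: "module R N" and E: "module R E" and S: "LinearCombinations.submodule R S N"
    and f: "f \<in> module_hom R (N\<lparr>carrier := S\<rparr>) E"
    and J: "finite J" "g \<in> J \<rightarrow> S"
  shows "(\<Oplus>\<^bsub>N\<^esub>j\<in>J. g j) \<in> S" "f (\<Oplus>\<^bsub>N\<^esub>j\<in>J. g j) = (\<Oplus>\<^bsub>E\<^esub>j\<in>J. f (g j))"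
proof -
  interpret N: module R N by (rule N)
  interpret E: module R E by (rule E)
  interpret S: module R "N\<lparr>carrier := S\<rparr>" by (rule N.submodule_is_module [OF S])
  interpret f: mod_hom R "N\<lparr>carrier := S\<rparr>" E f
    by unfold_locales (rule f)
  have SN: "S \<subseteq> carrier N"
    by (rule LinearCombinations.submodule.subset [OF S])
  have "(\<Oplus>\<^bsub>N\<^esub>j\<in>J. g j) \<in> S \<and> f (\<Oplus>\<^bsub>N\<^esub>j\<in>J. g j) = (\<Oplus>\<^bsub>E\<^esub>j\<in>J. f (g j))"
    using J
  proof (induction J rule: finite_induct)
    case empty
    then show ?case
      using LinearCombinations.submodule.zero_closed [OF S] f.f0_is_0 by simp
  next
    case (insert j J)
    then have g: "g j \<in> S" "g \<in> J \<rightarrow> S" by auto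
    then have gN: "g j \<in> carrier N" "g \<in> J \<rightarrow> carrier N" and
      gE: "f (g j) \<in> carrier E" "(\<lambda>j. f (g j)) \<in> J \<rightarrow> carrier E"
      using SN f.f_im by (auto simp: Pi_iff)
    have "(\<Oplus>\<^bsub>N\<^esub>j\<in>J. g j) \<in> S"
      using insert.IH [OF g(2)] by blast
    then have "f (g j \<oplus>\<^bsub>N\<^esub> (\<Oplus>\<^bsub>N\<^esub>j\<in>J. g j)) = f (g j) \<oplus>\<^bsub>E\<^esub> f (\<Oplus>\<^bsub>N\<^esub>j\<in>J. g j)"
      using module_hom_add [OF f, of "g j"] g(1) by simp
    then show ?case
      using insert.hyps insert.IH [OF g(2)] g gN gE
      by (simp add: LinearCombinations.submodule.m_closed [OF S])
  qed
  then show "(\<Oplus>\<^bsub>N\<^esub>j\<in>J. g j) \<in> S" "f (\<Oplus>\<^bsub>N\<^esub>j\<in>J. g j) = (\<Oplus>\<^bsub>E\<^esub>j\<in>J. f (g j))"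
    by auto
qed

text \<open>
  The module \<open>H\<close> is filtered by the images \<open>\<alpha>(W q)\<close>, and the conditions on the maps \<open>\<beta> q\<close> say that
  \<open>\<beta> q\<close> identifies the \<open>q\<close>-th subquotient of this filtration with a submodule of \<open>E\<close>.  Working with
  \<open>N\<close> avoids choosing, for an element of \<open>H\<close>, the element that \<open>\<beta> q\<close> should be applied to.

  The rank bases \<open>B q\<close> of the subquotients are lifted to \<open>W q\<close>.  In a relation between the lifts, the
  terms of the highest level \<open>q\<close> that occurs yield a relation in \<open>B q\<close>, so the lifts are independent.
  Conversely, up to torsion an element of \<open>\<alpha>(W q)\<close> differs from a combination of lifts by an element
  of the previous step of the filtration, and induction on \<open>q\<close> applies.
\<close>

lemma rank_basis_of_filtration:
  fixes W :: "nat \<Rightarrow> 'n set" and \<beta> :: "nat \<Rightarrow> 'n \<Rightarrow> 'e" and B :: "nat \<Rightarrow> 'e set"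
  assumes H: "module_over_domain R H" and E: "module_over_domain R E" and N: "module R N"
    and \<alpha>: "\<alpha> \<in> module_hom R N H" and surj: "\<alpha> ` carrier N = carrier H"
    and W: "\<And>q. LinearCombinations.submodule R (W q) N"
    and mono: "\<And>q. W q \<subseteq> W (Suc q)"
    and exhaust: "carrier N \<subseteq> (\<Union>q. W q)"
    and \<beta>: "\<And>q. \<beta> q \<in> module_hom R (N\<lparr>carrier := W q\<rparr>) E"
    and \<beta>_ker: "\<And>q w. w \<in> W q \<Longrightarrow> \<alpha> w = \<zero>\<^bsub>H\<^esub> \<Longrightarrow> \<beta> q w = \<zero>\<^bsub>E\<^esub>"
    and \<beta>_lower: "\<And>q w. w \<in> W q \<Longrightarrow> \<beta> (Suc q) w = \<zero>\<^bsub>E\<^esub>"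
    and \<beta>_0: "\<And>w. w \<in> W 0 \<Longrightarrow> \<beta> 0 w = \<zero>\<^bsub>E\<^esub> \<Longrightarrow> \<alpha> w = \<zero>\<^bsub>H\<^esub>"
    and \<beta>_Suc: "\<And>q w. w \<in> W (Suc q) \<Longrightarrow> \<beta> (Suc q) w = \<zero>\<^bsub>E\<^esub> \<Longrightarrow> \<alpha> w \<in> \<alpha> ` W q"
    and B: "\<And>q. B q \<subseteq> \<beta> q ` W q" "\<And>q. independent_family R E (B q) (\<lambda>x. x)"
      "\<And>q y. y \<in> \<beta> q ` W q \<Longrightarrow> \<exists>r \<in> carrier R - {\<zero>\<^bsub>R\<^esub>}. r \<odot>\<^bsub>E\<^esub> y \<in> module.span R E (B q)"
  shows "\<exists>h. rank_basis R H (SIGMA q:UNIV. B q) h"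
proof -
  interpret H: module_over_domain R H by (rule H)
  interpret E: module_over_domain R E by (rule E)
  interpret N: module R N by (rule N)
  interpret \<alpha>: mod_hom R N H \<alpha> by unfold_locales (rule \<alpha>)
  have "\<forall>q x. \<exists>w. x \<in> B q \<longrightarrow> w \<in> W q \<and> \<beta> q w = x"
    using B(1) by blast
  then obtain w where w: "\<And>q x. x \<in> B q \<Longrightarrow> w q x \<in> W q \<and> \<beta> q (w q x) = x"
    by metis
  let ?I = "SIGMA q:UNIV. B q"
  let ?w = "\<lambda>(q, x). w q x"
  define h where "h = (\<lambda>j. \<alpha> (?w j))"
  have WN: "W q \<subseteq> carrier N" for q
    by (rule LinearCombinations.submodule.subset [OF W])
  have mono': "W p \<subseteq> W q" if "p \<le> q" for p q
    using lift_Suc_mono_le [of W, OF mono that] .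
  have lower: "\<beta> q v = \<zero>\<^bsub>E\<^esub>" if "v \<in> W p" "p < q" for p q v
  proof -
    obtain q' where "q = Suc q'" "p \<le> q'"
      using \<open>p < q\<close> by (cases q) auto
    then show ?thesis
      using \<beta>_lower [of v q'] mono' [of p q'] that(1) by blast
  qed
  have wW: "?w j \<in> W (fst j)" "\<beta> (fst j) (?w j) = snd j" if "j \<in> ?I" for j
    using w that by auto
  have hH: "h ` ?I \<subseteq> carrier H"
    using wW(1) WN \<alpha>.f_im unfolding h_def by blast
  let ?T = "{x \<in> carrier H. \<exists>r\<in>H.nonzeros. r \<odot>\<^bsub>H\<^esub> x \<in> H.span (h ` ?I)}"
  have T: "LinearCombinations.submodule R ?T H"
    by (intro H.torsion_closure_submodule H.span_is_submodule hH)
  have ind: "independent_family R H ?I h"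
    unfolding independent_family_def
  proof (intro conjI allI impI)
    show "h \<in> ?I \<rightarrow> carrier H"
      using hH by blast
    fix J c
    assume J: "finite J \<and> J \<subseteq> ?I \<and> c \<in> J \<rightarrow> carrier R \<and> (\<Oplus>\<^bsub>H\<^esub>j\<in>J. c j \<odot>\<^bsub>H\<^esub> h j) = \<zero>\<^bsub>H\<^esub>"
    show "\<forall>j\<in>J. c j = \<zero>\<^bsub>R\<^esub>"
    proof (rule ccontr)
      define J' where "J' = {j \<in> J. c j \<noteq> \<zero>\<^bsub>R\<^esub>}"
      \<comment> \<open>\<open>q\<close> is the highest level on which the relation has a nonzero coefficient.\<close>
      define q where "q = Max (fst ` J')"
      assume "\<not> (\<forall>j\<in>J. c j = \<zero>\<^bsub>R\<^esub>)"
      then have ne: "J' \<noteq> {}" and fin: "finite J'" and J'I: "J' \<subseteq> ?I"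
        and cJ': "c \<in> J' \<rightarrow> carrier R"
        using J by (auto simp: J'_def)
      have q: "fst j \<le> q" if "j \<in> J'" for j
        unfolding q_def using fin that by simp
      have "q \<in> fst ` J'"
        unfolding q_def using fin ne by (intro Max_in) auto
      then obtain i where i: "i \<in> J'" "fst i = q"
        by blast
      have gW: "(\<lambda>j. c j \<odot>\<^bsub>N\<^esub> ?w j) \<in> J' \<rightarrow> W q"
      proof
        fix j assume j: "j \<in> J'"
        have "?w j \<in> W q"
          using wW(1) [of j] J'I j mono' [OF q [OF j]] by blast
        then show "c j \<odot>\<^bsub>N\<^esub> ?w j \<in> W q"
          using cJ' j by (intro LinearCombinations.submodule.smult_closed [OF W]) auto
      qed
      then have gN: "(\<lambda>j. c j \<odot>\<^bsub>N\<^esub> ?w j) \<in> J' \<rightarrow> carrier N"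
        using WN by blast
      let ?y = "\<Oplus>\<^bsub>N\<^esub>j\<in>J'. c j \<odot>\<^bsub>N\<^esub> ?w j"
      have self: "LinearCombinations.submodule R (carrier N) N"
        by (rule LinearCombinations.submodule.intro) (auto intro: N)
      have hc: "h j \<in> carrier H" "?w j \<in> carrier N" if "j \<in> J" for j
        using hH that J wW(1) [of j] WN by blast+
      have "\<alpha> ?y = (\<Oplus>\<^bsub>H\<^esub>j\<in>J'. \<alpha> (c j \<odot>\<^bsub>N\<^esub> ?w j))"
        using finsum_module_hom(2) [OF N H.module_axioms self _ fin gN, of \<alpha>] \<alpha> by simp
      also have "\<dots> = (\<Oplus>\<^bsub>H\<^esub>j\<in>J'. c j \<odot>\<^bsub>H\<^esub> h j)"
      proof (rule H.M.finsum_cong', rule refl)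
        show "(\<lambda>j. c j \<odot>\<^bsub>H\<^esub> h j) \<in> J' \<rightarrow> carrier H"
          using cJ' hc by (auto simp: J'_def)
        show "\<alpha> (c j \<odot>\<^bsub>N\<^esub> ?w j) = c j \<odot>\<^bsub>H\<^esub> h j" if "j \<in> J'" for j
          using cJ' that hc(2) [of j] unfolding h_def by (intro \<alpha>.f_smult) (auto simp: J'_def)
      qed
      also have "\<dots> = (\<Oplus>\<^bsub>H\<^esub>j\<in>J. c j \<odot>\<^bsub>H\<^esub> h j)"
        using J hc(1) by (intro H.M.add.finprod_mono_neutral_cong_left) (auto simp: J'_def Pi_iff)
      finally have "\<alpha> ?y = \<zero>\<^bsub>H\<^esub>"
        using J by simp
      then have y0: "\<beta> q ?y = \<zero>\<^bsub>E\<^esub>"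
        using \<beta>_ker finsum_module_hom(1) [OF N E.module_axioms W \<beta> fin gW] by blast
      have y1: "\<beta> q ?y = (\<Oplus>\<^bsub>E\<^esub>j\<in>J'. \<beta> q (c j \<odot>\<^bsub>N\<^esub> ?w j))"
        by (rule finsum_module_hom(2) [OF N E.module_axioms W \<beta> fin gW])
      have sm: "\<beta> q (c j \<odot>\<^bsub>N\<^esub> ?w j) = c j \<odot>\<^bsub>E\<^esub> (if fst j = q then snd j else \<zero>\<^bsub>E\<^esub>)"
        if j: "j \<in> J'" for j
      proof -
        have jW: "?w j \<in> W (fst j)" "\<beta> (fst j) (?w j) = snd j"
          using wW [of j] J'I j by blast+
        then have "\<beta> q (?w j) = (if fst j = q then snd j else \<zero>\<^bsub>E\<^esub>)"
          using lower [OF jW(1), of q] q [OF j] by auto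
        moreover have "?w j \<in> W q"
          using jW(1) mono' [OF q [OF j]] by blast
        then have "\<beta> q (c j \<odot>\<^bsub>N\<^esub> ?w j) = c j \<odot>\<^bsub>E\<^esub> \<beta> q (?w j)"
          using module_hom_smult [OF \<beta> [of q], of "c j" "?w j"] cJ' j by auto
        ultimately show ?thesis by simp
      qed
      define X where "X = {x. (q, x) \<in> J'}"
      have XJ: "Pair q ` X = {j \<in> J'. fst j = q}"
        by (force simp: X_def)
      have finX: "finite X"
        using fin XJ by (metis (mono_tags, lifting) finite_imageD finite_subset inj_onI mem_Collect_eq prod.inject subsetI)
      have XB: "X \<subseteq> B q"
        using J'I by (auto simp: X_def)
      have XE: "X \<subseteq> carrier E"
        using XB B(2) [of q] by (auto simp: independent_family_def)
      have cX: "(\<lambda>x. c (q, x)) \<in> X \<rightarrow> carrier R"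
        using cJ' by (auto simp: X_def)
      have "(\<Oplus>\<^bsub>E\<^esub>j\<in>J'. \<beta> q (c j \<odot>\<^bsub>N\<^esub> ?w j)) = (\<Oplus>\<^bsub>E\<^esub>j\<in>Pair q ` X. c j \<odot>\<^bsub>E\<^esub> snd j)"
      proof (rule E.M.add.finprod_mono_neutral_cong_right)
        show "Pair q ` X \<subseteq> J'" "finite J'"
          using XJ fin by auto
        show "\<beta> q (c j \<odot>\<^bsub>N\<^esub> ?w j) = \<zero>\<^bsub>E\<^esub>" if "j \<in> J' - Pair q ` X" for j
        proof -
          have "c j \<in> carrier R" "j \<in> J'" "fst j \<noteq> q"
            using that cJ' XJ by auto
          then show ?thesis
            using sm [of j] by simp
        qed
        show "\<beta> q (c j \<odot>\<^bsub>N\<^esub> ?w j) = c j \<odot>\<^bsub>E\<^esub> snd j" if "j \<in> Pair q ` X" for j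
          using that sm [of j] XJ by auto
        show "(\<lambda>j. \<beta> q (c j \<odot>\<^bsub>N\<^esub> ?w j)) \<in> J' \<rightarrow> carrier E"
        proof
          fix j assume "j \<in> J'"
          then have "c j \<odot>\<^bsub>N\<^esub> ?w j \<in> carrier (N\<lparr>carrier := W q\<rparr>)"
            using funcset_mem [OF gW] by simp
          then show "\<beta> q (c j \<odot>\<^bsub>N\<^esub> ?w j) \<in> carrier E"
            by (rule funcset_mem [OF module_hom_closed [OF \<beta>]])
        qed
      qed
      also have "\<dots> = (\<Oplus>\<^bsub>E\<^esub>x\<in>X. c (q, x) \<odot>\<^bsub>E\<^esub> x)"
        using cX XE by (subst E.M.finsum_reindex) (auto simp: inj_on_def Pi_iff subset_iff)
      finally have "(\<Oplus>\<^bsub>E\<^esub>x\<in>X. c (q, x) \<odot>\<^bsub>E\<^esub> x) = \<zero>\<^bsub>E\<^esub>"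
        using y0 y1 by simp
      then have "c (q, x) = \<zero>\<^bsub>R\<^esub>" if "x \<in> X" for x
        using independent_familyD [OF B(2) finX XB cX _ that] by simp
      moreover have "i = (q, snd i)" "snd i \<in> X"
        using i by (auto simp: X_def)
      ultimately show False
        using i by (metis (mono_tags, lifting) J'_def mem_Collect_eq)
    qed
  qed
  have step: "\<alpha> x \<in> ?T"
    if x: "x \<in> W q" and low: "\<And>z. z \<in> W q \<Longrightarrow> \<beta> q z = \<zero>\<^bsub>E\<^esub> \<Longrightarrow> \<alpha> z \<in> ?T" for q x
  proof -
    \<comment> \<open>This submodule contains \<open>B q\<close>, hence its span and a nonzero multiple of \<open>\<beta> q x\<close>.\<close>
    let ?S = "{\<beta> q v | v. v \<in> W q \<and> \<alpha> v \<in> ?T}"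
    interpret Wq: module R "N\<lparr>carrier := W q\<rparr>" by (rule N.submodule_is_module [OF W])
    interpret \<beta>: mod_hom R "N\<lparr>carrier := W q\<rparr>" E "\<beta> q"
      by unfold_locales (rule \<beta>)
    have \<beta>c: "\<beta> q v \<in> carrier E" if "v \<in> W q" for v
      using \<beta>.f_im [of v] that by simp
    have \<beta>a: "\<beta> q (u \<oplus>\<^bsub>N\<^esub> v) = \<beta> q u \<oplus>\<^bsub>E\<^esub> \<beta> q v" if "u \<in> W q" "v \<in> W q" for u v
      using \<beta>.f_add [of u v] that by simp
    have \<beta>s: "\<beta> q (c \<odot>\<^bsub>N\<^esub> v) = c \<odot>\<^bsub>E\<^esub> \<beta> q v" if "c \<in> carrier R" "v \<in> W q" for c v
      using \<beta>.f_smult [of c v] that by simp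
    have "LinearCombinations.submodule R ?S E"
    proof (rule LinearCombinations.submodule.intro)
      show "module R E" by (rule E.module_axioms)
      show "?S \<subseteq> carrier E" using \<beta>c by auto
      show "\<zero>\<^bsub>E\<^esub> \<in> ?S"
        using \<beta>.f0_is_0 LinearCombinations.submodule.zero_closed [OF W [of q]]
          LinearCombinations.submodule.zero_closed [OF T]
        by (auto intro!: exI [of _ "\<zero>\<^bsub>N\<^esub>"])
    next
      fix a b assume "a \<in> ?S" "b \<in> ?S"
      then obtain u v where u: "a = \<beta> q u" "u \<in> W q" "\<alpha> u \<in> ?T"
        and v: "b = \<beta> q v" "v \<in> W q" "\<alpha> v \<in> ?T" by blast
      have "\<alpha> (u \<oplus>\<^bsub>N\<^esub> v) = \<alpha> u \<oplus>\<^bsub>H\<^esub> \<alpha> v"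
        using u(2) v(2) WN by (intro \<alpha>.f_add) auto
      then have "\<alpha> (u \<oplus>\<^bsub>N\<^esub> v) \<in> ?T"
        using LinearCombinations.submodule.m_closed [OF T u(3) v(3)] by simp
      moreover have "u \<oplus>\<^bsub>N\<^esub> v \<in> W q"
        by (rule LinearCombinations.submodule.m_closed [OF W u(2) v(2)])
      ultimately show "a \<oplus>\<^bsub>E\<^esub> b \<in> ?S"
        using \<beta>a [OF u(2) v(2)] u(1) v(1) by (metis (mono_tags, lifting) mem_Collect_eq)
    next
      fix c a assume c: "c \<in> carrier R" and "a \<in> ?S"
      then obtain u where u: "a = \<beta> q u" "u \<in> W q" "\<alpha> u \<in> ?T" by blast
      have "\<alpha> (c \<odot>\<^bsub>N\<^esub> u) = c \<odot>\<^bsub>H\<^esub> \<alpha> u"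
        using u(2) c WN by (intro \<alpha>.f_smult) auto
      then have "\<alpha> (c \<odot>\<^bsub>N\<^esub> u) \<in> ?T"
        using LinearCombinations.submodule.smult_closed [OF T c u(3)] by simp
      moreover have "c \<odot>\<^bsub>N\<^esub> u \<in> W q"
        by (rule LinearCombinations.submodule.smult_closed [OF W c u(2)])
      ultimately show "c \<odot>\<^bsub>E\<^esub> a \<in> ?S"
        using \<beta>s [OF c u(2)] u(1) by (metis (mono_tags, lifting) mem_Collect_eq)
    qed
    moreover have "B q \<subseteq> ?S"
    proof
      fix y assume y: "y \<in> B q"
      have "(q, y) \<in> ?I" using y by simp
      then have "h (q, y) \<in> H.span (h ` ?I)" "h (q, y) \<in> carrier H"
        using H.in_own_span [OF hH] hH by blast+
      then have "\<alpha> (w q y) \<in> ?T"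
        using H.one_nonzero by (auto simp: h_def intro!: bexI [of _ "\<one>\<^bsub>R\<^esub>"])
      then show "y \<in> ?S"
        using w [OF y] by (metis (mono_tags, lifting) mem_Collect_eq)
    qed
    ultimately have "E.span (B q) \<subseteq> ?S"
      by (intro E.span_is_subset)
    moreover obtain r where r: "r \<in> E.nonzeros" "r \<odot>\<^bsub>E\<^esub> \<beta> q x \<in> E.span (B q)"
      using B(3) x by blast
    ultimately obtain v where v: "v \<in> W q" "\<alpha> v \<in> ?T" "r \<odot>\<^bsub>E\<^esub> \<beta> q x = \<beta> q v"
      by blast
    have rx: "r \<odot>\<^bsub>N\<^esub> x \<in> W q" and mv: "(\<ominus>\<^bsub>R\<^esub> \<one>\<^bsub>R\<^esub>) \<odot>\<^bsub>N\<^esub> v \<in> W q"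
      using r(1) x v(1) by (auto intro!: LinearCombinations.submodule.smult_closed [OF W])
    let ?z = "r \<odot>\<^bsub>N\<^esub> x \<oplus>\<^bsub>N\<^esub> (\<ominus>\<^bsub>R\<^esub> \<one>\<^bsub>R\<^esub>) \<odot>\<^bsub>N\<^esub> v"
    have z: "?z \<in> W q"
      by (rule LinearCombinations.submodule.m_closed [OF W rx mv])
    have "\<beta> q ?z = \<beta> q v \<oplus>\<^bsub>E\<^esub> (\<ominus>\<^bsub>R\<^esub> \<one>\<^bsub>R\<^esub>) \<odot>\<^bsub>E\<^esub> \<beta> q v"
      using \<beta>a [OF rx mv] \<beta>s r(1) x v by auto
    also have "\<dots> = \<zero>\<^bsub>E\<^esub>"
      using \<beta>c [OF v(1)] by (simp add: E.smult_l_minus E.M.r_neg)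
    finally have zT: "\<alpha> ?z \<in> ?T"
      using low z by blast
    have cN: "x \<in> carrier N" "v \<in> carrier N" "r \<in> carrier R"
      using x v(1) WN r(1) by auto
    have "?z \<oplus>\<^bsub>N\<^esub> v = r \<odot>\<^bsub>N\<^esub> x"
      using cN by (simp add: N.smult_l_minus N.M.a_assoc N.M.l_neg)
    then have "r \<odot>\<^bsub>H\<^esub> \<alpha> x = \<alpha> ?z \<oplus>\<^bsub>H\<^esub> \<alpha> v"
      using \<alpha>.f_add [of ?z v] \<alpha>.f_smult [of r x] cN by simp
    also have "\<dots> \<in> ?T"
      by (rule LinearCombinations.submodule.m_closed [OF T zT v(2)])
    finally obtain s where s: "s \<in> H.nonzeros" "s \<odot>\<^bsub>H\<^esub> (r \<odot>\<^bsub>H\<^esub> \<alpha> x) \<in> H.span (h ` ?I)"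
      by blast
    then have "(s \<otimes>\<^bsub>R\<^esub> r) \<odot>\<^bsub>H\<^esub> \<alpha> x \<in> H.span (h ` ?I)"
      using cN \<alpha>.f_im [OF cN(1)] by (simp add: H.smult_assoc1)
    then show "\<alpha> x \<in> ?T"
      using H.nonzeros_mult [OF s(1) r(1)] \<alpha>.f_im [OF cN(1)] by blast
  qed
  have gen: "\<alpha> x \<in> ?T" if "x \<in> W q" for q x
    using that
  proof (induction q arbitrary: x)
    case 0
    show ?case
    proof (rule step [OF "0.prems"])
      fix z assume "z \<in> W 0" "\<beta> 0 z = \<zero>\<^bsub>E\<^esub>"
      then have "\<alpha> z = \<zero>\<^bsub>H\<^esub>"
        by (rule \<beta>_0)
      then show "\<alpha> z \<in> ?T"
        using LinearCombinations.submodule.zero_closed [OF T] by (simp only:)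
    qed
  next
    case (Suc q)
    show ?case
    proof (rule step [OF Suc.prems])
      fix z assume "z \<in> W (Suc q)" "\<beta> (Suc q) z = \<zero>\<^bsub>E\<^esub>"
      then have "\<alpha> z \<in> \<alpha> ` W q"
        by (rule \<beta>_Suc)
      then obtain z' where "z' \<in> W q" "\<alpha> z = \<alpha> z'"
        by blast
      then show "\<alpha> z \<in> ?T"
        using Suc.IH [of z'] by (simp only:)
    qed
  qed
  have tors: "\<exists>r\<in>H.nonzeros. r \<odot>\<^bsub>H\<^esub> x \<in> H.span (h ` ?I)" if x: "x \<in> carrier H" for x
  proof -
    obtain y where "x = \<alpha> y" "y \<in> carrier N"
      using x unfolding surj [symmetric] by (rule imageE)
    then obtain q where "y \<in> W q"
      using exhaust by blast
    then have "\<alpha> y \<in> ?T"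
      by (rule gen)
    then show ?thesis
      unfolding \<open>x = \<alpha> y\<close> by (simp only: mem_Collect_eq)
  qed
  have "rank_basis R H ?I h"
    unfolding rank_basis_def by (intro conjI ballI ind tors)
  then show ?thesis
    by (intro exI [of _ h])
qed

section \<open>Smooth functions and the chain rule\<close>

lemma eventually_fun_upd_in_open:
  assumes V: "openin (Euclidean_space n) V" and x: "x \<in> V" and i: "i < n"
  shows "\<forall>\<^sub>F t in nhds (x i). x(i := t) \<in> V"
proof -
  have x0: "x k = 0" if "k \<ge> n" for k
    using openin_subset [OF V] x that by (auto simp: topspace_Euclidean_space)
  have "continuous_map euclideanreal (Euclidean_space n) (\<lambda>t. x(i := t))"
    unfolding Euclidean_space_def continuous_map_in_subtopology
  proof
    show "continuous_map euclideanreal (powertop_real UNIV) (\<lambda>t. x(i := t))"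
      unfolding continuous_map_componentwise_UNIV
    proof
      fix k show "continuous_map euclideanreal euclideanreal (\<lambda>t. (x(i := t)) k)"
        by (cases "k = i") (auto intro!: continuous_intros)
    qed
    show "(\<lambda>t. x(i := t)) \<in> topspace euclideanreal \<rightarrow> {x. \<forall>i\<ge>n. x i = 0}"
      using x0 i by auto
  qed
  then have "openin euclideanreal {t \<in> topspace euclideanreal. x(i := t) \<in> V}"
    by (rule openin_continuous_map_preimage) (rule V)
  then have "open {t. x(i := t) \<in> V}"
    by simp
  moreover have "x i \<in> {t. x(i := t) \<in> V}"
    using x by simp
  ultimately show ?thesis
    unfolding eventually_nhds by blast
qed

lemma Euclidean_space_vanish:
  "openin (Euclidean_space n) V \<Longrightarrow> x \<in> V \<Longrightarrow> j \<ge> n \<Longrightarrow> x j = 0"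
  using openin_subset [of "Euclidean_space n" V] by (auto simp: topspace_Euclidean_space)

text \<open>
  In a box the coordinates can be changed one at a time, as the proof of the chain rule requires.
\<close>

lemma open_contains_box:
  assumes V: "openin (Euclidean_space n) V" and y: "y \<in> V"
  shows "\<exists>\<delta>>0. \<forall>z. (\<forall>j\<ge>n. z j = 0) \<and> (\<forall>j<n. \<bar>z j - y j\<bar> < \<delta>) \<longrightarrow> z \<in> V"
proof -
  obtain U where U: "openin (powertop_real UNIV) U" "V = U \<inter> {x. \<forall>i\<ge>n. x i = 0}"
    using V unfolding Euclidean_space_def openin_subtopology by blast
  obtain X where X: "y \<in> (\<Pi>\<^sub>E i\<in>UNIV. X i)" "\<And>i. open (X i)" "(\<Pi>\<^sub>E i\<in>UNIV. X i) \<subseteq> U"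
    using product_topology_open_contains_basis [OF U(1), of y] y U(2) by auto
  have "\<exists>e>0. \<forall>s. \<bar>s - y j\<bar> < e \<longrightarrow> s \<in> X j" for j
    using X(2) [of j] X(1) unfolding open_dist dist_real_def by auto
  then obtain e where e: "\<And>j. e j > 0" "\<And>j s. \<bar>s - y j\<bar> < e j \<Longrightarrow> s \<in> X j"
    by metis
  let ?\<delta> = "Min (insert 1 (e ` {..<n}))"
  have pos: "?\<delta> > 0"
    using e(1) by auto
  moreover have "z \<in> V" if z: "\<forall>j\<ge>n. z j = 0" "\<forall>j<n. \<bar>z j - y j\<bar> < ?\<delta>" for z
  proof -
    have "z j \<in> X j" for j
    proof (cases "j < n")
      case True
      then have "?\<delta> \<le> e j"
        by (intro Min_le) auto
      then show ?thesis
        using e(2) [of "z j" j] z(2) True by force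
    next
      case False
      then show ?thesis
        using e z(1) Euclidean_space_vanish [OF V y, of j] by simp
    qed
    then show ?thesis
      using X(3) z(1) U(2) by auto
  qed
  ultimately show ?thesis by blast
qed

lemma MVT_between:
  fixes f f' :: "real \<Rightarrow> real"
  assumes "\<And>x. min a b \<le> x \<Longrightarrow> x \<le> max a b \<Longrightarrow> DERIV f x :> f' x"
  shows "\<exists>z. min a b \<le> z \<and> z \<le> max a b \<and> f b - f a = (b - a) * f' z"
proof -
  consider "a < b" | "a = b" | "b < a" by linarith
  then show ?thesis
  proof cases
    case 1
    have "DERIV f x :> f' x" if "a \<le> x" "x \<le> b" for x
      using assms [of x] that 1 by simp
    from MVT2 [OF 1 this] obtain z where "a < z" "z < b" "f b - f a = (b - a) * f' z"
      by blast
    then show ?thesis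
      by (intro exI [of _ z]) auto
  next
    case 2
    then show ?thesis by auto
  next
    case 3
    have "DERIV f x :> f' x" if "b \<le> x" "x \<le> a" for x
      using assms [of x] that 3 by simp
    from MVT2 [OF 3 this] obtain z where "b < z" "z < a" "f a - f b = (a - b) * f' z"
      by blast
    then show ?thesis
      by (intro exI [of _ z]) (auto simp: algebra_simps)
  qed
qed

text \<open>
  The increment of \<open>h\<close> along the curve is a telescoping sum over the coordinates.  By the mean value
  theorem, its \<open>k\<close>-th term is the increment of the \<open>k\<close>-th coordinate times the \<open>k\<close>-th partial
  derivative at an intermediate point, and the latter converges because the partial derivative is
  continuous.
\<close>

lemma has_derivative_along_curve:
  assumes V: "openin (Euclidean_space m) V"
    and diff: "\<And>j y. j < m \<Longrightarrow> y \<in> V \<Longrightarrow> (\<lambda>s. h (y(j := s))) differentiable (at (y j))"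
    and cont: "\<And>j. j < m \<Longrightarrow> continuous_map (subtopology (Euclidean_space m) V) euclideanreal (partial_deriv j h)"
    and \<gamma>V: "\<forall>\<^sub>F t in nhds t0. \<gamma> t \<in> V"
    and \<gamma>: "\<And>j. j < m \<Longrightarrow> ((\<lambda>t. \<gamma> t j) has_real_derivative d j) (at t0)"
  shows "((\<lambda>t. h (\<gamma> t)) has_real_derivative (\<Sum>j<m. partial_deriv j h (\<gamma> t0) * d j)) (at t0)"
proof -
  define y where "y = \<gamma> t0"
  have y: "y \<in> V"
    using \<gamma>V unfolding y_def by (rule eventually_nhds_x_imp_x)
  have y0: "y j = 0" if "j \<ge> m" for j
    by (rule Euclidean_space_vanish [OF V y that])
  \<comment> \<open>Only the first \<open>k\<close> coordinates follow the curve; the others stay at their values at \<open>t0\<close>.\<close>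
  define \<eta> where "\<eta> = (\<lambda>k t j. if j < k then \<gamma> t j else y j)"
  have near: "\<forall>\<^sub>F t in at t0. \<forall>j<m. \<bar>\<gamma> t j - y j\<bar> < \<delta>" if "\<delta> > 0" for \<delta>
  proof -
    have "\<forall>\<^sub>F t in at t0. \<bar>\<gamma> t j - y j\<bar> < \<delta>" if "j < m" for j
    proof -
      have "((\<lambda>t. \<gamma> t j) \<longlongrightarrow> \<gamma> t0 j) (at t0)"
        using DERIV_isCont [OF \<gamma> [OF that]] by (simp add: isCont_def)
      then show ?thesis
        using \<open>\<delta> > 0\<close> unfolding tendsto_iff dist_real_def y_def by blast
    qed
    then have "\<forall>\<^sub>F t in at t0. \<forall>j\<in>{..<m}. \<bar>\<gamma> t j - y j\<bar> < \<delta>"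
      by (intro eventually_ball_finite) auto
    then show ?thesis
      by (rule eventually_mono) auto
  qed
  have step: "((\<lambda>t. h (\<eta> (Suc k) t) - h (\<eta> k t)) has_real_derivative partial_deriv k h y * d k) (at t0)"
    if k: "k < m" for k
  proof -
    let ?u = "\<lambda>t. h (\<eta> (Suc k) t) - h (\<eta> k t)"
    \<comment> \<open>The difference quotient with respect to the \<open>k\<close>-th coordinate, completed by its limit.\<close>
    define q where "q = (\<lambda>t. if \<gamma> t k = y k then partial_deriv k h y else ?u t / (\<gamma> t k - y k))"
    have u: "?u t = (\<gamma> t k - y k) * q t" for t
    proof (cases "\<gamma> t k = y k")
      case True
      then have "\<eta> (Suc k) t = \<eta> k t"
        by (auto simp: \<eta>_def fun_eq_iff less_Suc_eq)
      then show ?thesis using True by simp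
    qed (simp add: q_def)
    have "(q \<longlongrightarrow> partial_deriv k h y) (at t0)"
      unfolding tendsto_iff
    proof (intro allI impI)
      fix \<epsilon> :: real assume "\<epsilon> > 0"
      let ?W = "{z \<in> topspace (subtopology (Euclidean_space m) V). partial_deriv k h z \<in> ball (partial_deriv k h y) \<epsilon>}"
      have "openin (subtopology (Euclidean_space m) V) ?W"
        by (rule openin_continuous_map_preimage [OF cont [OF k]]) simp
      then have W: "openin (Euclidean_space m) ?W"
        using V openin_trans_full by blast
      have yW: "y \<in> ?W"
        using y \<open>\<epsilon> > 0\<close> openin_subset [OF V] by auto
      obtain \<delta> where \<delta>: "\<delta> > 0" "\<And>z. (\<forall>j\<ge>m. z j = 0) \<Longrightarrow> (\<forall>j<m. \<bar>z j - y j\<bar> < \<delta>) \<Longrightarrow> z \<in> ?W"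
        using open_contains_box [OF W yW] by blast
      have "dist (q t) (partial_deriv k h y) < \<epsilon>" if t: "\<forall>j<m. \<bar>\<gamma> t j - y j\<bar> < \<delta>" for t
      proof (cases "\<gamma> t k = y k")
        case True
        then show ?thesis using \<open>\<epsilon> > 0\<close> by (simp add: q_def)
      next
        case False
        let ?z = "\<lambda>s. (\<eta> k t)(k := s)"
        have zW: "?z s \<in> ?W" if s: "min (y k) (\<gamma> t k) \<le> s" "s \<le> max (y k) (\<gamma> t k)" for s
        proof (rule \<delta>(2))
          show "\<forall>j\<ge>m. ?z s j = 0"
            using k y0 by (auto simp: \<eta>_def)
          have "\<bar>s - y k\<bar> \<le> \<bar>\<gamma> t k - y k\<bar>"
            using s by (auto simp: min_def max_def split: if_splits)
          then show "\<forall>j<m. \<bar>?z s j - y j\<bar> < \<delta>"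
            using t k \<delta>(1) by (auto simp: \<eta>_def intro: le_less_trans)
        qed
        have "((\<lambda>s. h (?z s)) has_real_derivative partial_deriv k h (?z s)) (at s)"
          if s: "min (y k) (\<gamma> t k) \<le> s" "s \<le> max (y k) (\<gamma> t k)" for s
        proof -
          have "?z s \<in> V"
            using zW [OF s] by simp
          from diff [OF k this] show ?thesis
            unfolding DERIV_deriv_iff_real_differentiable [symmetric] by (simp add: partial_deriv_def)
        qed
        then obtain s where s: "min (y k) (\<gamma> t k) \<le> s" "s \<le> max (y k) (\<gamma> t k)"
          and e: "h (?z (\<gamma> t k)) - h (?z (y k)) = (\<gamma> t k - y k) * partial_deriv k h (?z s)"
          using MVT_between [of "y k" "\<gamma> t k" "\<lambda>s. h (?z s)" "\<lambda>s. partial_deriv k h (?z s)"] by blast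
        have "?z (\<gamma> t k) = \<eta> (Suc k) t" "?z (y k) = \<eta> k t"
          by (auto simp: \<eta>_def fun_eq_iff less_Suc_eq)
        then have "q t = partial_deriv k h (?z s)"
          using e False by (simp add: q_def)
        then show ?thesis
          using zW [OF s] by (simp add: dist_commute)
      qed
      then show "\<forall>\<^sub>F t in at t0. dist (q t) (partial_deriv k h y) < \<epsilon>"
        using near [OF \<delta>(1)] by (rule eventually_mono [rotated])
    qed
    moreover have "((\<lambda>t. (\<gamma> t k - y k) / (t - t0)) \<longlongrightarrow> d k) (at t0)"
      using \<gamma> [OF k] by (simp add: has_field_derivative_iff y_def)
    ultimately have "((\<lambda>t. q t * ((\<gamma> t k - y k) / (t - t0))) \<longlongrightarrow> partial_deriv k h y * d k) (at t0)"
      by (rule tendsto_mult)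
    moreover have "(\<lambda>t. (?u t - ?u t0) / (t - t0)) = (\<lambda>t. q t * ((\<gamma> t k - y k) / (t - t0)))"
      by (simp only: u) (simp add: y_def mult.commute)
    ultimately show ?thesis
      unfolding has_field_derivative_iff by (simp only: mult.commute)
  qed
  have "((\<lambda>t. h (\<eta> k t)) has_real_derivative (\<Sum>j<k. partial_deriv j h y * d j)) (at t0)" if "k \<le> m" for k
    using that
  proof (induction k)
    case 0
    then show ?case by (simp add: \<eta>_def)
  next
    case (Suc k)
    then have "((\<lambda>t. h (\<eta> k t) + (h (\<eta> (Suc k) t) - h (\<eta> k t))) has_real_derivative
        (\<Sum>j<k. partial_deriv j h y * d j) + partial_deriv k h y * d k) (at t0)"
      by (intro DERIV_add step) auto
    then show ?case by simp
  qed
  then have "((\<lambda>t. h (\<eta> m t)) has_real_derivative (\<Sum>j<m. partial_deriv j h y * d j)) (at t0)"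
    by simp
  moreover have "\<forall>\<^sub>F t in nhds t0. h (\<gamma> t) = h (\<eta> m t)"
    using \<gamma>V
  proof (rule eventually_mono)
    fix t assume "\<gamma> t \<in> V"
    then have "\<gamma> t = \<eta> m t"
      using y0 Euclidean_space_vanish [OF V, of "\<gamma> t"] by (auto simp: \<eta>_def fun_eq_iff)
    then show "h (\<gamma> t) = h (\<eta> m t)" by simp
  qed
  ultimately show ?thesis
    unfolding y_def by (subst DERIV_cong_ev [OF refl _ refl])
qed

text \<open>
  Functions of class \<open>C\<^sup>k\<close>.  The order \<open>k\<close> is what the closure properties below are proved by
  induction on; the lists of directions in \<^const>\<open>smooth_on\<close> are less suited to the product and chain rules.
\<close>

fun times_differentiable :: "nat \<Rightarrow> (nat \<Rightarrow> real) set \<Rightarrow> nat \<Rightarrow> ((nat \<Rightarrow> real) \<Rightarrow> real) \<Rightarrow> bool" where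
  "times_differentiable n V 0 f \<longleftrightarrow> continuous_map (subtopology (Euclidean_space n) V) euclideanreal f"
| "times_differentiable n V (Suc k) f \<longleftrightarrow>
     continuous_map (subtopology (Euclidean_space n) V) euclideanreal f \<and>
     (\<forall>i<n. (\<forall>x\<in>V. (\<lambda>t. f (x(i := t))) differentiable (at (x i))) \<and>
        times_differentiable n V k (partial_deriv i f))"

lemma times_differentiable_continuous:
  "times_differentiable n V k f \<Longrightarrow> continuous_map (subtopology (Euclidean_space n) V) euclideanreal f"
  by (cases k) auto

lemma times_differentiable_Suc:
  "times_differentiable n V (Suc k) f \<Longrightarrow> times_differentiable n V k f"
  by (induction k arbitrary: f) auto

lemma partial_deriv_cong:
  assumes V: "openin (Euclidean_space n) V" and x: "x \<in> V" and i: "i < n"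
    and eq: "\<And>x. x \<in> V \<Longrightarrow> f x = g x"
  shows "partial_deriv i f x = partial_deriv i g x"
    and "(\<lambda>t. f (x(i := t))) differentiable (at (x i)) \<longleftrightarrow> (\<lambda>t. g (x(i := t))) differentiable (at (x i))"
proof -
  have ev: "\<forall>\<^sub>F t in nhds (x i). f (x(i := t)) = g (x(i := t))"
    by (rule eventually_mono [OF eventually_fun_upd_in_open [OF V x i]]) (rule eq)
  show "partial_deriv i f x = partial_deriv i g x"
    unfolding partial_deriv_def by (rule deriv_cong_ev [OF ev refl])
  show "(\<lambda>t. f (x(i := t))) differentiable (at (x i)) \<longleftrightarrow> (\<lambda>t. g (x(i := t))) differentiable (at (x i))"
    unfolding real_differentiable_def by (simp only: DERIV_cong_ev [OF refl ev refl])
qed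

lemma times_differentiable_cong:
  assumes V: "openin (Euclidean_space n) V"
    and "\<And>x. x \<in> V \<Longrightarrow> f x = g x" "times_differentiable n V k f"
  shows "times_differentiable n V k g"
  using assms(2,3)
proof (induction k arbitrary: f g)
  case 0
  then show ?case
    by (auto intro: continuous_map_eq)
next
  case (Suc k)
  have "continuous_map (subtopology (Euclidean_space n) V) euclideanreal g"
    using times_differentiable_continuous [OF Suc.prems(2)]
    by (rule continuous_map_eq) (simp add: Suc.prems(1))
  moreover have "times_differentiable n V k (partial_deriv i g)" if i: "i < n" for i
  proof (rule Suc.IH [of "partial_deriv i f"])
    show "times_differentiable n V k (partial_deriv i f)"
      using Suc.prems(2) i by simp
    show "partial_deriv i f x = partial_deriv i g x" if "x \<in> V" for x
      by (rule partial_deriv_cong(1) [OF V that i Suc.prems(1)])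
  qed
  moreover have "(\<lambda>t. g (x(i := t))) differentiable (at (x i))" if "i < n" "x \<in> V" for i x
  proof -
    have "(\<lambda>t. f (x(i := t))) differentiable (at (x i))"
      using Suc.prems(2) that by simp
    then show ?thesis
      by (rule iffD1 [OF partial_deriv_cong(2) [of n V x i f g, OF V that(2,1)], rotated]) (rule Suc.prems(1))
  qed
  ultimately show ?case by simp
qed

lemma has_partial_derivative:
  assumes "(\<lambda>t. f (x(i := t))) differentiable (at (x i))"
  shows "((\<lambda>t. f (x(i := t))) has_real_derivative partial_deriv i f x) (at (x i))"
  using assms by (simp add: partial_deriv_def DERIV_deriv_iff_real_differentiable)

lemma partial_derivI:
  assumes "((\<lambda>t. f (x(i := t))) has_real_derivative D) (at (x i))"
  shows "partial_deriv i f x = D" "(\<lambda>t. f (x(i := t))) differentiable (at (x i))"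
  using assms by (auto simp: partial_deriv_def DERIV_imp_deriv real_differentiable_def)

lemma times_differentiable_add:
  assumes V: "openin (Euclidean_space n) V"
    and "times_differentiable n V k f" "times_differentiable n V k g"
  shows "times_differentiable n V k (\<lambda>x. f x + g x)"
  using assms(2,3)
proof (induction k arbitrary: f g)
  case 0
  then show ?case by (simp add: continuous_map_add)
next
  case (Suc k)
  have "continuous_map (subtopology (Euclidean_space n) V) euclideanreal (\<lambda>x. f x + g x)"
    using Suc.prems by (intro continuous_map_add times_differentiable_continuous)
  moreover have D: "((\<lambda>t. f (x(i := t)) + g (x(i := t))) has_real_derivative
      partial_deriv i f x + partial_deriv i g x) (at (x i))" if "i < n" "x \<in> V" for i x
    using Suc.prems that by (intro DERIV_add has_partial_derivative) auto
  moreover note P = partial_derivI [of "\<lambda>x. f x + g x", OF D]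
  moreover have "times_differentiable n V k (partial_deriv i (\<lambda>x. f x + g x))" if i: "i < n" for i
  proof (rule times_differentiable_cong [OF V])
    show "times_differentiable n V k (\<lambda>x. partial_deriv i f x + partial_deriv i g x)"
      using Suc.prems i by (intro Suc.IH) auto
    show "partial_deriv i f x + partial_deriv i g x = partial_deriv i (\<lambda>x. f x + g x) x" if "x \<in> V" for x
      using P(1) [OF i that] by simp
  qed
  ultimately show ?case by simp
qed

lemma times_differentiable_mult:
  assumes V: "openin (Euclidean_space n) V"
    and "times_differentiable n V k f" "times_differentiable n V k g"
  shows "times_differentiable n V k (\<lambda>x. f x * g x)"
  using assms(2,3)
proof (induction k arbitrary: f g)
  case 0
  then show ?case by (simp add: continuous_map_real_mult)
next
  case (Suc k)
  have "continuous_map (subtopology (Euclidean_space n) V) euclideanreal (\<lambda>x. f x * g x)"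
    using Suc.prems by (intro continuous_map_real_mult times_differentiable_continuous)
  moreover have D: "((\<lambda>t. f (x(i := t)) * g (x(i := t))) has_real_derivative
      partial_deriv i f x * g x + partial_deriv i g x * f x) (at (x i))" if "i < n" "x \<in> V" for i x
    using DERIV_mult [OF has_partial_derivative [of f x i] has_partial_derivative [of g x i]] Suc.prems that
    by simp
  moreover note P = partial_derivI [of "\<lambda>x. f x * g x", OF D]
  moreover have "times_differentiable n V k (partial_deriv i (\<lambda>x. f x * g x))" if i: "i < n" for i
  proof (rule times_differentiable_cong [OF V])
    show "times_differentiable n V k (\<lambda>x. partial_deriv i f x * g x + partial_deriv i g x * f x)"
    proof (intro times_differentiable_add [OF V] Suc.IH)
      show "times_differentiable n V k f" "times_differentiable n V k g"
        by (rule times_differentiable_Suc, rule Suc.prems)+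
    qed (use Suc.prems i in simp_all)
    show "partial_deriv i f x * g x + partial_deriv i g x * f x = partial_deriv i (\<lambda>x. f x * g x) x"
      if "x \<in> V" for x
      using P(1) [OF i that] by simp
  qed
  ultimately show ?case by simp
qed

lemma times_differentiable_zero: "times_differentiable n V k (\<lambda>x. 0)"
proof (induction k)
  case (Suc k)
  have "partial_deriv i (\<lambda>x. 0) = (\<lambda>x. 0)" for i
    by (simp add: partial_deriv_def fun_eq_iff)
  then show ?case using Suc by simp
qed simp

lemma times_differentiable_sum:
  assumes V: "openin (Euclidean_space n) V" and "finite J" "\<And>j. j \<in> J \<Longrightarrow> times_differentiable n V k (f j)"
  shows "times_differentiable n V k (\<lambda>x. \<Sum>j\<in>J. f j x)"
  using assms(2,3)
  by (induction J rule: finite_induct) (auto simp: times_differentiable_zero times_differentiable_add [OF V])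

lemma smooth_on_partial_deriv:
  assumes "smooth_on n V f" "i < n"
  shows "smooth_on n V (partial_deriv i f)"
  unfolding smooth_on_def
proof
  fix js assume "js \<in> lists {..<n}"
  then have "js @ [i] \<in> lists {..<n}"
    using assms(2) by auto
  then show "continuous_map (subtopology (Euclidean_space n) V) euclideanreal (foldr partial_deriv js (partial_deriv i f)) \<and>
      (\<forall>ia<n. \<forall>x\<in>V. (\<lambda>t. foldr partial_deriv js (partial_deriv i f) (x(ia := t))) differentiable at (x ia))"
    using bspec [OF assms(1) [unfolded smooth_on_def], of "js @ [i]"] by simp
qed

lemma smooth_onD:
  assumes "smooth_on n V f"
  shows "continuous_map (subtopology (Euclidean_space n) V) euclideanreal f"
    and "i < n \<Longrightarrow> x \<in> V \<Longrightarrow> (\<lambda>t. f (x(i := t))) differentiable (at (x i))"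
proof -
  note D = bspec [OF assms [unfolded smooth_on_def], of "[]"]
  show "continuous_map (subtopology (Euclidean_space n) V) euclideanreal f"
    "i < n \<Longrightarrow> x \<in> V \<Longrightarrow> (\<lambda>t. f (x(i := t))) differentiable (at (x i))"
    using D by simp_all
qed

text \<open>
  The last entry of a list of directions is the derivative that is taken first, so the induction over
  the lists starts from their ends.
\<close>

lemma smooth_on_iff_times_differentiable:
  "smooth_on n V f \<longleftrightarrow> (\<forall>k. times_differentiable n V k f)"
proof
  assume "smooth_on n V f"
  then show "\<forall>k. times_differentiable n V k f"
  proof (intro allI)
    fix k show "times_differentiable n V k f"
      using \<open>smooth_on n V f\<close>
      by (induction k arbitrary: f) (auto simp: smooth_onD smooth_on_partial_deriv)
  qed
next
  assume f: "\<forall>k. times_differentiable n V k f"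
  have "\<forall>k. times_differentiable n V k (foldr partial_deriv js f)" if "js \<in> lists {..<n}" for js
    using f that
  proof (induction js arbitrary: f rule: rev_induct)
    case Nil
    then show ?case by simp
  next
    case (snoc i js)
    have "times_differentiable n V (Suc k) f" for k
      using snoc.prems(1) by blast
    then have "\<forall>k. times_differentiable n V k (partial_deriv i f)"
      using snoc.prems(2) by simp
    then show ?case
      using snoc.IH snoc.prems(2) by simp
  qed
  then have "times_differentiable n V (Suc 0) (foldr partial_deriv js f)" if "js \<in> lists {..<n}" for js
    using that by blast
  then show "smooth_on n V f"
    unfolding smooth_on_def by simp
qed

lemma smooth_on_cong:
  assumes V: "openin (Euclidean_space n) V" and "\<And>x. x \<in> V \<Longrightarrow> f x = g x" "smooth_on n V f"
  shows "smooth_on n V g"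
  using assms(3) times_differentiable_cong [of n V f g, OF V assms(2)]
  unfolding smooth_on_iff_times_differentiable by blast

lemma smooth_on_subset:
  assumes "smooth_on n V f" "V' \<subseteq> V"
  shows "smooth_on n V' f"
  using assms unfolding smooth_on_def by (meson continuous_map_from_subtopology_mono subsetD)

lemma smooth_on_local:
  assumes V: "openin (Euclidean_space n) V"
    and loc: "\<And>x. x \<in> V \<Longrightarrow> \<exists>V'. openin (Euclidean_space n) V' \<and> x \<in> V' \<and> V' \<subseteq> V \<and> smooth_on n V' f"
  shows "smooth_on n V f"
  unfolding smooth_on_def
proof (intro ballI conjI allI impI)
  fix js assume js: "js \<in> lists {..<n}"
  let ?f = "foldr partial_deriv js f"
  let ?I = "{V'. openin (Euclidean_space n) V' \<and> V' \<subseteq> V \<and> smooth_on n V' f}"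
  show "continuous_map (subtopology (Euclidean_space n) V) euclideanreal ?f"
  proof (rule pasting_lemma [where I = ?I and T = "\<lambda>V'. V'" and f = "\<lambda>V'. ?f"])
    fix V' assume V': "V' \<in> ?I"
    then show "openin (subtopology (Euclidean_space n) V) V'"
      using V by (simp add: openin_open_subtopology)
    have "continuous_map (subtopology (Euclidean_space n) V') euclideanreal ?f"
      using V' js unfolding smooth_on_def by blast
    then show "continuous_map (subtopology (subtopology (Euclidean_space n) V) V') euclideanreal ?f"
      using V' by (simp add: subtopology_subtopology Int_absorb1)
  next
    fix x assume "x \<in> topspace (subtopology (Euclidean_space n) V)"
    then show "\<exists>V'. V' \<in> ?I \<and> x \<in> V' \<and> ?f x = ?f x"
      using loc [of x] by auto
  qed auto
  fix i x assume "i < n" "x \<in> V"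
  then show "(\<lambda>t. ?f (x(i := t))) differentiable (at (x i))"
    using loc [of x] js unfolding smooth_on_def by blast
qed

text \<open>
  By the chain rule, \<open>\<partial>\<^sub>i(h \<circ> \<Psi>) = \<Sum>\<^sub>j (\<partial>\<^sub>jh \<circ> \<Psi>) \<partial>\<^sub>i\<Psi>\<^sub>j\<close>.  Since \<open>\<partial>\<^sub>jh\<close> is again smooth, the first factors
  are of class \<open>C\<^sup>k\<close> by induction, which makes \<open>h \<circ> \<Psi>\<close> of class \<open>C\<^sup>k\<^sup>+\<^sup>1\<close>.
\<close>

lemma smooth_on_compose:
  assumes V: "openin (Euclidean_space n) V" and V': "openin (Euclidean_space m) V'"
    and \<Psi>V: "\<And>x. x \<in> V \<Longrightarrow> \<Psi> x \<in> V'"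
    and \<Psi>: "\<And>j. j < m \<Longrightarrow> smooth_on n V (\<lambda>x. \<Psi> x j)"
    and h: "smooth_on m V' h"
  shows "smooth_on n V (\<lambda>x. h (\<Psi> x))"
proof -
  have "continuous_map (subtopology (Euclidean_space n) V) (Euclidean_space m) (\<lambda>x j. if j < m then \<Psi> x j else 0)"
    unfolding continuous_map_componentwise_Euclidean_space using \<Psi> smooth_onD(1) by blast
  then have "continuous_map (subtopology (Euclidean_space n) V) (Euclidean_space m) \<Psi>"
    by (rule continuous_map_eq)
      (use Euclidean_space_vanish [OF V' \<Psi>V] in \<open>auto simp: fun_eq_iff\<close>)
  then have \<Psi>c: "continuous_map (subtopology (Euclidean_space n) V) (subtopology (Euclidean_space m) V') \<Psi>"
    using \<Psi>V by (auto simp: continuous_map_in_subtopology)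
  have cont: "continuous_map (subtopology (Euclidean_space n) V) euclideanreal (\<lambda>x. g (\<Psi> x))"
    if "smooth_on m V' g" for g
    using continuous_map_compose [OF \<Psi>c smooth_onD(1) [OF that]] by (simp add: comp_def)
  have D: "((\<lambda>t. g (\<Psi> (x(i := t)))) has_real_derivative
      (\<Sum>j<m. partial_deriv j g (\<Psi> x) * partial_deriv i (\<lambda>x. \<Psi> x j) x)) (at (x i))"
    if g: "smooth_on m V' g" and i: "i < n" and x: "x \<in> V" for g i x
  proof -
    have "((\<lambda>t. g (\<Psi> (x(i := t)))) has_real_derivative
        (\<Sum>j<m. partial_deriv j g (\<Psi> (x(i := x i))) * partial_deriv i (\<lambda>x. \<Psi> x j) x)) (at (x i))"
    proof (rule has_derivative_along_curve [OF V'])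
      show "\<forall>\<^sub>F t in nhds (x i). \<Psi> (x(i := t)) \<in> V'"
        by (rule eventually_mono [OF eventually_fun_upd_in_open [OF V x i]]) (rule \<Psi>V)
      show "((\<lambda>t. \<Psi> (x(i := t)) j) has_real_derivative partial_deriv i (\<lambda>x. \<Psi> x j) x) (at (x i))"
        if "j < m" for j
        using has_partial_derivative [of "\<lambda>x. \<Psi> x j" x i] smooth_onD(2) [OF \<Psi> [OF that] i x] by simp
      show "(\<lambda>s. g (y(j := s))) differentiable (at (y j))" if "j < m" "y \<in> V'" for j y
        by (rule smooth_onD(2) [OF g that])
      show "continuous_map (subtopology (Euclidean_space m) V') euclideanreal (partial_deriv j g)"
        if "j < m" for j
        by (rule smooth_onD(1) [OF smooth_on_partial_deriv [OF g that]])
    qed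
    then show ?thesis by simp
  qed
  have "times_differentiable n V k (\<lambda>x. g (\<Psi> x))" if "smooth_on m V' g" for k g
    using that
  proof (induction k arbitrary: g)
    case 0
    then show ?case using cont by simp
  next
    case (Suc k)
    have "times_differentiable n V k (partial_deriv i (\<lambda>x. g (\<Psi> x)))" if i: "i < n" for i
    proof (rule times_differentiable_cong [OF V])
      show "(\<Sum>j<m. partial_deriv j g (\<Psi> x) * partial_deriv i (\<lambda>x. \<Psi> x j) x) = partial_deriv i (\<lambda>x. g (\<Psi> x)) x"
        if "x \<in> V" for x
        using partial_derivI(1) [of "\<lambda>x. g (\<Psi> x)", OF D [OF Suc.prems i that]] by simp
      show "times_differentiable n V k (\<lambda>x. \<Sum>j<m. partial_deriv j g (\<Psi> x) * partial_deriv i (\<lambda>x. \<Psi> x j) x)"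
      proof (intro times_differentiable_sum [OF V] times_differentiable_mult [OF V])
        fix j assume "j \<in> {..<m}"
        then have j: "j < m" by simp
        show "times_differentiable n V k (\<lambda>x. partial_deriv j g (\<Psi> x))"
          by (rule Suc.IH [OF smooth_on_partial_deriv [OF Suc.prems j]])
        show "times_differentiable n V k (\<lambda>x. partial_deriv i (\<lambda>x. \<Psi> x j) x)"
          using smooth_on_partial_deriv [OF \<Psi> [OF j] i] unfolding smooth_on_iff_times_differentiable by blast
      qed auto
    qed
    then show ?case
      using cont [OF Suc.prems] partial_derivI(2) [of "\<lambda>x. g (\<Psi> x)", OF D [OF Suc.prems]] by simp
  qed
  then show ?thesis
    using h unfolding smooth_on_iff_times_differentiable by blast
qed

lemma smooth_on_const: "smooth_on n V (\<lambda>x. c)"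
proof -
  have "partial_deriv i (\<lambda>x. c) = (\<lambda>x. 0)" for i
    by (simp add: partial_deriv_def fun_eq_iff)
  then have "times_differentiable n V k (\<lambda>x. c)" for k
    by (cases k) (auto simp: times_differentiable_zero)
  then show ?thesis
    by (simp add: smooth_on_iff_times_differentiable)
qed

lemma smooth_on_coordinate: "smooth_on n V (\<lambda>x. x j)"
proof -
  have c: "continuous_map (subtopology (Euclidean_space n) V) euclideanreal (\<lambda>x. x j)"
    unfolding Euclidean_space_def
    by (intro continuous_map_from_subtopology continuous_map_product_projection) simp
  have D: "((\<lambda>t. (x(i := t)) j) has_real_derivative (if i = j then 1 else 0)) (at (x i))" for i and x :: "nat \<Rightarrow> real"
    by auto
  have "partial_deriv i (\<lambda>x. x j) = (\<lambda>x. if i = j then 1 else 0)" for i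
    using partial_derivI(1) [of "\<lambda>x. x j", OF D] by blast
  moreover have "times_differentiable n V k (\<lambda>x. c)" for k c
    using smooth_on_const [of n V c] by (simp add: smooth_on_iff_times_differentiable)
  ultimately have "times_differentiable n V k (\<lambda>x. x j)" for k
    using c partial_derivI(2) [of "\<lambda>x. x j", OF D] by (cases k) auto
  then show ?thesis
    by (simp add: smooth_on_iff_times_differentiable)
qed

lemma smooth_on_lincomb:
  assumes V: "openin (Euclidean_space n) V" and f: "smooth_on n V f" and g: "smooth_on n V g"
  shows "smooth_on n V (\<lambda>x. a * f x + b * g x)"
  using f g smooth_on_const [of n V a] smooth_on_const [of n V b]
  unfolding smooth_on_iff_times_differentiable
  by (auto intro!: times_differentiable_add [OF V] times_differentiable_mult [OF V])

section \<open>Smooth maps between manifolds\<close>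

text \<open>
  This is all that composing smooth maps requires of the manifold in the middle, and it passes to
  products without any appeal to the chain rule.
\<close>

definition open_charts :: "'a mfd \<Rightarrow> bool" where
  "open_charts M \<longleftrightarrow>
     (\<forall>(U, \<phi>) \<in> atlas M. openin (mtop M) U \<and> inj_on \<phi> U \<and>
        (\<forall>S \<subseteq> U. openin (mtop M) S \<longrightarrow> openin (Euclidean_space (mdim M)) (\<phi> ` S))) \<and>
     (\<Union>(U, \<phi>) \<in> atlas M. U) = points M"

lemma open_chartsD:
  assumes "open_charts M" "(U, \<phi>) \<in> atlas M"
  shows "openin (mtop M) U" "inj_on \<phi> U"
    "S \<subseteq> U \<Longrightarrow> openin (mtop M) S \<Longrightarrow> openin (Euclidean_space (mdim M)) (\<phi> ` S)"
  using assms unfolding open_charts_def by blast+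

lemma open_charts_cover:
  assumes "open_charts M" "p \<in> points M"
  obtains U \<phi> where "(U, \<phi>) \<in> atlas M" "p \<in> U"
  using assms unfolding open_charts_def by blast

lemma smooth_manifold_open_charts:
  assumes M: "smooth_manifold M"
  shows "open_charts M"
  unfolding open_charts_def
proof (intro conjI ballI)
  show "(\<Union>(U, \<phi>) \<in> atlas M. U) = points M"
    using M by (simp add: smooth_manifold_def)
  fix c assume c: "c \<in> atlas M"
  obtain U \<phi> where c': "c = (U, \<phi>)" by (cases c)
  have U: "openin (mtop M) U" and \<phi>U: "openin (Euclidean_space (mdim M)) (\<phi> ` U)"
    and hom: "homeomorphic_map (subtopology (mtop M) U) (subtopology (Euclidean_space (mdim M)) (\<phi> ` U)) \<phi>"
    using M c unfolding smooth_manifold_def c' by auto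
  have "inj_on \<phi> U"
    using homeomorphic_imp_injective_map [OF hom] openin_subset [OF U] by (simp add: Int_absorb1)
  moreover have "openin (Euclidean_space (mdim M)) (\<phi> ` S)" if "S \<subseteq> U" "openin (mtop M) S" for S
  proof -
    have "openin (subtopology (mtop M) U) S"
      using that U by (simp add: openin_open_subtopology)
    then have "openin (subtopology (Euclidean_space (mdim M)) (\<phi> ` U)) (\<phi> ` S)"
      using homeomorphic_imp_open_map [OF hom] by (simp add: open_map_def)
    then show ?thesis
      using \<phi>U openin_trans_full by blast
  qed
  ultimately show "case c of (U, \<phi>) \<Rightarrow> openin (mtop M) U \<and> inj_on \<phi> U \<and>
      (\<forall>S \<subseteq> U. openin (mtop M) S \<longrightarrow> openin (Euclidean_space (mdim M)) (\<phi> ` S))"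
    using U by (simp add: c')
qed

lemma openin_box_Euclidean_space:
  assumes A: "openin (Euclidean_space m) A" and B: "openin (Euclidean_space n) B"
  shows "openin (Euclidean_space (m + n)) ((\<lambda>(x, y) i. if i < m then x i else y (i - m)) ` (A \<times> B))"
proof -
  let ?fst = "\<lambda>z i. if i < m then z i else (0::real)"
  let ?snd = "\<lambda>z i. if i < n then z (i + m) else (0::real)"
  let ?E = "Euclidean_space (m + n)"
  have coord: "continuous_map ?E euclideanreal (\<lambda>z. z j)" for j
    using smooth_onD(1) [OF smooth_on_coordinate, of "m + n" "topspace ?E" j] by simp
  have "continuous_map ?E (Euclidean_space m) ?fst" "continuous_map ?E (Euclidean_space n) ?snd"
    unfolding continuous_map_componentwise_Euclidean_space using coord by blast+
  then have "openin ?E {z \<in> topspace ?E. ?fst z \<in> A}" "openin ?E {z \<in> topspace ?E. ?snd z \<in> B}"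
    using A B by (auto intro: openin_continuous_map_preimage)
  then have "openin ?E ({z \<in> topspace ?E. ?fst z \<in> A} \<inter> {z \<in> topspace ?E. ?snd z \<in> B})"
    by (rule openin_Int)
  also have "{z \<in> topspace ?E. ?fst z \<in> A} \<inter> {z \<in> topspace ?E. ?snd z \<in> B} =
      (\<lambda>(x, y) i. if i < m then x i else y (i - m)) ` (A \<times> B)" (is "?L = ?R")
  proof (intro equalityI subsetI)
    fix z assume z: "z \<in> ?L"
    then have "z = (\<lambda>i. if i < m then ?fst z i else ?snd z (i - m))"
      by (auto simp: fun_eq_iff topspace_Euclidean_space)
    then show "z \<in> ?R"
      using z by (intro image_eqI [of _ _ "(?fst z, ?snd z)"]) auto
  next
    fix z assume "z \<in> ?R"
    then obtain x y where xy: "x \<in> A" "y \<in> B" "z = (\<lambda>i. if i < m then x i else y (i - m))"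
      by auto
    have v: "x i = 0" if "i \<ge> m" for i
      by (rule Euclidean_space_vanish [OF A xy(1) that])
    have w: "y i = 0" if "i \<ge> n" for i
      by (rule Euclidean_space_vanish [OF B xy(2) that])
    have fs: "?fst z = x" "?snd z = y"
      using v w by (auto simp: xy(3) fun_eq_iff)
    have "z \<in> topspace ?E"
      using v w by (auto simp: xy(3) topspace_Euclidean_space)
    then show "z \<in> ?L"
      using xy(1,2) by (simp only: fs Int_iff mem_Collect_eq simp_thms)
  qed
  finally show ?thesis .
qed

lemma open_charts_prod:
  assumes M: "open_charts M" and N: "open_charts N"
  shows "open_charts (prod_mfd M N)"
  unfolding open_charts_def
proof (intro conjI ballI)
  show "(\<Union>(U, \<phi>) \<in> atlas (prod_mfd M N). U) = points (prod_mfd M N)"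
  proof (intro equalityI subsetI)
    fix z assume "z \<in> (\<Union>(U, \<phi>) \<in> atlas (prod_mfd M N). U)"
    then show "z \<in> points (prod_mfd M N)"
      using openin_subset [OF open_chartsD(1) [OF M]] openin_subset [OF open_chartsD(1) [OF N]]
      by (fastforce simp: prod_mfd_def)
  next
    fix z assume "z \<in> points (prod_mfd M N)"
    then obtain x y where z: "z = (x, y)" "x \<in> points M" "y \<in> points N"
      by (auto simp: prod_mfd_def)
    obtain U \<phi> where U: "(U, \<phi>) \<in> atlas M" "x \<in> U"
      using open_charts_cover [OF M z(2)] .
    obtain V \<psi> where V: "(V, \<psi>) \<in> atlas N" "y \<in> V"
      using open_charts_cover [OF N z(3)] .
    have "(U \<times> V, \<lambda>(x, y) i. if i < mdim M then \<phi> x i else \<psi> y (i - mdim M)) \<in> atlas (prod_mfd M N)"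
      using U V by (auto simp: prod_mfd_def)
    then show "z \<in> (\<Union>(U, \<phi>) \<in> atlas (prod_mfd M N). U)"
      using z U V by blast
  qed
  fix c assume "c \<in> atlas (prod_mfd M N)"
  then obtain U \<phi> V \<psi> where U: "(U, \<phi>) \<in> atlas M" and V: "(V, \<psi>) \<in> atlas N"
    and c: "c = (U \<times> V, \<lambda>(x, y) i. if i < mdim M then \<phi> x i else \<psi> y (i - mdim M))"
    by (auto simp: prod_mfd_def)
  let ?\<Phi> = "\<lambda>(x, y) i. if i < mdim M then \<phi> x i else \<psi> y (i - mdim M)"
  have van: "\<phi> u i = 0" if "u \<in> U" "i \<ge> mdim M" for u i
    using Euclidean_space_vanish [OF open_chartsD(3) [OF M U order_refl open_chartsD(1) [OF M U]] _ that(2)]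
      that(1) by blast
  have "openin (mtop (prod_mfd M N)) (U \<times> V)"
    using open_chartsD(1) [OF M U] open_chartsD(1) [OF N V]
    by (simp add: prod_mfd_def openin_prod_Times_iff)
  moreover have "inj_on ?\<Phi> (U \<times> V)"
  proof (rule inj_onI, clarify)
    fix u v u' v' assume uv: "u \<in> U" "v \<in> V" "u' \<in> U" "v' \<in> V"
      and e: "(\<lambda>i. if i < mdim M then \<phi> u i else \<psi> v (i - mdim M)) =
        (\<lambda>i. if i < mdim M then \<phi> u' i else \<psi> v' (i - mdim M))"
    have "\<phi> u i = \<phi> u' i" for i
      using fun_cong [OF e, of i] van [of u i] van [of u' i] uv by (cases "i < mdim M") auto
    moreover have "\<psi> v i = \<psi> v' i" for i
      using fun_cong [OF e, of "i + mdim M"] by simp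
    ultimately show "u = u' \<and> v = v'"
      using open_chartsD(2) [OF M U] open_chartsD(2) [OF N V] uv by (auto simp: inj_on_def fun_eq_iff)
  qed
  moreover have "openin (Euclidean_space (mdim M + mdim N)) (?\<Phi> ` S)"
    if S: "S \<subseteq> U \<times> V" "openin (mtop (prod_mfd M N)) S" for S
  proof (subst openin_subopen, intro ballI)
    fix z assume "z \<in> ?\<Phi> ` S"
    then obtain u v where uv: "(u, v) \<in> S" "z = ?\<Phi> (u, v)" by auto
    have "openin (prod_topology (mtop M) (mtop N)) S"
      using S(2) by (simp add: prod_mfd_def)
    then obtain U' V' where U': "openin (mtop M) U'" "u \<in> U'" and V': "openin (mtop N) V'" "v \<in> V'"
      and sub: "U' \<times> V' \<subseteq> S"
      using uv(1) unfolding openin_prod_topology_alt by blast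
    have "U' \<subseteq> U" "V' \<subseteq> V"
      using sub S(1) U'(2) V'(2) by auto
    then have "openin (Euclidean_space (mdim M + mdim N))
        ((\<lambda>(x, y) i. if i < mdim M then x i else y (i - mdim M)) ` (\<phi> ` U' \<times> \<psi> ` V'))"
      using open_chartsD(3) [OF M U] open_chartsD(3) [OF N V] U'(1) V'(1)
      by (intro openin_box_Euclidean_space)
    moreover have "(\<lambda>(x, y) i. if i < mdim M then x i else y (i - mdim M)) ` (\<phi> ` U' \<times> \<psi> ` V') =
        ?\<Phi> ` (U' \<times> V')"
      by (force simp: image_iff)
    ultimately have "openin (Euclidean_space (mdim M + mdim N)) (?\<Phi> ` (U' \<times> V'))"
      by simp
    then show "\<exists>T. openin (Euclidean_space (mdim M + mdim N)) T \<and> z \<in> T \<and> T \<subseteq> ?\<Phi> ` S"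
      using uv(2) U'(2) V'(2) sub by blast
  qed
  ultimately show "case c of (U, \<phi>) \<Rightarrow> openin (mtop (prod_mfd M N)) U \<and> inj_on \<phi> U \<and>
      (\<forall>S \<subseteq> U. openin (mtop (prod_mfd M N)) S \<longrightarrow>
        openin (Euclidean_space (mdim (prod_mfd M N))) (\<phi> ` S))"
    by (simp add: c prod_mfd_def)
qed

lemma smooth_mapD:
  assumes "smooth_map M N F"
  shows "continuous_map (mtop M) (mtop N) F"
    and "(U, \<phi>) \<in> atlas M \<Longrightarrow> (V, \<psi>) \<in> atlas N \<Longrightarrow> i < mdim N \<Longrightarrow>
      smooth_on (mdim M) (\<phi> ` (U \<inter> F -` V)) (\<lambda>x. \<psi> (F (inv_into U \<phi> x)) i)"
  using assms unfolding smooth_map_def by blast+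

text \<open>
  The common core of two facts: with \<open>h\<close> a coordinate of a second map, composites of smooth maps are
  smooth; with \<open>h\<close> a smooth function, its pullback is smooth.  Near a given point the map runs within
  a single chart of \<open>N\<close>, where both factors are smooth functions on Euclidean open sets.
\<close>

lemma smooth_on_chart_compose:
  assumes M: "open_charts M" and N: "open_charts N" and F: "smooth_map M N F"
    and U: "(U, \<phi>) \<in> atlas M" and S: "openin (mtop M) S" "S \<subseteq> U"
    and T: "openin (mtop N) T" "F ` S \<subseteq> T"
    and h: "\<And>V \<psi>. (V, \<psi>) \<in> atlas N \<Longrightarrow> smooth_on (mdim N) (\<psi> ` (V \<inter> T)) (\<lambda>y. h (inv_into V \<psi> y))"
  shows "smooth_on (mdim M) (\<phi> ` S) (\<lambda>x. h (F (inv_into U \<phi> x)))"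
proof (rule smooth_on_local)
  show "openin (Euclidean_space (mdim M)) (\<phi> ` S)"
    by (rule open_chartsD(3) [OF M U S(2,1)])
  fix x assume "x \<in> \<phi> ` S"
  then obtain u where u: "u \<in> S" "x = \<phi> u" by blast
  have "F u \<in> points N"
    using T u(1) openin_subset [OF T(1)] by blast
  then obtain V \<psi> where V: "(V, \<psi>) \<in> atlas N" "F u \<in> V"
    by (rule open_charts_cover [OF N])
  note injU = open_chartsD(2) [OF M U] and injV = open_chartsD(2) [OF N V(1)]
  define S' where "S' = S \<inter> {p \<in> points M. F p \<in> V}"
  have S': "openin (mtop M) S'" "S' \<subseteq> U" "S' \<subseteq> S"
    unfolding S'_def using S
    by (auto intro!: openin_Int openin_continuous_map_preimage [OF smooth_mapD(1) [OF F] open_chartsD(1) [OF N V(1)]])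
  have opS': "openin (Euclidean_space (mdim M)) (\<phi> ` S')"
    by (rule open_chartsD(3) [OF M U S'(2,1)])
  have inv: "inv_into U \<phi> (\<phi> p) = p" if "p \<in> S'" for p
    using injU S'(2) that by (auto simp: inv_into_f_f)
  let ?\<Psi> = "\<lambda>x. \<psi> (F (inv_into U \<phi> x))"
  have opVT: "openin (Euclidean_space (mdim N)) (\<psi> ` (V \<inter> T))"
    using open_chartsD(1) [OF N V(1)] T(1) by (intro open_chartsD(3) [OF N V(1)]) auto
  have "smooth_on (mdim M) (\<phi> ` S') (\<lambda>x. h (inv_into V \<psi> (?\<Psi> x)))"
  proof (rule smooth_on_compose [OF opS' opVT _ _ h [OF V(1)]])
    show "?\<Psi> x \<in> \<psi> ` (V \<inter> T)" if "x \<in> \<phi> ` S'" for x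
      using that inv T(2) S'(3) by (auto simp: S'_def)
    show "smooth_on (mdim M) (\<phi> ` S') (\<lambda>x. ?\<Psi> x j)" if "j < mdim N" for j
      by (rule smooth_on_subset [OF smooth_mapD(2) [OF F U V(1) that]]) (use S'(2) in \<open>auto simp: S'_def\<close>)
  qed
  then have "smooth_on (mdim M) (\<phi> ` S') (\<lambda>x. h (F (inv_into U \<phi> x)))"
    by (rule smooth_on_cong [OF opS', rotated]) (use inv injV in \<open>auto simp: S'_def inv_into_f_f\<close>)
  moreover have "x \<in> \<phi> ` S'"
    using u V(2) S openin_subset [OF S(1)] by (auto simp: S'_def)
  ultimately show "\<exists>V'. openin (Euclidean_space (mdim M)) V' \<and> x \<in> V' \<and> V' \<subseteq> \<phi> ` S \<and>
      smooth_on (mdim M) V' (\<lambda>x. h (F (inv_into U \<phi> x)))"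
    using opS' S'(3) by blast
qed

lemma smooth_map_compose:
  assumes M: "open_charts M" and N: "open_charts N" and K: "open_charts K"
    and F: "smooth_map M N F" and H: "smooth_map N K H"
  shows "smooth_map M K (\<lambda>x. H (F x))"
  unfolding smooth_map_def
proof (intro conjI)
  show c: "continuous_map (mtop M) (mtop K) (\<lambda>x. H (F x))"
    using continuous_map_compose [OF smooth_mapD(1) [OF F] smooth_mapD(1) [OF H]] by (simp add: comp_def)
  show "\<forall>(U, \<phi>)\<in>atlas M. \<forall>(W, \<kappa>)\<in>atlas K. \<forall>i<mdim K.
      smooth_on (mdim M) (\<phi> ` (U \<inter> (\<lambda>x. H (F x)) -` W)) (\<lambda>x. \<kappa> (H (F (inv_into U \<phi> x))) i)"
  proof (clarify)
    fix U \<phi> W \<kappa> i assume U: "(U, \<phi>) \<in> atlas M" and W: "(W, \<kappa>) \<in> atlas K" and i: "i < mdim K"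
    let ?T = "{q \<in> points N. H q \<in> W}"
    have UM: "U \<subseteq> points M"
      by (rule openin_subset [OF open_chartsD(1) [OF M U]])
    have "U \<inter> (\<lambda>x. H (F x)) -` W = U \<inter> {p \<in> points M. H (F p) \<in> W}"
      using UM by auto
    moreover have "openin (mtop M) (U \<inter> {p \<in> points M. H (F p) \<in> W})"
      by (intro openin_Int open_chartsD(1) [OF M U]
          openin_continuous_map_preimage [OF c open_chartsD(1) [OF K W]])
    ultimately have op: "openin (mtop M) (U \<inter> (\<lambda>x. H (F x)) -` W)"
      by simp
    show "smooth_on (mdim M) (\<phi> ` (U \<inter> (\<lambda>x. H (F x)) -` W)) (\<lambda>x. \<kappa> (H (F (inv_into U \<phi> x))) i)"
    proof (rule smooth_on_chart_compose [OF M N F U op, where T = ?T and h = "\<lambda>q. \<kappa> (H q) i"])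
      show "openin (mtop N) ?T"
        by (rule openin_continuous_map_preimage [OF smooth_mapD(1) [OF H] open_chartsD(1) [OF K W]])
      show "F ` (U \<inter> (\<lambda>x. H (F x)) -` W) \<subseteq> ?T"
        using UM continuous_map_funspace [OF smooth_mapD(1) [OF F]] by auto
      show "smooth_on (mdim N) (\<psi> ` (V \<inter> ?T)) (\<lambda>y. \<kappa> (H (inv_into V \<psi> y)) i)"
        if "(V, \<psi>) \<in> atlas N" for V \<psi>
        by (rule smooth_on_subset [OF smooth_mapD(2) [OF H that W i]]) auto
    qed auto
  qed
qed

lemma smooth_functions_pullback:
  assumes M: "open_charts M" and N: "open_charts N" and F: "smooth_map M N F"
    and f: "f \<in> smooth_functions N"
  shows "(\<lambda>p. if p \<in> points M then f (F p) else 0) \<in> smooth_functions M"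
proof -
  have "smooth_on (mdim M) (\<phi> ` U) (\<lambda>x. if inv_into U \<phi> x \<in> points M then f (F (inv_into U \<phi> x)) else 0)"
    if U: "(U, \<phi>) \<in> atlas M" for U \<phi>
  proof -
    have UM: "U \<subseteq> points M"
      by (rule openin_subset [OF open_chartsD(1) [OF M U]])
    have opU: "openin (Euclidean_space (mdim M)) (\<phi> ` U)"
      by (rule open_chartsD(3) [OF M U order_refl open_chartsD(1) [OF M U]])
    have "smooth_on (mdim M) (\<phi> ` U) (\<lambda>x. f (F (inv_into U \<phi> x)))"
    proof (rule smooth_on_chart_compose [OF M N F U open_chartsD(1) [OF M U] order_refl, where T = "points N"])
      show "F ` U \<subseteq> points N"
        using UM continuous_map_funspace [OF smooth_mapD(1) [OF F]] by auto
      show "smooth_on (mdim N) (\<psi> ` (V \<inter> points N)) (\<lambda>y. f (inv_into V \<psi> y))"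
        if "(V, \<psi>) \<in> atlas N" for V \<psi>
      proof -
        have "smooth_on (mdim N) (\<psi> ` V) (\<lambda>y. f (inv_into V \<psi> y))"
          using f that by (auto simp: smooth_functions_def)
        then show ?thesis
          by (rule smooth_on_subset) auto
      qed
    qed simp
    then show ?thesis
      by (rule smooth_on_cong [OF opU, rotated]) (use UM inv_into_into [of _ \<phi> U] in auto)
  qed
  then show ?thesis
    by (auto simp: smooth_functions_def)
qed

lemma smooth_functions_mult:
  assumes M: "open_charts M" and f: "f \<in> smooth_functions M" and g: "g \<in> smooth_functions M"
  shows "(\<lambda>p. f p * g p) \<in> smooth_functions M"
proof -
  have "smooth_on (mdim M) (\<phi> ` U) (\<lambda>x. f (inv_into U \<phi> x) * g (inv_into U \<phi> x))"
    if U: "(U, \<phi>) \<in> atlas M" for U \<phi>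
    using times_differentiable_mult [OF open_chartsD(3) [OF M U order_refl open_chartsD(1) [OF M U]]] f g U
    unfolding smooth_on_iff_times_differentiable smooth_functions_def by blast
  then show ?thesis
    using f by (auto simp: smooth_functions_def)
qed

lemma smooth_map_pair:
  assumes F: "smooth_map P M F" and H: "smooth_map P N H"
  shows "smooth_map P (prod_mfd M N) (\<lambda>x. (F x, H x))"
  unfolding smooth_map_def
proof (intro conjI)
  show "continuous_map (mtop P) (mtop (prod_mfd M N)) (\<lambda>x. (F x, H x))"
    using smooth_mapD(1) [OF F] smooth_mapD(1) [OF H] by (simp add: prod_mfd_def continuous_map_pairedI)
  show "\<forall>(Q, \<theta>)\<in>atlas P. \<forall>(W, \<kappa>)\<in>atlas (prod_mfd M N). \<forall>i<mdim (prod_mfd M N).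
      smooth_on (mdim P) (\<theta> ` (Q \<inter> (\<lambda>x. (F x, H x)) -` W)) (\<lambda>x. \<kappa> (F (inv_into Q \<theta> x), H (inv_into Q \<theta> x)) i)"
  proof (clarify)
    fix Q \<theta> W \<kappa> i assume Q: "(Q, \<theta>) \<in> atlas P" and W: "(W, \<kappa>) \<in> atlas (prod_mfd M N)"
      and i: "i < mdim (prod_mfd M N)"
    obtain U \<phi> V \<psi> where U: "(U, \<phi>) \<in> atlas M" and V: "(V, \<psi>) \<in> atlas N"
      and c: "W = U \<times> V" "\<kappa> = (\<lambda>(x, y) i. if i < mdim M then \<phi> x i else \<psi> y (i - mdim M))"
      using W by (auto simp: prod_mfd_def)
    let ?S = "\<theta> ` (Q \<inter> (\<lambda>x. (F x, H x)) -` W)"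
    show "smooth_on (mdim P) ?S (\<lambda>x. \<kappa> (F (inv_into Q \<theta> x), H (inv_into Q \<theta> x)) i)"
    proof (cases "i < mdim M")
      case True
      have "smooth_on (mdim P) ?S (\<lambda>x. \<phi> (F (inv_into Q \<theta> x)) i)"
        by (rule smooth_on_subset [OF smooth_mapD(2) [OF F Q U True]]) (auto simp: c)
      then show ?thesis
        using True by (simp add: c)
    next
      case False
      then have "i - mdim M < mdim N"
        using i by (simp add: prod_mfd_def)
      then have "smooth_on (mdim P) ?S (\<lambda>x. \<psi> (H (inv_into Q \<theta> x)) (i - mdim M))"
        by (rule smooth_on_subset [OF smooth_mapD(2) [OF H Q V]]) (auto simp: c)
      then show ?thesis
        using False by (simp add: c)
    qed
  qed
qed

lemma smooth_map_const: "c \<in> points N \<Longrightarrow> smooth_map M N (\<lambda>x. c)"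
  by (auto simp: smooth_map_def smooth_on_const)

lemma smooth_map_id: "smooth_manifold M \<Longrightarrow> smooth_map M M (\<lambda>x. x)"
  unfolding smooth_map_def smooth_manifold_def vimage_ident by auto

lemma zero_smooth_function: "(\<lambda>p. 0) \<in> smooth_functions M"
  by (auto simp: smooth_functions_def smooth_on_const)

lemma smooth_functions_lincomb:
  assumes M: "smooth_manifold M" and f: "f \<in> smooth_functions M" and g: "g \<in> smooth_functions M"
  shows "(\<lambda>p. a * f p + b * g p) \<in> smooth_functions M"
proof -
  have "smooth_on (mdim M) (\<phi> ` U) (\<lambda>x. a * f (inv_into U \<phi> x) + b * g (inv_into U \<phi> x))"
    if "(U, \<phi>) \<in> atlas M" for U \<phi>
    using that M f g
    by (intro smooth_on_lincomb) (auto simp: smooth_manifold_def smooth_functions_def)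
  then show ?thesis
    using f g by (auto simp: smooth_functions_def)
qed

lemma smooth_functions_sum:
  assumes M: "smooth_manifold M" and "finite J" "\<And>j. j \<in> J \<Longrightarrow> f j \<in> smooth_functions M"
  shows "(\<lambda>p. \<Sum>j\<in>J. a j * f j p) \<in> smooth_functions M"
  using assms(2,3)
proof (induction J rule: finite_induct)
  case empty
  then show ?case by (simp add: zero_smooth_function)
next
  case (insert j J)
  then show ?case
    using smooth_functions_lincomb [OF M, of "f j" "\<lambda>p. \<Sum>j\<in>J. a j * f j p" "a j" 1] by simp
qed

section \<open>The adjoint action on the Lie algebra\<close>

lemma vector_field_lincomb:
  assumes "Y \<in> vector_fields M" "f \<in> smooth_functions M" "g \<in> smooth_functions M"
  shows "Y (\<lambda>p. a * f p + b * g p) = (\<lambda>p. a * Y f p + b * Y g p)"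
  using assms by (simp add: vector_fields_def)

lemma vector_fields_add_scale:
  assumes M: "smooth_manifold M" and X: "X \<in> vector_fields M" and Y: "Y \<in> vector_fields M"
  shows "(\<lambda>f p. a * X f p + b * Y f p) \<in> vector_fields M"
  unfolding vector_fields_def
proof (intro CollectI conjI allI ballI impI)
  fix f assume "f \<notin> smooth_functions M"
  then show "(\<lambda>p. a * X f p + b * Y f p) = (\<lambda>p. 0)"
    using X Y by (simp add: vector_fields_def)
next
  fix f assume "f \<in> smooth_functions M"
  then show "(\<lambda>p. a * X f p + b * Y f p) \<in> smooth_functions M"
    using X Y by (intro smooth_functions_lincomb M) (auto simp: vector_fields_def)
next
  fix f g c d assume "f \<in> smooth_functions M" "g \<in> smooth_functions M"
  then show "(\<lambda>p. a * X (\<lambda>p. c * f p + d * g p) p + b * Y (\<lambda>p. c * f p + d * g p) p) =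
      (\<lambda>p. c * (a * X f p + b * Y f p) + d * (a * X g p + b * Y g p))"
    by (simp add: vector_field_lincomb [OF X] vector_field_lincomb [OF Y] algebra_simps)
next
  fix f g assume "f \<in> smooth_functions M" "g \<in> smooth_functions M"
  then have "X (\<lambda>p. f p * g p) = (\<lambda>p. f p * X g p + g p * X f p)"
    "Y (\<lambda>p. f p * g p) = (\<lambda>p. f p * Y g p + g p * Y f p)"
    using X Y by (auto simp: vector_fields_def)
  then show "(\<lambda>p. a * X (\<lambda>p. f p * g p) p + b * Y (\<lambda>p. f p * g p) p) =
      (\<lambda>p. f p * (a * X g p + b * Y g p) + g p * (a * X f p + b * Y f p))"
    by (simp add: algebra_simps)
qed

lemma zero_vector_field: "(\<lambda>f p. 0) \<in> vector_fields M"
  by (simp add: vector_fields_def zero_smooth_function)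

lemma pushforward_lincomb:
  "pushforward M \<phi> (\<lambda>f p. a * X f p + b * Y f p) =
   (\<lambda>f p. a * pushforward M \<phi> X f p + b * pushforward M \<phi> Y f p)"
  by (auto simp: pushforward_def fun_eq_iff)

lemma lie_algebra_lincomb:
  assumes G: "lie_group G" and X: "X \<in> lie_algebra G" and Y: "Y \<in> lie_algebra G"
  shows "(\<lambda>f p. a * X f p + b * Y f p) \<in> lie_algebra G"
  using X Y G unfolding lie_algebra_def lie_group_def
  by (simp add: vector_fields_add_scale pushforward_lincomb)

lemma zero_in_lie_algebra: "(\<lambda>f p. 0) \<in> lie_algebra G"
  by (auto simp: lie_algebra_def zero_vector_field pushforward_def fun_eq_iff)

text \<open>
  This extends homogeneity of polynomial functions to all arguments: outside the Lie algebra they are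
  \<open>0\<close>, and a nonzero multiple of such an argument is again outside.
\<close>

lemma lie_algebra_scale_iff:
  assumes G: "lie_group G" and t: "t \<noteq> 0"
  shows "(\<lambda>f p. t * X f p) \<in> lie_algebra G \<longleftrightarrow> X \<in> lie_algebra G"
proof
  assume "X \<in> lie_algebra G"
  then show "(\<lambda>f p. t * X f p) \<in> lie_algebra G"
    using lie_algebra_lincomb [OF G, of X X t 0] by simp
next
  assume "(\<lambda>f p. t * X f p) \<in> lie_algebra G" (is "?Y \<in> _")
  then show "X \<in> lie_algebra G"
    using lie_algebra_lincomb [OF G, of ?Y ?Y "1 / t" 0] t by simp
qed

lemma Ad_scale: "Ad G g (\<lambda>f p. t * X f p) = (\<lambda>f p. t * Ad G g X f p)"
  using pushforward_lincomb [of _ _ t X 0 X] by (simp add: Ad_def)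

lemma lie_group_smooth_mult:
  assumes G: "lie_group G" and F: "smooth_map (mfd_of G) (mfd_of G) F" and H: "smooth_map (mfd_of G) (mfd_of G) H"
  shows "smooth_map (mfd_of G) (mfd_of G) (\<lambda>x. F x \<otimes>\<^bsub>G\<^esub> H x)"
proof -
  have op: "open_charts (mfd_of G)"
    using G by (intro smooth_manifold_open_charts) (simp add: lie_group_def)
  have "smooth_map (prod_mfd (mfd_of G) (mfd_of G)) (mfd_of G) (\<lambda>(x, y). x \<otimes>\<^bsub>G\<^esub> y)"
    using G by (simp add: lie_group_def)
  from smooth_map_compose [OF op open_charts_prod [OF op op] op smooth_map_pair [OF F H] this]
  show ?thesis by simp
qed

lemma fun_pullback_smooth:
  assumes G: "lie_group G" and F: "smooth_map (mfd_of G) (mfd_of G) F" and f: "f \<in> smooth_functions (mfd_of G)"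
  shows "fun_pullback (mfd_of G) F f \<in> smooth_functions (mfd_of G)"
proof -
  have op: "open_charts (mfd_of G)"
    using G by (intro smooth_manifold_open_charts) (simp add: lie_group_def)
  show ?thesis
    using smooth_functions_pullback [OF op op F f] by (simp add: fun_pullback_def)
qed

text \<open>
  Let \<open>c\<^sub>g\<close> denote conjugation by \<open>g\<close>.  It is smooth, so transporting derivations along it gives
  derivations.  Left invariance is preserved because \<open>L\<^sub>a \<circ> c\<^sub>g = c\<^sub>g \<circ> L\<^sub>b\<close> with \<open>b = g\<^sup>-\<^sup>1 a g\<close>, and the
  original field is invariant under \<open>L\<^sub>b\<close>.
\<close>

lemma Ad_in_lie_algebra:
  assumes G: "lie_group G" and g: "g \<in> carrier G" and X: "X \<in> lie_algebra G"
  shows "Ad G g X \<in> lie_algebra G"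
proof -
  interpret group G
    using G by (simp add: lie_group_def)
  let ?M = "mfd_of G"
  let ?S = "smooth_functions ?M"
  have car: "points ?M = carrier G"
    using G by (simp add: lie_group_def)
  have M: "smooth_manifold ?M"
    using G by (simp add: lie_group_def)
  define conj where "conj = (\<lambda>a x. a \<otimes>\<^bsub>G\<^esub> x \<otimes>\<^bsub>G\<^esub> inv\<^bsub>G\<^esub> a)"
  have conj_closed: "conj a x \<in> carrier G" if "a \<in> carrier G" "x \<in> carrier G" for a x
    using that by (simp add: conj_def)
  have cancel: "a \<otimes>\<^bsub>G\<^esub> (inv\<^bsub>G\<^esub> a \<otimes>\<^bsub>G\<^esub> x) = x" "inv\<^bsub>G\<^esub> a \<otimes>\<^bsub>G\<^esub> (a \<otimes>\<^bsub>G\<^esub> x) = x"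
    if "a \<in> carrier G" "x \<in> carrier G" for a x
    using that by (simp_all flip: m_assoc)
  have conj_inv: "conj a (conj (inv\<^bsub>G\<^esub> a) x) = x" "conj (inv\<^bsub>G\<^esub> a) (conj a x) = x"
    if "a \<in> carrier G" "x \<in> carrier G" for a x
    using that by (simp_all add: conj_def m_assoc cancel)
  have bij: "inv_into (carrier G) (conj a) x = conj (inv\<^bsub>G\<^esub> a) x" if "a \<in> carrier G" "x \<in> carrier G" for a x
  proof (rule inv_into_f_eq)
    show "inj_on (conj a) (carrier G)"
      using conj_inv(2) [OF that(1)] by (rule inj_on_inverseI)
  qed (use that conj_inv conj_closed in auto)
  have smooth_conj: "smooth_map ?M ?M (conj a)" if "a \<in> carrier G" for a
    unfolding conj_def using that car
    by (intro lie_group_smooth_mult [OF G] smooth_map_const smooth_map_id M) auto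
  have smooth_left: "smooth_map ?M ?M (\<lambda>x. a \<otimes>\<^bsub>G\<^esub> x)" if "a \<in> carrier G" for a
    using that car by (intro lie_group_smooth_mult [OF G] smooth_map_const smooth_map_id M) auto
  have inv_left: "inv_into (carrier G) (\<lambda>x. a \<otimes>\<^bsub>G\<^esub> x) x = inv\<^bsub>G\<^esub> a \<otimes>\<^bsub>G\<^esub> x"
    if "a \<in> carrier G" "x \<in> carrier G" for a x
    by (rule inv_into_f_eq) (use that in \<open>auto simp: inj_on_def m_assoc [symmetric]\<close>)
  let ?c = "fun_pullback ?M (conj g)"
  have pc: "?c f \<in> ?S" if "f \<in> ?S" for f
    by (rule fun_pullback_smooth [OF G smooth_conj [OF g] that])
  have XV: "X \<in> vector_fields ?M"
    and Xinv: "\<And>a. a \<in> carrier G \<Longrightarrow> pushforward ?M (\<lambda>x. a \<otimes>\<^bsub>G\<^esub> x) X = X"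
    using X by (auto simp: lie_algebra_def)
  have Ad: "Ad G g X = (\<lambda>f p. if f \<in> ?S \<and> p \<in> carrier G then X (?c f) (conj (inv\<^bsub>G\<^esub> g) p) else 0)"
    using bij [OF g] by (auto simp: Ad_def pushforward_def car fun_eq_iff conj_def)
  have AdV: "Ad G g X \<in> vector_fields ?M"
    unfolding vector_fields_def
  proof (intro CollectI conjI allI ballI impI)
    fix f assume "f \<notin> ?S"
    then show "Ad G g X f = (\<lambda>p. 0)" by (simp add: Ad)
  next
    fix f assume f: "f \<in> ?S"
    have "X (?c f) \<in> ?S"
      using XV pc [OF f] by (simp add: vector_fields_def)
    then have "fun_pullback ?M (conj (inv\<^bsub>G\<^esub> g)) (X (?c f)) \<in> ?S"
      using g by (intro fun_pullback_smooth [OF G smooth_conj]) auto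
    moreover have "Ad G g X f = fun_pullback ?M (conj (inv\<^bsub>G\<^esub> g)) (X (?c f))"
      using f by (simp add: Ad fun_pullback_def [of ?M "conj (inv\<^bsub>G\<^esub> g)"] car)
    ultimately show "Ad G g X f \<in> ?S"
      by simp
  next
    fix f h a b assume fh: "f \<in> ?S" "h \<in> ?S"
    have "?c (\<lambda>p. a * f p + b * h p) = (\<lambda>p. a * ?c f p + b * ?c h p)"
      by (auto simp: fun_pullback_def)
    then show "Ad G g X (\<lambda>p. a * f p + b * h p) = (\<lambda>p. a * Ad G g X f p + b * Ad G g X h p)"
      using fh smooth_functions_lincomb [OF M fh] vector_field_lincomb [OF XV pc [OF fh(1)] pc [OF fh(2)]]
      by (auto simp: Ad)
  next
    fix f h assume fh: "f \<in> ?S" "h \<in> ?S"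
    have c: "?c (\<lambda>p. f p * h p) = (\<lambda>p. ?c f p * ?c h p)"
      by (auto simp: fun_pullback_def)
    have X2: "X (\<lambda>p. ?c f p * ?c h p) = (\<lambda>p. ?c f p * X (?c h) p + ?c h p * X (?c f) p)"
      using XV pc [OF fh(1)] pc [OF fh(2)] by (simp add: vector_fields_def)
    have "(\<lambda>p. f p * h p) \<in> ?S"
      by (rule smooth_functions_mult [OF smooth_manifold_open_charts [OF M] fh])
    moreover have "?c u (conj (inv\<^bsub>G\<^esub> g) p) = u p" if "p \<in> carrier G" for u p
      using that g conj_inv(1) conj_closed by (simp add: fun_pullback_def car)
    ultimately show "Ad G g X (\<lambda>p. f p * h p) = (\<lambda>p. f p * Ad G g X h p + h p * Ad G g X f p)"
      using fh by (auto simp: Ad c X2 fun_eq_iff)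
  qed
  have "pushforward ?M (\<lambda>x. a \<otimes>\<^bsub>G\<^esub> x) (Ad G g X) = Ad G g X" if a: "a \<in> carrier G" for a
  proof (intro ext)
    fix f p
    show "pushforward ?M (\<lambda>x. a \<otimes>\<^bsub>G\<^esub> x) (Ad G g X) f p = Ad G g X f p"
    proof (cases "f \<in> ?S \<and> p \<in> carrier G")
      case False
      then show ?thesis by (auto simp: pushforward_def Ad car)
    next
      case True
      let ?L = "\<lambda>b. fun_pullback ?M (\<lambda>x. b \<otimes>\<^bsub>G\<^esub> x)"
      let ?b = "conj (inv\<^bsub>G\<^esub> g) a"
      have b: "?b \<in> carrier G" using a g conj_closed by simp
      have La: "?L a f \<in> ?S"
        using True by (intro fun_pullback_smooth [OF G smooth_left [OF a]]) auto
      have "?c (?L a f) = ?L ?b (?c f)"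
        using a g by (auto simp: fun_pullback_def car fun_eq_iff conj_def m_assoc cancel)
      moreover have "conj (inv\<^bsub>G\<^esub> g) (inv\<^bsub>G\<^esub> a \<otimes>\<^bsub>G\<^esub> p) = inv\<^bsub>G\<^esub> ?b \<otimes>\<^bsub>G\<^esub> conj (inv\<^bsub>G\<^esub> g) p"
        using a g True by (simp add: conj_def inv_mult_group m_assoc cancel)
      ultimately have "pushforward ?M (\<lambda>x. a \<otimes>\<^bsub>G\<^esub> x) (Ad G g X) f p =
          X (?L ?b (?c f)) (inv\<^bsub>G\<^esub> ?b \<otimes>\<^bsub>G\<^esub> conj (inv\<^bsub>G\<^esub> g) p)"
        using True a La inv_left by (simp add: pushforward_def car Ad)
      also have "\<dots> = pushforward ?M (\<lambda>x. ?b \<otimes>\<^bsub>G\<^esub> x) X (?c f) (conj (inv\<^bsub>G\<^esub> g) p)"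
        using True b g pc conj_closed inv_left by (simp add: pushforward_def car)
      also have "\<dots> = Ad G g X f p"
        using True Xinv [OF b] by (simp add: Ad)
      finally show ?thesis .
    qed
  qed
  then show ?thesis
    using AdV by (simp add: lie_algebra_def)
qed

section \<open>Invariant polynomials\<close>

lemma sym_power_iff:
  "f \<in> sym_power G k \<longleftrightarrow> (\<exists>(N::nat) c \<alpha>. (\<forall>j<N. \<forall>i<k. \<alpha> j i \<in> lie_dual G) \<and>
     f = (\<lambda>X. if X \<in> lie_algebra G then \<Sum>j<N. c j * (\<Prod>i<k. \<alpha> j i X) else 0))"
  unfolding sym_power_def by blast

lemma sym_power_outside: "f \<in> sym_power G k \<Longrightarrow> X \<notin> lie_algebra G \<Longrightarrow> f X = 0"
  by (auto simp: sym_power_iff)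

lemma sym_power_zero: "(\<lambda>X. 0) \<in> sym_power G k"
  unfolding sym_power_iff by (intro exI [of _ 0]) (auto simp: fun_eq_iff)

lemma sym_power_monomial:
  assumes "\<And>i. i < k \<Longrightarrow> \<alpha> i \<in> lie_dual G"
  shows "(\<lambda>X. if X \<in> lie_algebra G then c * (\<Prod>i<k. \<alpha> i X) else 0) \<in> sym_power G k"
  unfolding sym_power_iff using assms
  by (intro exI [of _ "Suc 0"] exI [of _ "\<lambda>j. c"] exI [of _ "\<lambda>j. \<alpha>"]) auto

lemma sum_lessThan_add:
  fixes f g :: "nat \<Rightarrow> 'a::comm_monoid_add"
  shows "(\<Sum>j<M + N. if j < M then f j else g (j - M)) = (\<Sum>j<M. f j) + (\<Sum>j<N. g j)"
  by (induction N) (auto simp: add.assoc)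

lemma prod_lessThan_add:
  fixes f g :: "nat \<Rightarrow> 'a::comm_monoid_mult"
  shows "(\<Prod>j<M + N. if j < M then f j else g (j - M)) = (\<Prod>j<M. f j) * (\<Prod>j<N. g j)"
  by (induction N) (auto simp: mult.assoc)

lemma sym_power_add:
  assumes "f \<in> sym_power G k" "h \<in> sym_power G k"
  shows "(\<lambda>X. f X + h X) \<in> sym_power G k"
proof -
  obtain M c \<alpha> where f: "\<forall>j<M::nat. \<forall>i<k. \<alpha> j i \<in> lie_dual G"
    "f = (\<lambda>X. if X \<in> lie_algebra G then \<Sum>j<M. c j * (\<Prod>i<k. \<alpha> j i X) else 0)"
    using assms(1) unfolding sym_power_iff by blast
  obtain N d \<beta> where h: "\<forall>j<N::nat. \<forall>i<k. \<beta> j i \<in> lie_dual G"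
    "h = (\<lambda>X. if X \<in> lie_algebra G then \<Sum>j<N. d j * (\<Prod>i<k. \<beta> j i X) else 0)"
    using assms(2) unfolding sym_power_iff by blast
  let ?\<gamma> = "\<lambda>j. if j < M then \<alpha> j else \<beta> (j - M)" and ?e = "\<lambda>j. if j < M then c j else d (j - M)"
  have "(\<Sum>j<M + N. ?e j * (\<Prod>i<k. ?\<gamma> j i X)) =
      (\<Sum>j<M. c j * (\<Prod>i<k. \<alpha> j i X)) + (\<Sum>j<N. d j * (\<Prod>i<k. \<beta> j i X))" for X
    unfolding sum_lessThan_add [symmetric] by (rule sum.cong) auto
  then show ?thesis
    unfolding sym_power_iff f(2) h(2) using f(1) h(1)
    by (intro exI [of _ "M + N"] exI [of _ ?e] exI [of _ ?\<gamma>]) (auto simp: fun_eq_iff)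
qed

lemma sym_power_cmult:
  assumes "f \<in> sym_power G k"
  shows "(\<lambda>X. a * f X) \<in> sym_power G k"
proof -
  obtain N c \<alpha> where f: "\<forall>j<N::nat. \<forall>i<k. \<alpha> j i \<in> lie_dual G"
    "f = (\<lambda>X. if X \<in> lie_algebra G then \<Sum>j<N. c j * (\<Prod>i<k. \<alpha> j i X) else 0)"
    using assms unfolding sym_power_iff by blast
  show ?thesis
    unfolding sym_power_iff f(2) using f(1)
    by (intro exI [of _ N] exI [of _ "\<lambda>j. a * c j"] exI [of _ \<alpha>])
      (auto simp: fun_eq_iff sum_distrib_left mult.assoc)
qed

lemma sym_power_sum:
  assumes "\<And>j. j \<in> J \<Longrightarrow> f j \<in> sym_power G k"
  shows "(\<lambda>X. \<Sum>j\<in>J. f j X) \<in> sym_power G k"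
  using assms
  by (induction J rule: infinite_finite_induct) (auto simp: sym_power_zero sym_power_add)

lemma sym_power_mult:
  assumes "f \<in> sym_power G k" "h \<in> sym_power G l"
  shows "(\<lambda>X. f X * h X) \<in> sym_power G (k + l)"
proof -
  obtain M c \<alpha> where f: "\<forall>j<M::nat. \<forall>i<k. \<alpha> j i \<in> lie_dual G"
    "f = (\<lambda>X. if X \<in> lie_algebra G then \<Sum>j<M. c j * (\<Prod>i<k. \<alpha> j i X) else 0)"
    using assms(1) unfolding sym_power_iff by blast
  obtain N d \<beta> where h: "\<forall>j<N::nat. \<forall>i<l. \<beta> j i \<in> lie_dual G"
    "h = (\<lambda>X. if X \<in> lie_algebra G then \<Sum>j<N. d j * (\<Prod>i<l. \<beta> j i X) else 0)"
    using assms(2) unfolding sym_power_iff by blast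
  have "(\<lambda>X. \<Sum>(j, j')\<in>{..<M} \<times> {..<N}. if X \<in> lie_algebra G
      then (c j * d j') * (\<Prod>i<k + l. (if i < k then \<alpha> j i else \<beta> j' (i - k)) X) else 0) \<in> sym_power G (k + l)"
    using f(1) h(1) by (intro sym_power_sum) (auto intro!: sym_power_monomial simp: split_beta)
  moreover have "(\<Prod>i<k + l. (if i < k then \<alpha> j i else \<beta> j' (i - k)) X) =
      (\<Prod>i<k. \<alpha> j i X) * (\<Prod>i<l. \<beta> j' i X)" for j j' X
    unfolding prod_lessThan_add [symmetric] by (rule prod.cong) auto
  ultimately show ?thesis
    unfolding f(2) h(2)
    by (simp add: sum_product sum.cartesian_product split_beta mult_ac if_distrib cong: if_cong)
      (erule back_subst [of "\<lambda>f. f \<in> sym_power G (k + l)"], auto simp: fun_eq_iff intro!: sum.cong)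
qed

lemma lie_dual_lincomb:
  assumes "\<alpha> \<in> lie_dual G" "X \<in> lie_algebra G" "Y \<in> lie_algebra G"
  shows "\<alpha> (\<lambda>f p. a * X f p + b * Y f p) = a * \<alpha> X + b * \<alpha> Y"
  using assms by (simp add: lie_dual_def)

lemma sym_power_scale:
  assumes G: "lie_group G" and f: "f \<in> sym_power G k" and t: "t \<noteq> 0"
  shows "f (\<lambda>h p. t * X h p) = t ^ k * f X"
proof -
  obtain N c \<alpha> where \<alpha>: "\<forall>j<N::nat. \<forall>i<k. \<alpha> j i \<in> lie_dual G"
    and f: "f = (\<lambda>X. if X \<in> lie_algebra G then \<Sum>j<N. c j * (\<Prod>i<k. \<alpha> j i X) else 0)"
    using f unfolding sym_power_iff by blast
  show ?thesis
  proof (cases "X \<in> lie_algebra G")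
    case True
    have "(\<Prod>i<k. \<alpha> j i (\<lambda>h p. t * X h p)) = t ^ k * (\<Prod>i<k. \<alpha> j i X)" if "j < N" for j
    proof -
      have "\<alpha> j i (\<lambda>h p. t * X h p) = t * \<alpha> j i X" if "i < k" for i
        using lie_dual_lincomb [of "\<alpha> j i" G X X t 0] \<alpha> \<open>j < N\<close> that True by simp
      then have "(\<Prod>i<k. \<alpha> j i (\<lambda>h p. t * X h p)) = (\<Prod>i<k. t * \<alpha> j i X)"
        by (intro prod.cong) auto
      then show ?thesis
        by (simp add: prod.distrib)
    qed
    then show ?thesis
      using True lie_algebra_scale_iff [OF G t] unfolding f
      by (simp add: sum_distrib_left mult_ac)
  next
    case False
    then show ?thesis
      using lie_algebra_scale_iff [OF G t] unfolding f by simp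
  qed
qed

text \<open>
  Linear functionals are affine along a line, so products of them are polynomials in the parameter.
\<close>

lemma sym_power_on_line:
  assumes G: "lie_group G" and f: "f \<in> sym_power G k"
    and X: "X \<in> lie_algebra G" and Y: "Y \<in> lie_algebra G"
  shows "\<exists>p. \<forall>t. f (\<lambda>h x. (1 - t) * X h x + t * Y h x) = poly p t"
proof -
  obtain N c \<alpha> where \<alpha>: "\<forall>j<N::nat. \<forall>i<k. \<alpha> j i \<in> lie_dual G"
    and f: "f = (\<lambda>X. if X \<in> lie_algebra G then \<Sum>j<N. c j * (\<Prod>i<k. \<alpha> j i X) else 0)"
    using f unfolding sym_power_iff by blast
  let ?p = "\<Sum>j<N. Polynomial.smult (c j) (\<Prod>i<k. [:\<alpha> j i X, \<alpha> j i Y - \<alpha> j i X:])"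
  have "f (\<lambda>h x. (1 - t) * X h x + t * Y h x) = poly ?p t" for t
  proof -
    have "(\<Prod>i<k. \<alpha> j i (\<lambda>h x. (1 - t) * X h x + t * Y h x)) =
        (\<Prod>i<k. poly [:\<alpha> j i X, \<alpha> j i Y - \<alpha> j i X:] t)" if "j < N" for j
      using \<alpha> that X Y by (intro prod.cong refl) (subst lie_dual_lincomb, auto simp: algebra_simps)
    then show ?thesis
      using lie_algebra_lincomb [OF G X Y] unfolding f
      by (simp add: poly_sum poly_prod)
  qed
  then show ?thesis by blast
qed

lemma power_sum_zero_coeffs:
  fixes e :: "nat \<Rightarrow> real"
  assumes "\<And>t. t \<noteq> 0 \<Longrightarrow> (\<Sum>k<N. t ^ k * e k) = 0" "k < N"
  shows "e k = 0"
proof -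
  let ?p = "\<Sum>k<N. monom (e k) k"
  have "poly ?p t = 0" if "t \<noteq> 0" for t
    using assms(1) [OF that] by (simp add: poly_sum poly_monom mult.commute)
  then have "- {0} \<subseteq> {t. poly ?p t = 0}"
    by auto
  moreover have "infinite (- {0::real})"
    using infinite_UNIV_char_0 by (simp add: Compl_eq_Diff_UNIV)
  ultimately have "?p = 0"
    using poly_roots_finite [of ?p] finite_subset by blast
  then have "coeff ?p k = 0"
    by simp
  then show ?thesis
    using assms(2) by (simp add: coeff_sum)
qed

text \<open>
  The property that characterizes \<open>hom_component G f\<close>.
\<close>

definition graded_decomposition ::
    "'g lie_group_data \<Rightarrow> ('g vf \<Rightarrow> real) \<Rightarrow> (nat \<Rightarrow> 'g vf \<Rightarrow> real) \<Rightarrow> bool" where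
  "graded_decomposition G f c \<longleftrightarrow>
     (\<forall>k. c k \<in> sym_power G k) \<and> finite {k. c k \<noteq> (\<lambda>X. 0)} \<and>
     f = (\<lambda>X. \<Sum>k | c k \<noteq> (\<lambda>X. 0). c k X)"

lemma graded_decompositionI:
  assumes "\<And>k. c k \<in> sym_power G k" "\<And>k. k \<ge> N \<Longrightarrow> c k = (\<lambda>X. 0)" "\<And>X. f X = (\<Sum>k<N. c k X)"
  shows "graded_decomposition G f c"
proof -
  have s: "{k. c k \<noteq> (\<lambda>X. 0)} \<subseteq> {..<N}"
    using assms(2) by (force simp: not_less)
  then have "f = (\<lambda>X. \<Sum>k | c k \<noteq> (\<lambda>X. 0). c k X)"
    unfolding assms(3) [abs_def] by (intro ext sum.mono_neutral_right) auto
  then show ?thesis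
    unfolding graded_decomposition_def using assms(1) finite_subset [OF s] by simp
qed

lemma graded_decompositionE:
  assumes "graded_decomposition G f c"
  obtains N where "\<And>k. k \<ge> N \<Longrightarrow> c k = (\<lambda>X. 0)" "\<And>M X. M \<ge> N \<Longrightarrow> f X = (\<Sum>k<M. c k X)"
proof -
  have fin: "finite {k. c k \<noteq> (\<lambda>X. 0)}" and f: "f = (\<lambda>X. \<Sum>k | c k \<noteq> (\<lambda>X. 0). c k X)"
    using assms by (auto simp: graded_decomposition_def)
  then obtain N where N: "\<And>k. c k \<noteq> (\<lambda>X. 0) \<Longrightarrow> k < N"
    using finite_nat_set_iff_bounded by auto
  show thesis
  proof
    show z: "c k = (\<lambda>X. 0)" if "k \<ge> N" for k
      using N [of k] that by auto
    show "f X = (\<Sum>k<M. c k X)" if "M \<ge> N" for M X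
      unfolding f using N that by (intro sum.mono_neutral_left) force+
  qed
qed

text \<open>
  Evaluating two decompositions of \<open>f\<close> at \<open>t X\<close> gives two expressions of the function
  \<open>t \<mapsto> f(t X)\<close> as a polynomial in \<open>t \<noteq> 0\<close>, whose coefficients are the values of the components at \<open>X\<close>.
\<close>

lemma graded_decomposition_unique:
  assumes G: "lie_group G" and c: "graded_decomposition G f c" and d: "graded_decomposition G f d"
  shows "c = d"
proof (intro ext)
  obtain N1 where N1: "\<And>k. k \<ge> N1 \<Longrightarrow> c k = (\<lambda>X. 0)" "\<And>M X. M \<ge> N1 \<Longrightarrow> f X = (\<Sum>k<M. c k X)"
    using graded_decompositionE [OF c] by blast
  obtain N2 where N2: "\<And>k. k \<ge> N2 \<Longrightarrow> d k = (\<lambda>X. 0)" "\<And>M X. M \<ge> N2 \<Longrightarrow> f X = (\<Sum>k<M. d k X)"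
    using graded_decompositionE [OF d] by blast
  have sym: "c k \<in> sym_power G k" "d k \<in> sym_power G k" for k
    using c d by (auto simp: graded_decomposition_def)
  fix k X
  let ?N = "max (Suc k) (max N1 N2)"
  have "(\<Sum>k<?N. t ^ k * (c k X - d k X)) = 0" if t: "t \<noteq> 0" for t
  proof -
    have "(\<Sum>k<?N. t ^ k * c k X) = (\<Sum>k<?N. c k (\<lambda>h p. t * X h p))"
      by (simp add: sym_power_scale [OF G sym(1) t])
    also have "\<dots> = (\<Sum>k<?N. d k (\<lambda>h p. t * X h p))"
      using N1(2) [of ?N] N2(2) [of ?N] by simp
    also have "\<dots> = (\<Sum>k<?N. t ^ k * d k X)"
      by (simp add: sym_power_scale [OF G sym(2) t])
    finally show ?thesis
      by (simp add: right_diff_distrib sum_subtractf)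
  qed
  then have "c k X - d k X = 0"
    by (rule power_sum_zero_coeffs) auto
  then show "c k X = d k X" by simp
qed

lemma hom_component_eqI:
  assumes "lie_group G" "graded_decomposition G f c"
  shows "hom_component G f = c"
  unfolding hom_component_def
proof (rule the_equality)
  show "(\<forall>k. c k \<in> sym_power G k) \<and> finite {k. c k \<noteq> (\<lambda>X. 0)} \<and> f = (\<lambda>X. \<Sum>k | c k \<noteq> (\<lambda>X. 0). c k X)"
    using assms(2) by (simp add: graded_decomposition_def)
  show "d = c" if "(\<forall>k. d k \<in> sym_power G k) \<and> finite {k. d k \<noteq> (\<lambda>X. 0)} \<and> f = (\<lambda>X. \<Sum>k | d k \<noteq> (\<lambda>X. 0). d k X)" for d
    using that assms graded_decomposition_unique unfolding graded_decomposition_def by blast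
qed

definition Ad_invariant :: "'g lie_group_data \<Rightarrow> ('g vf \<Rightarrow> real) \<Rightarrow> bool" where
  "Ad_invariant G f \<longleftrightarrow> (\<forall>g \<in> carrier G. \<forall>X \<in> lie_algebra G. f (Ad G g X) = f X)"

lemma inv_poly_iff:
  "f \<in> carrier (inv_poly_ring G) \<longleftrightarrow> (\<exists>c. graded_decomposition G f c) \<and> Ad_invariant G f"
proof -
  have "(\<exists>N c. f = (\<lambda>X. \<Sum>k<(N::nat). c k X) \<and> (\<forall>k<N. c k \<in> sym_power G k)) \<longleftrightarrow> (\<exists>c. graded_decomposition G f c)"
  proof
    assume "\<exists>N c. f = (\<lambda>X. \<Sum>k<(N::nat). c k X) \<and> (\<forall>k<N. c k \<in> sym_power G k)"
    then obtain N c where f: "f = (\<lambda>X. \<Sum>k<(N::nat). c k X)" "\<forall>k<N. c k \<in> sym_power G k"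
      by blast
    have "graded_decomposition G f (\<lambda>k. if k < N then c k else (\<lambda>X. 0))"
      by (rule graded_decompositionI [of _ _ N]) (auto simp: f sym_power_zero)
    then show "\<exists>c. graded_decomposition G f c" by blast
  next
    assume "\<exists>c. graded_decomposition G f c"
    then obtain c where c: "graded_decomposition G f c" by blast
    obtain N where "\<And>k. k \<ge> N \<Longrightarrow> c k = (\<lambda>X. 0)" "\<And>M X. M \<ge> N \<Longrightarrow> f X = (\<Sum>k<M. c k X)"
      using graded_decompositionE [OF c] by blast
    then have "f = (\<lambda>X. \<Sum>k<N. c k X)" by blast
    then show "\<exists>N c. f = (\<lambda>X. \<Sum>k<(N::nat). c k X) \<and> (\<forall>k<N. c k \<in> sym_power G k)"
      using c unfolding graded_decomposition_def by blast
  qed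
  then show ?thesis
    by (simp add: inv_poly_ring_def Ad_invariant_def)
qed

lemma hom_component_decomposition:
  assumes "lie_group G" "f \<in> carrier (inv_poly_ring G)"
  shows "graded_decomposition G f (hom_component G f)"
  using assms hom_component_eqI unfolding inv_poly_iff by metis

lemma hom_component_sym_power:
  assumes "lie_group G" "f \<in> carrier (inv_poly_ring G)"
  shows "hom_component G f k \<in> sym_power G k"
  using hom_component_decomposition [OF assms] by (simp add: graded_decomposition_def)

text \<open>
  The coefficients of the polynomial \<open>f(t X) = f(Ad\<^sub>g(t X)) = f(t Ad\<^sub>g X)\<close> in \<open>t\<close> are compared.
\<close>

lemma hom_component_invariant:
  assumes G: "lie_group G" and f: "f \<in> carrier (inv_poly_ring G)"
  shows "Ad_invariant G (hom_component G f k)"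
  unfolding Ad_invariant_def
proof (intro ballI)
  fix g X assume g: "g \<in> carrier G" and X: "X \<in> lie_algebra G"
  let ?c = "hom_component G f"
  obtain N where "\<And>k. k \<ge> N \<Longrightarrow> ?c k = (\<lambda>X. 0)"
    and N: "\<And>M X. M \<ge> N \<Longrightarrow> f X = (\<Sum>k<M. ?c k X)"
    using graded_decompositionE [OF hom_component_decomposition [OF G f]] by blast
  let ?N = "max (Suc k) N"
  have "(\<Sum>k<?N. t ^ k * (?c k (Ad G g X) - ?c k X)) = 0" if t: "t \<noteq> 0" for t
  proof -
    have tX: "(\<lambda>h p. t * X h p) \<in> lie_algebra G"
      using lie_algebra_scale_iff [OF G t] X by blast
    have "(\<Sum>k<?N. t ^ k * ?c k (Ad G g X)) = (\<Sum>k<?N. ?c k (Ad G g (\<lambda>h p. t * X h p)))"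
      unfolding Ad_scale
      using t by (intro sum.cong) (auto simp: sym_power_scale [OF G hom_component_sym_power [OF G f]])
    also have "\<dots> = f (Ad G g (\<lambda>h p. t * X h p))"
      using N [of ?N] by simp
    also have "\<dots> = f (\<lambda>h p. t * X h p)"
      using f g tX unfolding inv_poly_iff Ad_invariant_def by blast
    also have "\<dots> = (\<Sum>k<?N. ?c k (\<lambda>h p. t * X h p))"
      by (rule N) simp
    also have "\<dots> = (\<Sum>k<?N. t ^ k * ?c k X)"
      using t by (intro sum.cong) (auto simp: sym_power_scale [OF G hom_component_sym_power [OF G f]])
    finally show ?thesis
      by (simp add: right_diff_distrib sum_subtractf)
  qed
  then have "?c k (Ad G g X) - ?c k X = 0"
    by (rule power_sum_zero_coeffs) auto
  then show "?c k (Ad G g X) = ?c k X" by simp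
qed

lemma hom_component_vanishes:
  assumes "lie_group G" "f \<in> carrier (inv_poly_ring G)"
  shows "\<exists>N. \<forall>k\<ge>N. hom_component G f k = (\<lambda>X. 0)"
proof -
  obtain N where "\<And>k. k \<ge> N \<Longrightarrow> hom_component G f k = (\<lambda>X. 0)"
    "\<And>M X. M \<ge> N \<Longrightarrow> f X = (\<Sum>k<M. hom_component G f k X)"
    using graded_decompositionE [OF hom_component_decomposition [OF assms]] by blast
  then show ?thesis by blast
qed

lemma graded_decomposition_add:
  assumes "graded_decomposition G f c" "graded_decomposition G h d"
  shows "graded_decomposition G (\<lambda>X. f X + h X) (\<lambda>k X. c k X + d k X)"
proof -
  obtain N1 where N1: "\<And>k. k \<ge> N1 \<Longrightarrow> c k = (\<lambda>X. 0)" "\<And>M X. M \<ge> N1 \<Longrightarrow> f X = (\<Sum>k<M. c k X)"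
    using graded_decompositionE [OF assms(1)] by blast
  obtain N2 where N2: "\<And>k. k \<ge> N2 \<Longrightarrow> d k = (\<lambda>X. 0)" "\<And>M X. M \<ge> N2 \<Longrightarrow> h X = (\<Sum>k<M. d k X)"
    using graded_decompositionE [OF assms(2)] by blast
  show ?thesis
  proof (rule graded_decompositionI [of _ _ "max N1 N2"])
    show "(\<lambda>X. c k X + d k X) \<in> sym_power G k" for k
      using assms by (intro sym_power_add) (auto simp: graded_decomposition_def)
    show "(\<lambda>X. c k X + d k X) = (\<lambda>X. 0)" if "k \<ge> max N1 N2" for k
      using N1(1) [of k] N2(1) [of k] that by simp
    show "f X + h X = (\<Sum>k<max N1 N2. c k X + d k X)" for X
      using N1(2) [of "max N1 N2"] N2(2) [of "max N1 N2"] by (simp add: sum.distrib)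
  qed
qed

lemma graded_decomposition_mult:
  assumes "graded_decomposition G f c" "graded_decomposition G h d"
  shows "graded_decomposition G (\<lambda>X. f X * h X) (\<lambda>k X. \<Sum>i\<le>k. c i X * d (k - i) X)"
proof -
  obtain N1 where N1: "\<And>k. k \<ge> N1 \<Longrightarrow> c k = (\<lambda>X. 0)" "\<And>M X. M \<ge> N1 \<Longrightarrow> f X = (\<Sum>k<M. c k X)"
    using graded_decompositionE [OF assms(1)] by blast
  obtain N2 where N2: "\<And>k. k \<ge> N2 \<Longrightarrow> d k = (\<lambda>X. 0)" "\<And>M X. M \<ge> N2 \<Longrightarrow> h X = (\<Sum>k<M. d k X)"
    using graded_decompositionE [OF assms(2)] by blast
  have cz: "c k X = 0" if "k \<ge> N1" for k X using N1(1) [OF that] by simp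
  have dz: "d k X = 0" if "k \<ge> N2" for k X using N2(1) [OF that] by simp
  show ?thesis
  proof (rule graded_decompositionI [of _ _ "N1 + N2"])
    show "(\<lambda>X. \<Sum>i\<le>k. c i X * d (k - i) X) \<in> sym_power G k" for k
    proof (rule sym_power_sum)
      fix i assume "i \<in> {..k}"
      then show "(\<lambda>X. c i X * d (k - i) X) \<in> sym_power G k"
        using sym_power_mult [of "c i" G i "d (k - i)" "k - i"] assms
        by (simp add: graded_decomposition_def)
    qed
    show "(\<lambda>X. \<Sum>i\<le>k. c i X * d (k - i) X) = (\<lambda>X. 0)" if "k \<ge> N1 + N2" for k
    proof (intro ext sum.neutral ballI)
      fix X i
      show "c i X * d (k - i) X = 0"
        using cz [of i X] dz [of "k - i" X] that by (cases "i \<ge> N1") auto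
    qed
    fix X
    have "f X * h X = (\<Sum>(i, j)\<in>{..<N1} \<times> {..<N2}. c i X * d j X)"
      using N1(2) [of N1 X] N2(2) [of N2 X] by (simp add: sum_product sum.cartesian_product)
    also have "\<dots> = (\<Sum>(i, j)\<in>{(i, j). i + j < N1 + N2}. c i X * d j X)"
    proof (rule sum.mono_neutral_left)
      have "{(i, j). i + j < N1 + N2} \<subseteq> {..<N1 + N2} \<times> {..<N1 + N2}" by auto
      then show "finite {(i, j). i + j < N1 + N2}"
        by (rule finite_subset) simp
      show "\<forall>x\<in>{(i, j). i + j < N1 + N2} - {..<N1} \<times> {..<N2}. (case x of (i, j) \<Rightarrow> c i X * d j X) = 0"
        using cz dz by (auto simp flip: not_less) blast+
    qed auto
    also have "\<dots> = (\<Sum>k<N1 + N2. \<Sum>i\<le>k. c i X * d (k - i) X)"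
      by (rule sum.triangle_reindex)
    finally show "f X * h X = (\<Sum>k<N1 + N2. \<Sum>i\<le>k. c i X * d (k - i) X)" .
  qed
qed

lemma inv_poly_ring_simps:
  "f \<otimes>\<^bsub>inv_poly_ring G\<^esub> h = (\<lambda>X. f X * h X)"
  "f \<oplus>\<^bsub>inv_poly_ring G\<^esub> h = (\<lambda>X. f X + h X)"
  "\<zero>\<^bsub>inv_poly_ring G\<^esub> = (\<lambda>X. 0)"
  "\<one>\<^bsub>inv_poly_ring G\<^esub> = (\<lambda>X. if X \<in> lie_algebra G then 1 else 0)"
  by (simp_all add: inv_poly_ring_def)

lemma inv_poly_closed:
  assumes "f \<in> carrier (inv_poly_ring G)" "h \<in> carrier (inv_poly_ring G)"
  shows "(\<lambda>X. f X + h X) \<in> carrier (inv_poly_ring G)"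
    and "(\<lambda>X. f X * h X) \<in> carrier (inv_poly_ring G)"
proof -
  obtain c d where c: "graded_decomposition G f c" and d: "graded_decomposition G h d"
    using assms unfolding inv_poly_iff by blast
  show "(\<lambda>X. f X + h X) \<in> carrier (inv_poly_ring G)"
    using graded_decomposition_add [OF c d] assms by (auto simp: inv_poly_iff Ad_invariant_def)
  show "(\<lambda>X. f X * h X) \<in> carrier (inv_poly_ring G)"
    using graded_decomposition_mult [OF c d] assms by (auto simp: inv_poly_iff Ad_invariant_def)
qed

lemma inv_poly_cmult:
  assumes "f \<in> carrier (inv_poly_ring G)"
  shows "(\<lambda>X. a * f X) \<in> carrier (inv_poly_ring G)"
proof -
  obtain c where c: "graded_decomposition G f c"
    using assms unfolding inv_poly_iff by blast
  obtain N where N: "\<And>k. k \<ge> N \<Longrightarrow> c k = (\<lambda>X. 0)" "\<And>M X. M \<ge> N \<Longrightarrow> f X = (\<Sum>k<M. c k X)"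
    using graded_decompositionE [OF c] by blast
  have "graded_decomposition G (\<lambda>X. a * f X) (\<lambda>k X. a * c k X)"
  proof (rule graded_decompositionI [of _ _ N])
    show "(\<lambda>X. a * c k X) \<in> sym_power G k" for k
      using c by (intro sym_power_cmult) (simp add: graded_decomposition_def)
    show "(\<lambda>X. a * c k X) = (\<lambda>X. 0)" if "k \<ge> N" for k
      using N(1) [OF that] by simp
    show "a * f X = (\<Sum>k<N. a * c k X)" for X
      using N(2) [of N X] by (simp add: sum_distrib_left)
  qed
  then show ?thesis
    using assms by (auto simp: inv_poly_iff Ad_invariant_def)
qed

lemma inv_poly_outside:
  assumes "f \<in> carrier (inv_poly_ring G)" "X \<notin> lie_algebra G"
  shows "f X = 0"
proof -
  obtain c where c: "graded_decomposition G f c"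
    using assms unfolding inv_poly_iff by blast
  then have "c k X = 0" for k
    using sym_power_outside [of "c k" G k X] assms(2) by (auto simp: graded_decomposition_def)
  then show ?thesis
    using c by (simp add: graded_decomposition_def)
qed

lemma inv_poly_on_line:
  assumes G: "lie_group G" and f: "f \<in> carrier (inv_poly_ring G)"
    and X: "X \<in> lie_algebra G" and Y: "Y \<in> lie_algebra G"
  shows "\<exists>p. \<forall>t. f (\<lambda>h x. (1 - t) * X h x + t * Y h x) = poly p t"
proof -
  obtain c where c: "graded_decomposition G f c"
    using f unfolding inv_poly_iff by blast
  obtain N where "\<And>k. k \<ge> N \<Longrightarrow> c k = (\<lambda>X. 0)" and N: "\<And>M X. M \<ge> N \<Longrightarrow> f X = (\<Sum>k<M. c k X)"
    using graded_decompositionE [OF c] by blast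
  have "\<exists>p. \<forall>t. c k (\<lambda>h x. (1 - t) * X h x + t * Y h x) = poly p t" for k
    using c by (intro sym_power_on_line [OF G _ X Y, of _ k]) (simp add: graded_decomposition_def)
  then obtain p where p: "\<And>k t. c k (\<lambda>h x. (1 - t) * X h x + t * Y h x) = poly (p k) t"
    by metis
  have "f (\<lambda>h x. (1 - t) * X h x + t * Y h x) = poly (\<Sum>k<N. p k) t" for t
    using N [of N] by (simp add: p poly_sum)
  then show ?thesis by blast
qed

lemma hom_component_add:
  assumes G: "lie_group G" and "f \<in> carrier (inv_poly_ring G)" "h \<in> carrier (inv_poly_ring G)"
  shows "hom_component G (\<lambda>X. f X + h X) = (\<lambda>k X. hom_component G f k X + hom_component G h k X)"
  by (rule hom_component_eqI [OF G graded_decomposition_add])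
    (use assms in \<open>auto intro: hom_component_decomposition\<close>)

lemma hom_component_mult:
  assumes G: "lie_group G" and "f \<in> carrier (inv_poly_ring G)" "h \<in> carrier (inv_poly_ring G)"
  shows "hom_component G (\<lambda>X. f X * h X) =
    (\<lambda>k X. \<Sum>i\<le>k. hom_component G f i X * hom_component G h (k - i) X)"
  by (rule hom_component_eqI [OF G graded_decomposition_mult])
    (use assms in \<open>auto intro: hom_component_decomposition\<close>)

lemma graded_decomposition_one:
  "graded_decomposition G (\<one>\<^bsub>inv_poly_ring G\<^esub>) (\<lambda>k. if k = 0 then \<one>\<^bsub>inv_poly_ring G\<^esub> else (\<lambda>X. 0))"
proof (rule graded_decompositionI [of _ _ 1])
  have "(\<lambda>X. if X \<in> lie_algebra G then 1 else 0) \<in> sym_power G 0"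
    using sym_power_monomial [of 0 undefined G 1] by (simp cong: if_cong)
  then show "(if k = 0 then \<one>\<^bsub>inv_poly_ring G\<^esub> else (\<lambda>X. 0)) \<in> sym_power G k" for k
    by (auto simp: inv_poly_ring_simps sym_power_zero)
qed auto

text \<open>
  If \<open>f X \<noteq> 0\<close> and \<open>h Y \<noteq> 0\<close>, then the restrictions of \<open>f\<close> and \<open>h\<close> to the line through \<open>X\<close> and \<open>Y\<close> are
  nonzero polynomials in one variable, and so is their product.
\<close>

lemma domain_inv_poly_ring:
  assumes G: "lie_group G"
  shows "domain (inv_poly_ring G)"
proof -
  let ?R = "inv_poly_ring G"
  have one: "\<one>\<^bsub>?R\<^esub> \<in> carrier ?R"
    using graded_decomposition_one [of G] Ad_in_lie_algebra [OF G] unfolding inv_poly_iff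
    by (auto simp: Ad_invariant_def inv_poly_ring_simps)
  have zero: "\<zero>\<^bsub>?R\<^esub> \<in> carrier ?R"
    using inv_poly_cmult [OF one, of 0] by (simp add: inv_poly_ring_simps)
  have ab: "abelian_group ?R"
  proof (rule abelian_groupI)
    fix f assume f: "f \<in> carrier ?R"
    show "\<exists>h\<in>carrier ?R. h \<oplus>\<^bsub>?R\<^esub> f = \<zero>\<^bsub>?R\<^esub>"
      using inv_poly_cmult [OF f, of "- 1"]
      by (intro bexI [of _ "\<lambda>X. - 1 * f X"]) (auto simp: inv_poly_ring_simps)
  qed (use zero in \<open>auto simp: inv_poly_ring_simps inv_poly_closed algebra_simps\<close>)
  have mon: "comm_monoid ?R"
  proof (rule comm_monoidI)
    fix f assume f: "f \<in> carrier ?R"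
    show "\<one>\<^bsub>?R\<^esub> \<otimes>\<^bsub>?R\<^esub> f = f"
      using inv_poly_outside [OF f] by (auto simp: inv_poly_ring_simps fun_eq_iff)
  qed (use one in \<open>auto simp: inv_poly_ring_simps inv_poly_closed algebra_simps\<close>)
  have cr: "cring ?R"
    by (rule cringI [OF ab mon]) (simp add: inv_poly_ring_simps algebra_simps)
  have integral: "f = \<zero>\<^bsub>?R\<^esub> \<or> h = \<zero>\<^bsub>?R\<^esub>"
    if fh: "f \<otimes>\<^bsub>?R\<^esub> h = \<zero>\<^bsub>?R\<^esub>" and f: "f \<in> carrier ?R" and h: "h \<in> carrier ?R" for f h
  proof (rule ccontr)
    assume "\<not> (f = \<zero>\<^bsub>?R\<^esub> \<or> h = \<zero>\<^bsub>?R\<^esub>)"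
    then obtain X Y where XY: "f X \<noteq> 0" "h Y \<noteq> 0"
      by (auto simp: inv_poly_ring_simps fun_eq_iff)
    then have L: "X \<in> lie_algebra G" "Y \<in> lie_algebra G"
      using inv_poly_outside f h by blast+
    obtain p where p: "\<And>t. f (\<lambda>h x. (1 - t) * X h x + t * Y h x) = poly p t"
      using inv_poly_on_line [OF G f L] by blast
    obtain q where q: "\<And>t. h (\<lambda>h x. (1 - t) * X h x + t * Y h x) = poly q t"
      using inv_poly_on_line [OF G h L] by blast
    have "poly (p * q) t = 0" for t
      using fun_cong [OF fh] by (simp add: inv_poly_ring_simps flip: p q)
    then have "p * q = 0"
      using poly_all_0_iff_0 by blast
    moreover have "poly p 0 \<noteq> 0" "poly q 1 \<noteq> 0"
      using XY p [of 0] q [of 1] by simp_all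
    ultimately show False by auto
  qed
  have "\<one>\<^bsub>?R\<^esub> \<noteq> \<zero>\<^bsub>?R\<^esub>"
  proof
    assume "\<one>\<^bsub>?R\<^esub> = \<zero>\<^bsub>?R\<^esub>"
    from fun_cong [OF this, of "\<lambda>f p. 0"] show False
      using zero_in_lie_algebra [of G] by (simp add: inv_poly_ring_simps)
  qed
  then show ?thesis
    using integral by (intro domain.intro cr domain_axioms.intro) auto
qed

section \<open>The filtered Cartan complex\<close>

definition cform_subspace :: "('g, 'm) cform set \<Rightarrow> bool" where
  "cform_subspace S \<longleftrightarrow> (\<lambda>X Ys p. 0) \<in> S \<and>
     (\<forall>\<omega>\<in>S. \<forall>\<eta>\<in>S. \<forall>a b. (\<lambda>X Ys p. a * \<omega> X Ys p + b * \<eta> X Ys p) \<in> S)"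

lemma cform_subspaceD:
  assumes "cform_subspace S"
  shows "(\<lambda>X Ys p. 0) \<in> S"
    and "\<omega> \<in> S \<Longrightarrow> \<eta> \<in> S \<Longrightarrow> (\<lambda>X Ys p. a * \<omega> X Ys p + b * \<eta> X Ys p) \<in> S"
    and "\<omega> \<in> S \<Longrightarrow> \<eta> \<in> S \<Longrightarrow> (\<lambda>X Ys p. \<omega> X Ys p + \<eta> X Ys p) \<in> S"
    and "\<omega> \<in> S \<Longrightarrow> \<eta> \<in> S \<Longrightarrow> (\<lambda>X Ys p. \<omega> X Ys p - \<eta> X Ys p) \<in> S"
proof -
  show zero: "(\<lambda>X Ys p. 0) \<in> S"
    using assms by (simp add: cform_subspace_def)
  show lin: "(\<lambda>X Ys p. a * \<omega> X Ys p + b * \<eta> X Ys p) \<in> S" if "\<omega> \<in> S" "\<eta> \<in> S" for \<omega> \<eta> a b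
    using assms that by (simp add: cform_subspace_def)
  show "(\<lambda>X Ys p. \<omega> X Ys p + \<eta> X Ys p) \<in> S" if "\<omega> \<in> S" "\<eta> \<in> S"
    using lin [OF that, of 1 1] by simp
  show "(\<lambda>X Ys p. \<omega> X Ys p - \<eta> X Ys p) \<in> S" if "\<omega> \<in> S" "\<eta> \<in> S"
    using lin [OF that, of 1 "- 1"] by simp
qed

lemma cform_subspace_sum:
  assumes S: "cform_subspace S" and "\<And>j. j \<in> J \<Longrightarrow> \<omega> j \<in> S"
  shows "(\<lambda>X Ys p. \<Sum>j\<in>J. \<omega> j X Ys p) \<in> S"
  using assms(2)
  by (induction J rule: infinite_finite_induct) (auto intro: cform_subspaceD [OF S])

lemma form_pullback_lincomb:
  "form_pullback M \<phi> (\<lambda>Ys p. a * \<omega> Ys p + b * \<eta> Ys p) =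
   (\<lambda>Ys p. a * form_pullback M \<phi> \<omega> Ys p + b * form_pullback M \<phi> \<eta> Ys p)"
  by (auto simp: form_pullback_def fun_eq_iff)

lemma cartan_iff:
  "\<omega> \<in> cartan G M act k q \<longleftrightarrow>
     (\<exists>(N::nat) f v. (\<forall>j<N. f j \<in> sym_power G k \<and> v j \<in> forms M q) \<and>
        \<omega> = (\<lambda>X Ys p. \<Sum>j<N. f j X * v j Ys p)) \<and>
     (\<forall>g \<in> carrier G. \<forall>X \<in> lie_algebra G.
        \<omega> (Ad G g X) = form_pullback M (act (inv\<^bsub>G\<^esub> g)) (\<omega> X))"
  unfolding cartan_def by blast

lemma cartan_subspace: "cform_subspace (cartan G M act k q)"
  unfolding cform_subspace_def
proof (intro conjI ballI allI)
  show "(\<lambda>X Ys p. 0) \<in> cartan G M act k q"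
    unfolding cartan_iff by (intro conjI exI [of _ 0]) (auto simp: form_pullback_def fun_eq_iff)
  fix \<omega> \<eta> a b assume \<omega>: "\<omega> \<in> cartan G M act k q" and \<eta>: "\<eta> \<in> cartan G M act k q"
  obtain N f v where f: "\<forall>j<N::nat. f j \<in> sym_power G k \<and> v j \<in> forms M q"
    "\<omega> = (\<lambda>X Ys p. \<Sum>j<N. f j X * v j Ys p)"
    using \<omega> unfolding cartan_iff by blast
  obtain N' f' v' where f': "\<forall>j<N'::nat. f' j \<in> sym_power G k \<and> v' j \<in> forms M q"
    "\<eta> = (\<lambda>X Ys p. \<Sum>j<N'. f' j X * v' j Ys p)"
    using \<eta> unfolding cartan_iff by blast
  let ?F = "\<lambda>j. if j < N then (\<lambda>X. a * f j X) else (\<lambda>X. b * f' (j - N) X)"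
  let ?V = "\<lambda>j. if j < N then v j else v' (j - N)"
  have "(\<Sum>j<N + N'. ?F j X * ?V j Ys p) = a * \<omega> X Ys p + b * \<eta> X Ys p" for X Ys p
  proof -
    have "(\<Sum>j<N + N'. ?F j X * ?V j Ys p) =
        (\<Sum>j<N + N'. if j < N then a * f j X * v j Ys p else b * f' (j - N) X * v' (j - N) Ys p)"
      by (rule sum.cong) auto
    also have "\<dots> = (\<Sum>j<N. a * f j X * v j Ys p) + (\<Sum>j<N'. b * f' j X * v' j Ys p)"
      by (rule sum_lessThan_add)
    finally show ?thesis
      by (simp add: f(2) f'(2) sum_distrib_left mult.assoc)
  qed
  moreover have "\<forall>j<N + N'. ?F j \<in> sym_power G k \<and> ?V j \<in> forms M q"
    using f(1) f'(1) by (auto intro: sym_power_cmult)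
  moreover have "a * \<omega> (Ad G g X) Ys p + b * \<eta> (Ad G g X) Ys p =
      form_pullback M (act (inv\<^bsub>G\<^esub> g)) (\<lambda>Ys p. a * \<omega> X Ys p + b * \<eta> X Ys p) Ys p"
    if "g \<in> carrier G" "X \<in> lie_algebra G" for g X Ys p
    using \<omega> \<eta> that unfolding form_pullback_lincomb by (simp add: cartan_iff)
  ultimately show "(\<lambda>X Ys p. a * \<omega> X Ys p + b * \<eta> X Ys p) \<in> cartan G M act k q"
    unfolding cartan_iff
    by (intro conjI exI [of _ "N + N'"] exI [of _ ?F] exI [of _ ?V]) (auto simp: fun_eq_iff)
qed

lemma cartan_mult:
  assumes h: "h \<in> sym_power G l" "Ad_invariant G h" and \<omega>: "\<omega> \<in> cartan G M act k q"
  shows "(\<lambda>X Ys p. h X * \<omega> X Ys p) \<in> cartan G M act (l + k) q"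
proof -
  obtain N f v where f: "\<forall>j<N::nat. f j \<in> sym_power G k \<and> v j \<in> forms M q"
    "\<omega> = (\<lambda>X Ys p. \<Sum>j<N. f j X * v j Ys p)"
    using \<omega> unfolding cartan_iff by blast
  have "h (Ad G g X) * \<omega> (Ad G g X) Ys p = form_pullback M (act (inv\<^bsub>G\<^esub> g)) (\<lambda>Ys p. h X * \<omega> X Ys p) Ys p"
    if "g \<in> carrier G" "X \<in> lie_algebra G" for g X Ys p
    using \<omega> h(2) that form_pullback_lincomb [of M "act (inv\<^bsub>G\<^esub> g)" "h X" "\<omega> X" 0 "\<omega> X"]
    by (simp add: cartan_iff Ad_invariant_def)
  moreover have "\<forall>j<N. (\<lambda>X. h X * f j X) \<in> sym_power G (l + k) \<and> v j \<in> forms M q"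
    using f(1) h(1) by (auto intro: sym_power_mult)
  moreover have "(\<lambda>X Ys p. h X * \<omega> X Ys p) = (\<lambda>X Ys p. \<Sum>j<N. h X * f j X * v j Ys p)"
    by (simp add: f(2) sum_distrib_left mult.assoc)
  ultimately show ?thesis
    unfolding cartan_iff
    by (intro conjI exI [of _ N] exI [of _ "\<lambda>j X. h X * f j X"] exI [of _ v]) (auto simp: fun_eq_iff)
qed

lemma cartan_outside:
  assumes "\<omega> \<in> cartan G M act k q" "X \<notin> lie_algebra G"
  shows "\<omega> X = (\<lambda>Ys p. 0)"
proof -
  obtain N f v where f: "\<forall>j<N::nat. f j \<in> sym_power G k \<and> v j \<in> forms M q"
    "\<omega> = (\<lambda>X Ys p. \<Sum>j<N. f j X * v j Ys p)"
    using assms(1) unfolding cartan_iff by blast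
  have "f j X = 0" if "j < N" for j
    using sym_power_outside [of "f j" G k X] f(1) that assms(2) by blast
  then show ?thesis
    by (simp add: f(2))
qed

lemma cartan_smooth:
  assumes M: "smooth_manifold M" and "\<omega> \<in> cartan G M act k q"
  shows "\<omega> X Ys \<in> smooth_functions M"
proof -
  obtain N f v where f: "\<forall>j<N::nat. f j \<in> sym_power G k \<and> v j \<in> forms M q"
    "\<omega> = (\<lambda>X Ys p. \<Sum>j<N. f j X * v j Ys p)"
    using assms(2) unfolding cartan_iff by blast
  show ?thesis
    unfolding f(2) using f(1) by (intro smooth_functions_sum [OF M]) (auto simp: forms_def)
qed

abbreviation bidegrees :: "int \<Rightarrow> int \<Rightarrow> nat set" where
  "bidegrees p n \<equiv> {k. p \<le> 2 * int k \<and> 2 * int k \<le> n}"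

lemma finite_bidegrees: "finite (bidegrees p n)"
  by (rule finite_subset [of _ "{..nat n}"]) auto

lemma cartan_filt_iff:
  "\<omega> \<in> cartan_filt G M act p n \<longleftrightarrow>
     (\<exists>w. (\<forall>k\<in>bidegrees p n. w k \<in> cartan G M act k (nat (n - 2 * int k))) \<and>
        \<omega> = (\<lambda>X Ys x. \<Sum>k\<in>bidegrees p n. w k X Ys x))"
  unfolding cartan_filt_def by blast

lemma cartan_filt_subspace: "cform_subspace (cartan_filt G M act p n)"
  unfolding cform_subspace_def
proof (intro conjI ballI allI)
  show "(\<lambda>X Ys x. 0) \<in> cartan_filt G M act p n"
    unfolding cartan_filt_iff
    by (intro exI [of _ "\<lambda>k X Ys x. 0"]) (auto intro: cform_subspaceD(1) [OF cartan_subspace])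
  fix \<omega> \<eta> a b assume "\<omega> \<in> cartan_filt G M act p n" "\<eta> \<in> cartan_filt G M act p n"
  then obtain v w where v: "\<And>k. k \<in> bidegrees p n \<Longrightarrow> v k \<in> cartan G M act k (nat (n - 2 * int k))"
    "\<omega> = (\<lambda>X Ys x. \<Sum>k\<in>bidegrees p n. v k X Ys x)"
    and w: "\<And>k. k \<in> bidegrees p n \<Longrightarrow> w k \<in> cartan G M act k (nat (n - 2 * int k))"
    "\<eta> = (\<lambda>X Ys x. \<Sum>k\<in>bidegrees p n. w k X Ys x)"
    unfolding cartan_filt_iff by blast
  show "(\<lambda>X Ys x. a * \<omega> X Ys x + b * \<eta> X Ys x) \<in> cartan_filt G M act p n"
    unfolding cartan_filt_iff v(2) w(2)
    by (intro exI [of _ "\<lambda>k X Ys x. a * v k X Ys x + b * w k X Ys x"])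
      (use v(1) w(1) in \<open>auto intro: cform_subspaceD(2) [OF cartan_subspace] simp: sum.distrib sum_distrib_left\<close>)
qed

lemma cartan_filt_antimono:
  assumes "p \<le> p'"
  shows "cartan_filt G M act p' n \<subseteq> cartan_filt G M act p n"
proof
  fix \<omega> assume "\<omega> \<in> cartan_filt G M act p' n"
  then obtain w where w: "\<And>k. k \<in> bidegrees p' n \<Longrightarrow> w k \<in> cartan G M act k (nat (n - 2 * int k))"
    "\<omega> = (\<lambda>X Ys x. \<Sum>k\<in>bidegrees p' n. w k X Ys x)"
    unfolding cartan_filt_iff by blast
  let ?w = "\<lambda>k. if k \<in> bidegrees p' n then w k else (\<lambda>X Ys x. 0)"
  have "(\<Sum>k\<in>bidegrees p' n. w k X Ys x) = (\<Sum>k\<in>bidegrees p n. ?w k X Ys x)" for X Ys x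
    using assms by (intro sum.mono_neutral_cong_left finite_bidegrees) auto
  then show "\<omega> \<in> cartan_filt G M act p n"
    unfolding cartan_filt_iff w(2) using w(1)
    by (intro exI [of _ ?w]) (auto intro: cform_subspaceD(1) [OF cartan_subspace])
qed

lemma cartan_filt_mult:
  assumes h: "h \<in> sym_power G l" "Ad_invariant G h" and \<omega>: "\<omega> \<in> cartan_filt G M act p n"
  shows "(\<lambda>X Ys x. h X * \<omega> X Ys x) \<in> cartan_filt G M act (p + 2 * int l) (n + 2 * int l)"
proof -
  obtain w where w: "\<And>k. k \<in> bidegrees p n \<Longrightarrow> w k \<in> cartan G M act k (nat (n - 2 * int k))"
    "\<omega> = (\<lambda>X Ys x. \<Sum>k\<in>bidegrees p n. w k X Ys x)"
    using \<omega> unfolding cartan_filt_iff by blast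
  let ?w = "\<lambda>k. if l \<le> k then (\<lambda>X Ys x. h X * w (k - l) X Ys x) else (\<lambda>X Ys x. 0)"
  have "(\<Sum>k\<in>bidegrees p n. h X * w k X Ys x) =
      (\<Sum>k\<in>bidegrees (p + 2 * int l) (n + 2 * int l). ?w k X Ys x)" for X Ys x
  proof -
    have "(\<Sum>k\<in>bidegrees p n. h X * w k X Ys x) = (\<Sum>k\<in>(\<lambda>k. k + l) ` bidegrees p n. ?w k X Ys x)"
      by (subst sum.reindex) (auto simp: inj_on_def)
    also have "\<dots> = (\<Sum>k\<in>bidegrees (p + 2 * int l) (n + 2 * int l). ?w k X Ys x)"
    proof (rule sum.mono_neutral_left [OF finite_bidegrees])
      show "(\<lambda>k. k + l) ` bidegrees p n \<subseteq> bidegrees (p + 2 * int l) (n + 2 * int l)"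
        by auto
      show "\<forall>k\<in>bidegrees (p + 2 * int l) (n + 2 * int l) - (\<lambda>k. k + l) ` bidegrees p n. ?w k X Ys x = 0"
      proof
        fix k assume k: "k \<in> bidegrees (p + 2 * int l) (n + 2 * int l) - (\<lambda>k. k + l) ` bidegrees p n"
        have "k < l"
        proof (rule ccontr)
          assume "\<not> k < l"
          then have "k - l \<in> bidegrees p n" "k = (k - l) + l"
            using k by (auto simp: of_nat_diff)
          then show False using k by blast
        qed
        then show "?w k X Ys x = 0" by simp
      qed
    qed
    finally show ?thesis .
  qed
  moreover have "?w k \<in> cartan G M act k (nat (n + 2 * int l - 2 * int k))"
    if k: "k \<in> bidegrees (p + 2 * int l) (n + 2 * int l)" for k
  proof (cases "l \<le> k")
    case True
    have "k - l \<in> bidegrees p n"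
      using k True by (auto simp: of_nat_diff)
    then have "(\<lambda>X Ys x. h X * w (k - l) X Ys x) \<in> cartan G M act (l + (k - l)) (nat (n - 2 * int (k - l)))"
      by (intro cartan_mult h w)
    then show ?thesis
      using True by (simp add: of_nat_diff algebra_simps)
  next
    case False
    then show ?thesis
      by (simp add: cform_subspaceD(1) [OF cartan_subspace])
  qed
  ultimately show ?thesis
    unfolding cartan_filt_iff w(2)
    by (intro exI [of _ ?w]) (auto simp: sum_distrib_left)
qed

lemma cartan_filt_outside:
  assumes "\<omega> \<in> cartan_filt G M act p n" "X \<notin> lie_algebra G"
  shows "\<omega> X Ys x = 0"
  using assms unfolding cartan_filt_iff by (auto simp: cartan_outside intro!: sum.neutral)

lemma cartan_filt_smooth:
  assumes M: "smooth_manifold M" and "\<omega> \<in> cartan_filt G M act p n"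
  shows "\<omega> X Ys \<in> smooth_functions M"
proof -
  obtain w where w: "\<And>k. k \<in> bidegrees p n \<Longrightarrow> w k \<in> cartan G M act k (nat (n - 2 * int k))"
    "\<omega> = (\<lambda>X Ys x. \<Sum>k\<in>bidegrees p n. w k X Ys x)"
    using assms(2) unfolding cartan_filt_iff by blast
  have "(\<lambda>x. \<Sum>k\<in>bidegrees p n. 1 * w k X Ys x) \<in> smooth_functions M"
    by (rule smooth_functions_sum [OF M finite_bidegrees]) (rule cartan_smooth [OF M w(1)])
  then show ?thesis
    by (simp add: w(2))
qed

text \<open>
  A vector field is linear on smooth functions only: it is \<open>0\<close> on all others.  Hence the two forms are
  required to have smooth values.
\<close>

lemma ext_deriv_lincomb:
  assumes v: "\<And>Ys. v Ys \<in> smooth_functions M" and w: "\<And>Ys. w Ys \<in> smooth_functions M"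
  shows "ext_deriv M (\<lambda>Ys p. a * v Ys p + b * w Ys p) =
    (\<lambda>Ys p. a * ext_deriv M v Ys p + b * ext_deriv M w Ys p)"
proof (intro ext)
  fix Ys p
  show "ext_deriv M (\<lambda>Ys p. a * v Ys p + b * w Ys p) Ys p = a * ext_deriv M v Ys p + b * ext_deriv M w Ys p"
  proof (cases "set Ys \<subseteq> vector_fields M")
    case True
    have "(Ys ! i) (\<lambda>p. a * v (nths Ys (- {i})) p + b * w (nths Ys (- {i})) p) =
        (\<lambda>p. a * (Ys ! i) (v (nths Ys (- {i}))) p + b * (Ys ! i) (w (nths Ys (- {i}))) p)"
      if "i < length Ys" for i
    proof -
      have "Ys ! i \<in> vector_fields M"
        using True nth_mem [OF that] by blast
      then show ?thesis
        by (rule vector_field_lincomb [OF _ v w])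
    qed
    then have "(\<Sum>i<length Ys. (- 1) ^ i * (Ys ! i) (\<lambda>p. a * v (nths Ys (- {i})) p + b * w (nths Ys (- {i})) p) p) =
        (\<Sum>i<length Ys. a * ((- 1) ^ i * (Ys ! i) (v (nths Ys (- {i}))) p) +
          b * ((- 1) ^ i * (Ys ! i) (w (nths Ys (- {i}))) p))"
      by (intro sum.cong refl) (simp add: algebra_simps)
    then show ?thesis
      using True by (simp add: ext_deriv_def sum.distrib sum_distrib_left split_beta algebra_simps)
  qed (simp add: ext_deriv_def)
qed

text \<open>
  The coefficients depend on the element of the Lie algebra but not on the point of the manifold, so
  that differentiation on the manifold treats them as constants.
\<close>

lemma cartan_diff_lincomb:
  assumes "\<And>X Ys. \<omega> X Ys \<in> smooth_functions M" "\<And>X Ys. \<eta> X Ys \<in> smooth_functions M"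
  shows "cartan_diff G M act (\<lambda>X Ys p. f X * \<omega> X Ys p + h X * \<eta> X Ys p) =
    (\<lambda>X Ys p. f X * cartan_diff G M act \<omega> X Ys p + h X * cartan_diff G M act \<eta> X Ys p)"
  unfolding cartan_diff_def contraction_def
  by (subst ext_deriv_lincomb) (auto simp: assms algebra_simps)

lemma cartan_diff_mult:
  assumes "\<And>X Ys. \<omega> X Ys \<in> smooth_functions M"
  shows "cartan_diff G M act (\<lambda>X Ys p. f X * \<omega> X Ys p) = (\<lambda>X Ys p. f X * cartan_diff G M act \<omega> X Ys p)"
  using cartan_diff_lincomb [of \<omega> M \<omega> G act f "\<lambda>X. 0"] assms by simp

lemma cartan_diff_zero: "cartan_diff G M act (\<lambda>X Ys p. 0) = (\<lambda>X Ys p. 0)"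
  using cartan_diff_mult [of "\<lambda>X Ys p. 0" M G act "\<lambda>X. 0"] by (simp add: zero_smooth_function)

section \<open>Graded subquotients of the space of equivariant forms\<close>

lemma cform_space_simps:
  "x \<oplus>\<^bsub>cform_space\<^esub> y = (\<lambda>X Ys p. x X Ys p + y X Ys p)"
  "\<zero>\<^bsub>cform_space\<^esub> = (\<lambda>X Ys p. 0)"
  "f \<odot>\<^bsub>cform_space\<^esub> x = (\<lambda>X Ys p. f X * x X Ys p)"
  by (simp_all add: cform_space_def)

lemma cform_coset:
  "D +>\<^bsub>cform_space\<^esub> z = {(\<lambda>X Ys p. d X Ys p + z X Ys p) | d. d \<in> D}"
  by (auto simp: a_r_coset_def r_coset_def cform_space_def)

lemma cform_set_add:
  "A <+>\<^bsub>cform_space\<^esub> B = {(\<lambda>X Ys p. a X Ys p + b X Ys p) | a b. a \<in> A \<and> b \<in> B}"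
  by (auto simp: set_add_def set_mult_def cform_space_def)

lemma cform_coset_eq_iff:
  assumes D: "cform_subspace D"
  shows "D +>\<^bsub>cform_space\<^esub> z = D +>\<^bsub>cform_space\<^esub> z' \<longleftrightarrow> (\<lambda>X Ys p. z X Ys p - z' X Ys p) \<in> D"
proof
  assume "D +>\<^bsub>cform_space\<^esub> z = D +>\<^bsub>cform_space\<^esub> z'"
  moreover have "z \<in> D +>\<^bsub>cform_space\<^esub> z"
    unfolding cform_coset using cform_subspaceD(1) [OF D] by force
  ultimately obtain d where "d \<in> D" "z = (\<lambda>X Ys p. d X Ys p + z' X Ys p)"
    unfolding cform_coset by auto
  then show "(\<lambda>X Ys p. z X Ys p - z' X Ys p) \<in> D"
    by simp
next
  assume e: "(\<lambda>X Ys p. z X Ys p - z' X Ys p) \<in> D"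
  show "D +>\<^bsub>cform_space\<^esub> z = D +>\<^bsub>cform_space\<^esub> z'"
  proof (intro equalityI subsetI)
    fix x assume "x \<in> D +>\<^bsub>cform_space\<^esub> z"
    then obtain d where d: "d \<in> D" "x = (\<lambda>X Ys p. d X Ys p + z X Ys p)"
      unfolding cform_coset by auto
    have "(\<lambda>X Ys p. d X Ys p + (z X Ys p - z' X Ys p)) \<in> D"
      by (rule cform_subspaceD(3) [OF D d(1) e])
    moreover have "x = (\<lambda>X Ys p. (d X Ys p + (z X Ys p - z' X Ys p)) + z' X Ys p)"
      by (simp add: d(2))
    ultimately show "x \<in> D +>\<^bsub>cform_space\<^esub> z'"
      unfolding cform_coset by (intro CollectI exI conjI)
  next
    fix x assume "x \<in> D +>\<^bsub>cform_space\<^esub> z'"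
    then obtain d where d: "d \<in> D" "x = (\<lambda>X Ys p. d X Ys p + z' X Ys p)"
      unfolding cform_coset by auto
    have "(\<lambda>X Ys p. d X Ys p - (z X Ys p - z' X Ys p)) \<in> D"
      by (rule cform_subspaceD(4) [OF D d(1) e])
    moreover have "x = (\<lambda>X Ys p. (d X Ys p - (z X Ys p - z' X Ys p)) + z X Ys p)"
      by (simp add: d(2))
    ultimately show "x \<in> D +>\<^bsub>cform_space\<^esub> z"
      unfolding cform_coset by (intro CollectI exI conjI)
  qed
qed

lemma cform_coset_zero: "D +>\<^bsub>cform_space\<^esub> (\<lambda>X Ys p. 0) = D"
  by (auto simp: cform_coset)

lemma cform_coset_eq_self_iff:
  "cform_subspace D \<Longrightarrow> D +>\<^bsub>cform_space\<^esub> z = D \<longleftrightarrow> z \<in> D"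
  using cform_coset_eq_iff [of D z "\<lambda>X Ys p. 0"] by (simp add: cform_coset_zero)

lemma cform_coset_add:
  assumes D: "cform_subspace D"
  shows "(D +>\<^bsub>cform_space\<^esub> z) <+>\<^bsub>cform_space\<^esub> (D +>\<^bsub>cform_space\<^esub> z') =
    D +>\<^bsub>cform_space\<^esub> (\<lambda>X Ys p. z X Ys p + z' X Ys p)"
proof (intro equalityI subsetI)
  fix x assume "x \<in> (D +>\<^bsub>cform_space\<^esub> z) <+>\<^bsub>cform_space\<^esub> (D +>\<^bsub>cform_space\<^esub> z')"
  then obtain d d' where d: "d \<in> D" "d' \<in> D"
    and x: "x = (\<lambda>X Ys p. (d X Ys p + z X Ys p) + (d' X Ys p + z' X Ys p))"
    unfolding cform_set_add cform_coset by auto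
  have "x = (\<lambda>X Ys p. (d X Ys p + d' X Ys p) + (z X Ys p + z' X Ys p))"
    by (simp add: x algebra_simps)
  then show "x \<in> D +>\<^bsub>cform_space\<^esub> (\<lambda>X Ys p. z X Ys p + z' X Ys p)"
    unfolding cform_coset using cform_subspaceD(3) [OF D d] by (intro CollectI exI conjI)
next
  fix x assume "x \<in> D +>\<^bsub>cform_space\<^esub> (\<lambda>X Ys p. z X Ys p + z' X Ys p)"
  then obtain d where d: "d \<in> D" "x = (\<lambda>X Ys p. d X Ys p + (z X Ys p + z' X Ys p))"
    unfolding cform_coset by auto
  have "(\<lambda>X Ys p. d X Ys p + z X Ys p) \<in> D +>\<^bsub>cform_space\<^esub> z"
    unfolding cform_coset using d(1) by auto
  moreover have "(\<lambda>X Ys p. 0 + z' X Ys p) \<in> D +>\<^bsub>cform_space\<^esub> z'"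
    unfolding cform_coset using cform_subspaceD(1) [OF D]
    by (intro CollectI exI [of _ "\<lambda>X Ys p. 0"]) simp
  moreover have "x = (\<lambda>X Ys p. (d X Ys p + z X Ys p) + (0 + z' X Ys p))"
    by (simp add: d(2) algebra_simps)
  ultimately show "x \<in> (D +>\<^bsub>cform_space\<^esub> z) <+>\<^bsub>cform_space\<^esub> (D +>\<^bsub>cform_space\<^esub> z')"
    unfolding cform_set_add by (intro CollectI exI conjI)
qed

lemma coset_smult_coset:
  assumes D: "cform_subspace D" and D': "cform_subspace D'"
    and f: "\<And>d. d \<in> D' \<Longrightarrow> (\<lambda>X Ys p. f X * d X Ys p) \<in> D"
  shows "coset_smult cform_space D f (D' +>\<^bsub>cform_space\<^esub> z) =
    D +>\<^bsub>cform_space\<^esub> (\<lambda>X Ys p. f X * z X Ys p)"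
proof -
  have "D +>\<^bsub>cform_space\<^esub> (f \<odot>\<^bsub>cform_space\<^esub> x) = D +>\<^bsub>cform_space\<^esub> (\<lambda>X Ys p. f X * z X Ys p)"
    if "x \<in> D' +>\<^bsub>cform_space\<^esub> z" for x
  proof -
    obtain d where d: "d \<in> D'" "x = (\<lambda>X Ys p. d X Ys p + z X Ys p)"
      using \<open>x \<in> _\<close> unfolding cform_coset by blast
    then show ?thesis
      unfolding cform_coset_eq_iff [OF D] using f [OF d(1)] by (simp add: cform_space_simps algebra_simps)
  qed
  moreover have "z \<in> D' +>\<^bsub>cform_space\<^esub> z"
    unfolding cform_coset using cform_subspaceD(1) [OF D'] by force
  ultimately show ?thesis
    unfolding coset_smult_def by auto
qed

lemma quotient_space_simps:
  "carrier (quotient_space cform_space Z D) = (\<lambda>z. D +>\<^bsub>cform_space\<^esub> z) ` Z"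
  "\<zero>\<^bsub>quotient_space cform_space Z D\<^esub> = D"
  "x \<oplus>\<^bsub>quotient_space cform_space Z D\<^esub> y = x <+>\<^bsub>cform_space\<^esub> y"
  by (simp_all add: quotient_space_def)

lemma abelian_monoid_quotient_space:
  assumes Z: "cform_subspace Z" and D: "cform_subspace D"
  shows "abelian_monoid (quotient_space cform_space Z D)"
proof (rule abelian_monoidI, unfold quotient_space_simps)
  show "D \<in> (\<lambda>z. D +>\<^bsub>cform_space\<^esub> z) ` Z"
    using cform_subspaceD(1) [OF Z] cform_coset_zero [of D] by (metis image_eqI)
  fix x assume "x \<in> (\<lambda>z. D +>\<^bsub>cform_space\<^esub> z) ` Z"
  then obtain u where u: "u \<in> Z" "x = D +>\<^bsub>cform_space\<^esub> u" by blast
  show "D <+>\<^bsub>cform_space\<^esub> x = x"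
    using cform_coset_add [OF D, of "\<lambda>X Ys p. 0" u] by (simp add: cform_coset_zero u(2))
  fix y assume "y \<in> (\<lambda>z. D +>\<^bsub>cform_space\<^esub> z) ` Z"
  then obtain v where v: "v \<in> Z" "y = D +>\<^bsub>cform_space\<^esub> v" by blast
  show "x <+>\<^bsub>cform_space\<^esub> y \<in> (\<lambda>z. D +>\<^bsub>cform_space\<^esub> z) ` Z"
    unfolding u(2) v(2) cform_coset_add [OF D] using cform_subspaceD(3) [OF Z u(1) v(1)] by blast
  show "x <+>\<^bsub>cform_space\<^esub> y = y <+>\<^bsub>cform_space\<^esub> x"
    unfolding u(2) v(2) cform_coset_add [OF D] by (simp add: add.commute)
  fix z assume "z \<in> (\<lambda>z. D +>\<^bsub>cform_space\<^esub> z) ` Z"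
  then obtain w where w: "w \<in> Z" "z = D +>\<^bsub>cform_space\<^esub> w" by blast
  show "x <+>\<^bsub>cform_space\<^esub> y <+>\<^bsub>cform_space\<^esub> z = x <+>\<^bsub>cform_space\<^esub> (y <+>\<^bsub>cform_space\<^esub> z)"
    unfolding u(2) v(2) w(2) cform_coset_add [OF D] by (simp add: add.assoc)
qed

lemma finsum_cosets:
  assumes Z: "cform_subspace Z" and D: "cform_subspace D" and "finite K" "\<And>k. k \<in> K \<Longrightarrow> z k \<in> Z"
  shows "(\<Oplus>\<^bsub>quotient_space cform_space Z D\<^esub>k\<in>K. D +>\<^bsub>cform_space\<^esub> z k) =
    D +>\<^bsub>cform_space\<^esub> (\<lambda>X Ys p. \<Sum>k\<in>K. z k X Ys p)"
proof -
  interpret Q: abelian_monoid "quotient_space cform_space Z D"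
    by (rule abelian_monoid_quotient_space [OF Z D])
  show ?thesis
    using assms(3,4)
  proof (induction K rule: finite_induct)
    case empty
    then show ?case by (simp add: quotient_space_simps cform_coset_zero)
  next
    case (insert k K)
    have "(\<lambda>k. D +>\<^bsub>cform_space\<^esub> z k) \<in> K \<rightarrow> carrier (quotient_space cform_space Z D)"
      "D +>\<^bsub>cform_space\<^esub> z k \<in> carrier (quotient_space cform_space Z D)"
      using insert.prems by (auto simp: quotient_space_simps)
    then show ?case
      using insert by (simp add: quotient_space_simps(3) cform_coset_add [OF D])
  qed
qed

text \<open>
  Module axioms pass to images.  They are verified for representatives, where they are pointwise
  identities of real functions, and never for cosets.
\<close>

lemma module_surj_image:
  assumes W: "module R W" and onto: "f ` carrier W = carrier A"
    and add: "\<And>x y. x \<in> carrier W \<Longrightarrow> y \<in> carrier W \<Longrightarrow> f (x \<oplus>\<^bsub>W\<^esub> y) = f x \<oplus>\<^bsub>A\<^esub> f y"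
    and smult: "\<And>a x. a \<in> carrier R \<Longrightarrow> x \<in> carrier W \<Longrightarrow> f (a \<odot>\<^bsub>W\<^esub> x) = a \<odot>\<^bsub>A\<^esub> f x"
    and zero: "f \<zero>\<^bsub>W\<^esub> = \<zero>\<^bsub>A\<^esub>"
  shows "module R A"
proof -
  interpret W: module R W by (rule W)
  have A: "x \<in> carrier A \<longleftrightarrow> (\<exists>u\<in>carrier W. x = f u)" for x
    using onto by blast
  have fW: "f u \<in> carrier A" if "u \<in> carrier W" for u
    using that onto by blast
  show ?thesis
  proof (rule module_criteria)
    show "cring R" by (rule W.R.is_cring)
    show "\<zero>\<^bsub>A\<^esub> \<in> carrier A"
      using fW [of "\<zero>\<^bsub>W\<^esub>"] by (simp add: zero)
    show "\<forall>v\<in>carrier A. \<exists>neg_v\<in>carrier A. v \<oplus>\<^bsub>A\<^esub> neg_v = \<zero>\<^bsub>A\<^esub>"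
    proof
      fix v assume "v \<in> carrier A"
      then obtain u where u: "u \<in> carrier W" "v = f u" using A by blast
      then have "f u \<oplus>\<^bsub>A\<^esub> f (\<ominus>\<^bsub>W\<^esub> u) = \<zero>\<^bsub>A\<^esub>"
        using add [of u "\<ominus>\<^bsub>W\<^esub> u"] zero by (simp add: W.M.r_neg)
      then show "\<exists>neg_v\<in>carrier A. v \<oplus>\<^bsub>A\<^esub> neg_v = \<zero>\<^bsub>A\<^esub>"
        using fW [of "\<ominus>\<^bsub>W\<^esub> u"] u by auto
    qed
  qed (auto simp: A W.M.a_ac W.smult_assoc1 W.smult_l_distr W.smult_r_distr
      simp flip: add smult zero intro!: bexI)
qed

text \<open>
  Both equivariant cohomology and \<open>E\<^sub>\<infinity>\<close> are direct sums of subquotients \<open>Z i / D i\<close> of this kind, where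
  an invariant polynomial of degree \<open>k\<close> multiplies the summand at \<open>src k i\<close> into the one at \<open>i\<close>.
\<close>

locale graded_subquotient =
  fixes G :: "'g lie_group_data"
    and Z D :: "'i \<Rightarrow> ('g, 'm) cform set" and src :: "nat \<Rightarrow> 'i \<Rightarrow> 'i" and P :: "'i \<Rightarrow> bool"
  assumes G: "lie_group G" and domR: "domain (inv_poly_ring G)"
    and Z: "\<And>i. cform_subspace (Z i)" and D: "\<And>i. cform_subspace (D i)"
    and Z_outside: "\<And>i. Z i \<subseteq> {z. \<forall>X. X \<notin> lie_algebra G \<longrightarrow> z X = (\<lambda>Ys p. 0)}"
    and Z_mult: "\<And>k f i z. f \<in> sym_power G k \<Longrightarrow> Ad_invariant G f \<Longrightarrow> z \<in> Z (src k i) \<Longrightarrow>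
      (\<lambda>X Ys p. f X * z X Ys p) \<in> Z i"
    and D_mult: "\<And>k f i z. f \<in> sym_power G k \<Longrightarrow> Ad_invariant G f \<Longrightarrow> z \<in> D (src k i) \<Longrightarrow>
      (\<lambda>X Ys p. f X * z X Ys p) \<in> D i"
    and src_0: "\<And>i. src 0 i = i" and src_add: "\<And>k l i. src k (src l i) = src (k + l) i"
    and src_inj: "\<And>k. inj (src k)" and P_src: "\<And>k i. P (src k i) \<longleftrightarrow> P i"
begin

abbreviation R where "R \<equiv> inv_poly_ring G"
abbreviation hc where "hc \<equiv> hom_component G"
abbreviation Q where "Q \<equiv> \<lambda>i. quotient_space cform_space (Z i) (D i)"

text \<open>
  Finitely supported families of representatives; they form a module that maps onto the direct sum.
\<close>

definition reps :: "('i \<Rightarrow> ('g, 'm) cform) set" where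
  "reps = {w. (\<forall>i. w i \<in> Z i) \<and> finite {i. w i \<noteq> (\<lambda>X Ys p. 0)} \<and> (\<forall>i. \<not> P i \<longrightarrow> w i = (\<lambda>X Ys p. 0))}"

text \<open>
  The term for \<open>k\<close> is the homogeneous component of degree \<open>k\<close> acting from \<open>Z (src k i)\<close> to \<open>Z i\<close>.
\<close>

definition scal :: "('g vf \<Rightarrow> real) \<Rightarrow> ('i \<Rightarrow> ('g, 'm) cform) \<Rightarrow> 'i \<Rightarrow> ('g, 'm) cform" where
  "scal a w = (\<lambda>i X Ys p. \<Sum>k | hc a k \<noteq> (\<lambda>X. 0). hc a k X * w (src k i) X Ys p)"

definition rep_module :: "('g vf \<Rightarrow> real, 'i \<Rightarrow> ('g, 'm) cform) module" where
  "rep_module = \<lparr>carrier = reps, monoid.mult = (\<lambda>v w i X Ys p. 0), one = (\<lambda>i X Ys p. 0),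
     zero = (\<lambda>i X Ys p. 0), add = (\<lambda>v w i X Ys p. v i X Ys p + w i X Ys p), smult = scal\<rparr>"

abbreviation total :: "('g vf \<Rightarrow> real, 'i \<Rightarrow> ('g, 'm) cform set) module" where
  "total \<equiv> graded_sum cform_space (\<lambda>X. 0) hc Q src P"

definition cls :: "('i \<Rightarrow> ('g, 'm) cform) \<Rightarrow> 'i \<Rightarrow> ('g, 'm) cform set" where
  "cls w = (\<lambda>i. D i +>\<^bsub>cform_space\<^esub> w i)"

lemma rep_module_simps:
  "carrier rep_module = reps" "\<zero>\<^bsub>rep_module\<^esub> = (\<lambda>i X Ys p. 0)"
  "v \<oplus>\<^bsub>rep_module\<^esub> w = (\<lambda>i X Ys p. v i X Ys p + w i X Ys p)" "a \<odot>\<^bsub>rep_module\<^esub> w = scal a w"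
  by (simp_all add: rep_module_def)

lemma hc_finite: "a \<in> carrier R \<Longrightarrow> finite {k. hc a k \<noteq> (\<lambda>X. 0)}"
  using hom_component_decomposition [OF G] by (simp add: graded_decomposition_def)

lemma scal_bounded:
  assumes "\<And>k. k \<ge> N \<Longrightarrow> hc a k = (\<lambda>X. 0)"
  shows "scal a w i X Ys p = (\<Sum>k<N. hc a k X * w (src k i) X Ys p)"
  unfolding scal_def
proof (rule sum.mono_neutral_left)
  show "{k. hc a k \<noteq> (\<lambda>X. 0)} \<subseteq> {..<N}"
    using assms by (force simp: not_less)
qed auto

lemma hc_mult:
  assumes "a \<in> carrier R" "z \<in> Z (src k i)"
  shows "(\<lambda>X Ys p. hc a k X * z X Ys p) \<in> Z i"
  using assms by (intro Z_mult [of _ k] hom_component_sym_power hom_component_invariant G)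

lemma reps_add:
  assumes "v \<in> reps" "w \<in> reps"
  shows "(\<lambda>i X Ys p. a * v i X Ys p + b * w i X Ys p) \<in> reps"
proof -
  have "{i. (\<lambda>X Ys p. a * v i X Ys p + b * w i X Ys p) \<noteq> (\<lambda>X Ys p. 0)} \<subseteq>
      {i. v i \<noteq> (\<lambda>X Ys p. 0)} \<union> {i. w i \<noteq> (\<lambda>X Ys p. 0)}"
    by auto
  then show ?thesis
    using assms finite_subset unfolding reps_def
    by (auto intro!: cform_subspaceD(2) [OF Z])
qed

lemma reps_scal:
  assumes a: "a \<in> carrier R" and w: "w \<in> reps"
  shows "scal a w \<in> reps"
proof -
  let ?K = "{k. hc a k \<noteq> (\<lambda>X. 0)}" and ?S = "{i. w i \<noteq> (\<lambda>X Ys p. 0)}"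
  have "scal a w i \<in> Z i" for i
    unfolding scal_def using w
    by (intro cform_subspace_sum [OF Z]) (auto simp: reps_def intro!: hc_mult [OF a])
  moreover have "finite {i. scal a w i \<noteq> (\<lambda>X Ys p. 0)}"
  proof (rule finite_subset)
    show "{i. scal a w i \<noteq> (\<lambda>X Ys p. 0)} \<subseteq> (\<Union>k\<in>?K. src k -` ?S)"
    proof
      fix i assume i: "i \<in> {i. scal a w i \<noteq> (\<lambda>X Ys p. 0)}"
      show "i \<in> (\<Union>k\<in>?K. src k -` ?S)"
      proof (rule ccontr)
        assume "\<not> ?thesis"
        then have "scal a w i = (\<lambda>X Ys p. 0)"
          by (auto simp: scal_def fun_eq_iff intro!: sum.neutral)
        then show False using i by simp
      qed
    qed
    show "finite (\<Union>k\<in>?K. src k -` ?S)"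
      using w by (intro finite_UN_I hc_finite a finite_vimageI src_inj) (simp add: reps_def)
  qed
  moreover have "scal a w i = (\<lambda>X Ys p. 0)" if "\<not> P i" for i
    using w that P_src by (auto simp: scal_def reps_def fun_eq_iff intro!: sum.neutral)
  ultimately show ?thesis
    by (simp add: reps_def)
qed

text \<open>
  Associativity is the comparison of two double sums: the homogeneous components of a product are
  given by the Cauchy product, and shifting by \<open>j\<close> and by \<open>l\<close> amounts to shifting by \<open>j + l\<close>.
\<close>

lemma module_rep_module: "module R rep_module"
proof (rule module_criteria, unfold rep_module_simps)
  show "cring R"
    using domR by (simp add: domain_def)
  show zero: "(\<lambda>i X Ys p. 0) \<in> reps"
    using cform_subspaceD(1) [OF Z] by (simp add: reps_def)
  show "\<forall>v w. v \<in> reps \<and> w \<in> reps \<longrightarrow> (\<lambda>i X Ys p. v i X Ys p + w i X Ys p) \<in> reps"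
    using reps_add [of _ _ 1 1] by simp
  show "\<forall>v\<in>reps. \<exists>neg_v\<in>reps. (\<lambda>i X Ys p. v i X Ys p + neg_v i X Ys p) = (\<lambda>i X Ys p. 0)"
  proof
    fix v assume "v \<in> reps"
    then have "(\<lambda>i X Ys p. - v i X Ys p) \<in> reps"
      using reps_add [of v v "- 1" 0] by simp
    then show "\<exists>neg_v\<in>reps. (\<lambda>i X Ys p. v i X Ys p + neg_v i X Ys p) = (\<lambda>i X Ys p. 0)"
      by (rule bexI [rotated]) simp
  qed
  show "\<forall>c v. c \<in> carrier R \<and> v \<in> reps \<longrightarrow> scal c v \<in> reps"
    using reps_scal by blast
  show "\<forall>v w. v \<in> reps \<and> w \<in> reps \<longrightarrow> (\<lambda>i X Ys p. v i X Ys p + w i X Ys p) = (\<lambda>i X Ys p. w i X Ys p + v i X Ys p)"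
    by (simp add: add.commute)
  show "\<forall>v w x. v \<in> reps \<and> w \<in> reps \<and> x \<in> reps \<longrightarrow>
      (\<lambda>i X Ys p. v i X Ys p + w i X Ys p + x i X Ys p) = (\<lambda>i X Ys p. v i X Ys p + (w i X Ys p + x i X Ys p))"
    by (simp add: add.assoc)
  show "\<forall>v\<in>reps. (\<lambda>i X Ys p. v i X Ys p + 0) = v"
    by simp
  show "\<forall>a b v. a \<in> carrier R \<and> b \<in> carrier R \<and> v \<in> reps \<longrightarrow> scal (a \<otimes>\<^bsub>R\<^esub> b) v = scal a (scal b v)"
  proof (intro allI impI ext)
    fix a b v i X Ys p assume "a \<in> carrier R \<and> b \<in> carrier R \<and> v \<in> reps"
    then have a: "a \<in> carrier R" and b: "b \<in> carrier R" by auto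
    obtain A where A: "\<And>k. k \<ge> A \<Longrightarrow> hc a k = (\<lambda>X. 0)"
      using hom_component_vanishes [OF G a] by blast
    obtain B where B: "\<And>k. k \<ge> B \<Longrightarrow> hc b k = (\<lambda>X. 0)"
      using hom_component_vanishes [OF G b] by blast
    have Az: "hc a k X = 0" if "k \<ge> A" for k using A [OF that] by simp
    have Bz: "hc b k X = 0" if "k \<ge> B" for k using B [OF that] by simp
    have ab: "hc (a \<otimes>\<^bsub>R\<^esub> b) = (\<lambda>k X. \<Sum>i\<le>k. hc a i X * hc b (k - i) X)"
      unfolding inv_poly_ring_simps by (rule hom_component_mult [OF G a b])
    have "hc (a \<otimes>\<^bsub>R\<^esub> b) k = (\<lambda>X. 0)" if "k \<ge> A + B" for k
      unfolding ab
    proof (intro ext sum.neutral ballI)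
      fix X j
      show "hc a j X * hc b (k - j) X = 0"
        using A [of j] B [of "k - j"] that by (cases "j \<ge> A") auto
    qed
    then have "scal (a \<otimes>\<^bsub>R\<^esub> b) v i X Ys p = (\<Sum>k<A + B. \<Sum>j\<le>k. hc a j X * hc b (k - j) X * v (src k i) X Ys p)"
      by (simp add: scal_bounded [of "A + B"] ab sum_distrib_right)
    also have "\<dots> = (\<Sum>k<A + B. \<Sum>j\<le>k. hc a j X * hc b (k - j) X * v (src (j + (k - j)) i) X Ys p)"
      by (intro sum.cong refl) simp
    also have "\<dots> = (\<Sum>(j, l)\<in>{(j, l). j + l < A + B}. hc a j X * hc b l X * v (src (j + l) i) X Ys p)"
      by (rule sum.triangle_reindex [symmetric])
    also have "\<dots> = (\<Sum>(j, l)\<in>{..<A} \<times> {..<B}. hc a j X * hc b l X * v (src (j + l) i) X Ys p)"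
    proof (rule sum.mono_neutral_right)
      have "{(j, l). j + l < A + B} \<subseteq> {..<A + B} \<times> {..<A + B}" by auto
      then show "finite {(j, l). j + l < A + B}"
        by (rule finite_subset) simp
      show "\<forall>x\<in>{(j, l). j + l < A + B} - {..<A} \<times> {..<B}.
          (case x of (j, l) \<Rightarrow> hc a j X * hc b l X * v (src (j + l) i) X Ys p) = 0"
        using Az Bz by (auto simp flip: not_less) blast+
    qed auto
    also have "\<dots> = (\<Sum>j<A. \<Sum>l<B. hc a j X * hc b l X * v (src (j + l) i) X Ys p)"
      by (simp add: sum.cartesian_product)
    also have "\<dots> = scal a (scal b v) i X Ys p"
      by (simp add: scal_bounded [of A, OF A] scal_bounded [of B, OF B] sum_distrib_left mult.assoc
          src_add add.commute)
    finally show "scal (a \<otimes>\<^bsub>R\<^esub> b) v i X Ys p = scal a (scal b v) i X Ys p" .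
  qed
  show "\<forall>v\<in>reps. scal \<one>\<^bsub>R\<^esub> v = v"
  proof (intro ballI ext)
    fix v i X Ys p assume v: "v \<in> reps"
    have e: "hc \<one>\<^bsub>R\<^esub> = (\<lambda>k. if k = 0 then \<one>\<^bsub>R\<^esub> else (\<lambda>X. 0))"
      by (rule hom_component_eqI [OF G graded_decomposition_one])
    have "scal \<one>\<^bsub>R\<^esub> v i X Ys p = (\<Sum>k<1. hc \<one>\<^bsub>R\<^esub> k X * v (src k i) X Ys p)"
      by (rule scal_bounded) (simp add: e)
    also have "\<dots> = v i X Ys p"
    proof (cases "X \<in> lie_algebra G")
      case False
      have "v i \<in> Z i"
        using v by (simp add: reps_def)
      then have "v i X = (\<lambda>Ys p. 0)"
        using Z_outside [of i] False by blast
      then show ?thesis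
        unfolding e by (simp add: src_0 inv_poly_ring_simps)
    qed (unfold e, simp add: src_0 inv_poly_ring_simps)
    finally show "scal \<one>\<^bsub>R\<^esub> v i X Ys p = v i X Ys p" .
  qed
  show "\<forall>a b v. a \<in> carrier R \<and> b \<in> carrier R \<and> v \<in> reps \<longrightarrow>
      scal (a \<oplus>\<^bsub>R\<^esub> b) v = (\<lambda>i X Ys p. scal a v i X Ys p + scal b v i X Ys p)"
  proof (intro allI impI ext)
    fix a b v i X Ys p assume "a \<in> carrier R \<and> b \<in> carrier R \<and> v \<in> reps"
    then have a: "a \<in> carrier R" and b: "b \<in> carrier R" by auto
    obtain A where A: "\<And>k. k \<ge> A \<Longrightarrow> hc a k = (\<lambda>X. 0)"
      using hom_component_vanishes [OF G a] by blast
    obtain B where B: "\<And>k. k \<ge> B \<Longrightarrow> hc b k = (\<lambda>X. 0)"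
      using hom_component_vanishes [OF G b] by blast
    have ab: "hc (a \<oplus>\<^bsub>R\<^esub> b) = (\<lambda>k X. hc a k X + hc b k X)"
      unfolding inv_poly_ring_simps by (rule hom_component_add [OF G a b])
    have "scal (a \<oplus>\<^bsub>R\<^esub> b) v i X Ys p = (\<Sum>k<max A B. hc (a \<oplus>\<^bsub>R\<^esub> b) k X * v (src k i) X Ys p)"
      by (rule scal_bounded) (simp add: ab A B)
    moreover have "scal a v i X Ys p = (\<Sum>k<max A B. hc a k X * v (src k i) X Ys p)"
      "scal b v i X Ys p = (\<Sum>k<max A B. hc b k X * v (src k i) X Ys p)"
      by (rule scal_bounded, simp add: A B)+
    ultimately show "scal (a \<oplus>\<^bsub>R\<^esub> b) v i X Ys p = scal a v i X Ys p + scal b v i X Ys p"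
      by (simp add: ab sum.distrib algebra_simps)
  qed
  show "\<forall>a v w. a \<in> carrier R \<and> v \<in> reps \<and> w \<in> reps \<longrightarrow>
      scal a (\<lambda>i X Ys p. v i X Ys p + w i X Ys p) = (\<lambda>i X Ys p. scal a v i X Ys p + scal a w i X Ys p)"
    by (simp add: scal_def sum.distrib algebra_simps)
qed

lemma total_simps:
  "carrier total = {e. (\<forall>i. e i \<in> (\<lambda>z. D i +>\<^bsub>cform_space\<^esub> z) ` Z i) \<and> finite {i. e i \<noteq> D i} \<and>
     (\<forall>i. \<not> P i \<longrightarrow> e i = D i)}"
  "\<zero>\<^bsub>total\<^esub> = D"
  "d \<oplus>\<^bsub>total\<^esub> e = (\<lambda>i. d i <+>\<^bsub>cform_space\<^esub> e i)"
  "a \<odot>\<^bsub>total\<^esub> e = (\<lambda>i. \<Oplus>\<^bsub>Q i\<^esub>k\<in>{k. hc a k \<noteq> (\<lambda>X. 0)}. coset_smult cform_space (D i) (hc a k) (e (src k i)))"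
  by (simp_all add: graded_sum_def quotient_space_simps)

lemma cls_zero_iff: "cls w = \<zero>\<^bsub>total\<^esub> \<longleftrightarrow> (\<forall>i. w i \<in> D i)"
  by (simp add: cls_def total_simps fun_eq_iff cform_coset_eq_self_iff [OF D])

lemma cls_eq_iff: "cls v = cls w \<longleftrightarrow> (\<forall>i. (\<lambda>X Ys p. v i X Ys p - w i X Ys p) \<in> D i)"
  by (simp add: cls_def fun_eq_iff [of "\<lambda>i. D i +>\<^bsub>cform_space\<^esub> v i"] cform_coset_eq_iff [OF D])

lemma cls_onto: "cls ` reps = carrier total"
proof (intro equalityI subsetI)
  fix e assume "e \<in> cls ` reps"
  then obtain w where w: "w \<in> reps" "e = cls w" by blast
  have "{i. cls w i \<noteq> D i} \<subseteq> {i. w i \<noteq> (\<lambda>X Ys p. 0)}"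
    by (auto simp: cls_def cform_coset_zero)
  then have "finite {i. cls w i \<noteq> D i}"
    using w(1) finite_subset by (auto simp: reps_def)
  then show "e \<in> carrier total"
    using w by (auto simp: total_simps reps_def cls_def cform_coset_zero)
next
  fix e assume e: "e \<in> carrier total"
  then have "\<forall>i. \<exists>z. z \<in> Z i \<and> e i = D i +>\<^bsub>cform_space\<^esub> z"
    by (auto simp: total_simps)
  then obtain z where z: "\<And>i. z i \<in> Z i" "\<And>i. e i = D i +>\<^bsub>cform_space\<^esub> z i"
    by metis
  let ?w = "\<lambda>i. if e i = D i then (\<lambda>X Ys p. 0) else z i"
  have "finite {i. ?w i \<noteq> (\<lambda>X Ys p. 0)}"
    by (rule finite_subset [of _ "{i. e i \<noteq> D i}"]) (use e in \<open>auto simp: total_simps\<close>)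
  then have "?w \<in> reps"
    using e z(1) cform_subspaceD(1) [OF Z] by (auto simp: reps_def total_simps)
  moreover have "cls ?w = e"
    using z(2) by (auto simp: cls_def fun_eq_iff [of _ e] cform_coset_zero)
  ultimately show "e \<in> cls ` reps"
    using imageI [of ?w reps cls] by simp
qed

lemma cls_add: "cls (\<lambda>i X Ys p. v i X Ys p + w i X Ys p) = cls v \<oplus>\<^bsub>total\<^esub> cls w"
  by (simp add: cls_def total_simps cform_coset_add [OF D])

lemma cls_scal:
  assumes a: "a \<in> carrier R" and w: "w \<in> reps"
  shows "cls (scal a w) = a \<odot>\<^bsub>total\<^esub> cls w"
proof
  fix i
  let ?K = "{k. hc a k \<noteq> (\<lambda>X. 0)}"
  have "coset_smult cform_space (D i) (hc a k) (cls w (src k i)) =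
      D i +>\<^bsub>cform_space\<^esub> (\<lambda>X Ys p. hc a k X * w (src k i) X Ys p)" for k
    unfolding cls_def
    by (rule coset_smult_coset [OF D D])
      (intro D_mult [of _ k] hom_component_sym_power hom_component_invariant G a)
  then have "(a \<odot>\<^bsub>total\<^esub> cls w) i =
      (\<Oplus>\<^bsub>Q i\<^esub>k\<in>?K. D i +>\<^bsub>cform_space\<^esub> (\<lambda>X Ys p. hc a k X * w (src k i) X Ys p))"
    by (simp add: total_simps)
  also have "\<dots> = D i +>\<^bsub>cform_space\<^esub> scal a w i"
    unfolding scal_def using w
    by (intro finsum_cosets [OF Z D] hc_finite a hc_mult) (simp add: reps_def)
  finally show "cls (scal a w) i = (a \<odot>\<^bsub>total\<^esub> cls w) i"
    by (simp add: cls_def)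
qed

lemma module_total: "module R total"
proof (rule module_surj_image [OF module_rep_module, of cls])
  show "cls \<zero>\<^bsub>rep_module\<^esub> = \<zero>\<^bsub>total\<^esub>"
    by (simp add: rep_module_simps cls_def cform_coset_zero total_simps(2))
qed (auto simp: rep_module_simps cls_onto cls_add cls_scal)

lemma cls_hom: "cls \<in> module_hom R rep_module total"
  using cls_onto by (auto simp: module_hom_def rep_module_simps cls_add cls_scal)

end

section \<open>The filtration by fibre degree\<close>

context
  fixes G :: "'g lie_group_data" and M :: "'m mfd" and act :: "'g \<Rightarrow> 'm \<Rightarrow> 'm"
  assumes G: "lie_group G" and M: "smooth_manifold M"
begin

abbreviation "F \<equiv> cartan_filt G M act"
abbreviation "d \<equiv> cartan_diff G M act"

definition filt_cycles :: "int \<Rightarrow> int \<Rightarrow> ('g, 'm) cform set" where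
  "filt_cycles p n = {x \<in> F p n. d x = (\<lambda>X Ys p. 0)}"

text \<open>
  The denominator of \<open>E\<^sub>\<infinity>\<close> in filtration degree \<open>p\<close> and total degree \<open>n\<close>.
\<close>

definition filt_boundaries :: "int \<Rightarrow> int \<Rightarrow> ('g, 'm) cform set" where
  "filt_boundaries p n = {(\<lambda>X Ys x. y X Ys x + d z X Ys x) | y z.
     y \<in> filt_cycles (p + 1) n \<and> z \<in> F 0 (n - 1) \<and> d z \<in> F p n}"

abbreviation boundaries :: "int \<Rightarrow> ('g, 'm) cform set" where
  "boundaries n \<equiv> d ` F 0 (n - 1)"

lemma diff_lincomb:
  assumes "x \<in> F p n" "y \<in> F p' n'"
  shows "d (\<lambda>X Ys p. a * x X Ys p + b * y X Ys p) = (\<lambda>X Ys p. a * d x X Ys p + b * d y X Ys p)"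
  by (rule cartan_diff_lincomb [of x M y G act "\<lambda>X. a" "\<lambda>X. b",
        OF cartan_filt_smooth [OF M assms(1)] cartan_filt_smooth [OF M assms(2)]])

lemma diff_mult:
  assumes "x \<in> F p n"
  shows "d (\<lambda>X Ys p. f X * x X Ys p) = (\<lambda>X Ys p. f X * d x X Ys p)"
  by (rule cartan_diff_mult [of x M G act f, OF cartan_filt_smooth [OF M assms]])

lemma zero_F: "(\<lambda>X Ys x. 0) \<in> F p n"
  by (rule cform_subspaceD(1) [OF cartan_filt_subspace])

lemma F_subset_F_zero: "F p n \<subseteq> F 0 n"
  using cartan_filt_antimono [of 0 p G M act n] cartan_filt_nonpos [of p G M act n] by (cases "p \<ge> 0") auto

lemma filt_cycles_subspace: "cform_subspace (filt_cycles p n)"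
  unfolding cform_subspace_def
proof (intro conjI ballI allI)
  show "(\<lambda>X Ys p. 0) \<in> filt_cycles p n"
    by (simp add: filt_cycles_def zero_F cartan_diff_zero)
  fix \<omega> \<eta> a b assume "\<omega> \<in> filt_cycles p n" "\<eta> \<in> filt_cycles p n"
  then show "(\<lambda>X Ys p. a * \<omega> X Ys p + b * \<eta> X Ys p) \<in> filt_cycles p n"
    using cform_subspaceD(2) [OF cartan_filt_subspace, of \<omega> G M act p n \<eta> a b]
    by (simp add: filt_cycles_def diff_lincomb [of \<omega> p n \<eta> p n])
qed

lemma boundaries_subspace: "cform_subspace (boundaries n)"
  unfolding cform_subspace_def
proof (intro conjI ballI allI)
  show "(\<lambda>X Ys p. 0) \<in> boundaries n"
    using imageI [OF zero_F, of d 0 "n - 1"] by (simp only: cartan_diff_zero)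
  fix \<omega> \<eta> a b assume "\<omega> \<in> boundaries n" "\<eta> \<in> boundaries n"
  then obtain x y where x: "x \<in> F 0 (n - 1)" "\<omega> = d x" and y: "y \<in> F 0 (n - 1)" "\<eta> = d y"
    by blast
  show "(\<lambda>X Ys p. a * \<omega> X Ys p + b * \<eta> X Ys p) \<in> boundaries n"
    unfolding x(2) y(2) diff_lincomb [OF x(1) y(1), symmetric]
    by (intro imageI cform_subspaceD(2) [OF cartan_filt_subspace] x(1) y(1))
qed

lemma filt_boundaries_subspace: "cform_subspace (filt_boundaries p n)"
  unfolding cform_subspace_def
proof (intro conjI ballI allI)
  have "(\<lambda>X Ys p. 0) \<in> filt_cycles (p + 1) n" "(\<lambda>X Ys p. 0) \<in> F 0 (n - 1)" "(\<lambda>X Ys p. 0) \<in> F p n"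
    using cform_subspaceD(1) filt_cycles_subspace cartan_filt_subspace by blast+
  then show "(\<lambda>X Ys p. 0) \<in> filt_boundaries p n"
    unfolding filt_boundaries_def
    by (intro CollectI exI [of _ "\<lambda>X Ys p. 0"]) (simp add: cartan_diff_zero)
  fix \<omega> \<eta> a b assume "\<omega> \<in> filt_boundaries p n" "\<eta> \<in> filt_boundaries p n"
  then obtain x y x' y' where y: "y \<in> filt_cycles (p + 1) n" "x \<in> F 0 (n - 1)" "d x \<in> F p n"
    "\<omega> = (\<lambda>X Ys p. y X Ys p + d x X Ys p)"
    and y': "y' \<in> filt_cycles (p + 1) n" "x' \<in> F 0 (n - 1)" "d x' \<in> F p n"
    "\<eta> = (\<lambda>X Ys p. y' X Ys p + d x' X Ys p)"
    unfolding filt_boundaries_def by auto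
  let ?y = "\<lambda>X Ys p. a * y X Ys p + b * y' X Ys p"
  let ?x = "\<lambda>X Ys p. a * x X Ys p + b * x' X Ys p"
  have dx: "d ?x = (\<lambda>X Ys p. a * d x X Ys p + b * d x' X Ys p)"
    by (rule diff_lincomb [OF y(2) y'(2)])
  have "?y \<in> filt_cycles (p + 1) n" "?x \<in> F 0 (n - 1)" "d ?x \<in> F p n"
    unfolding dx using y y'
    by (auto intro: cform_subspaceD(2) [OF filt_cycles_subspace] cform_subspaceD(2) [OF cartan_filt_subspace])
  moreover have "(\<lambda>X Ys p. a * \<omega> X Ys p + b * \<eta> X Ys p) = (\<lambda>X Ys p. ?y X Ys p + d ?x X Ys p)"
    unfolding dx by (simp add: y(4) y'(4) algebra_simps)
  ultimately show "(\<lambda>X Ys p. a * \<omega> X Ys p + b * \<eta> X Ys p) \<in> filt_boundaries p n"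
    unfolding filt_boundaries_def by (intro CollectI exI conjI)
qed

lemma filt_mult:
  assumes f: "f \<in> sym_power G k" "Ad_invariant G f" and x: "x \<in> F (p - 2 * int k) (n - 2 * int k)"
  shows "(\<lambda>X Ys x'. f X * x X Ys x') \<in> F p n"
  using cartan_filt_mult [OF f x] by simp

lemma filt_cycles_mult:
  assumes f: "f \<in> sym_power G k" "Ad_invariant G f" and x: "x \<in> filt_cycles (p - 2 * int k) (n - 2 * int k)"
  shows "(\<lambda>X Ys x'. f X * x X Ys x') \<in> filt_cycles p n"
proof -
  have xF: "x \<in> F (p - 2 * int k) (n - 2 * int k)" "d x = (\<lambda>X Ys p. 0)"
    using x by (auto simp: filt_cycles_def)
  show ?thesis
    using filt_mult [OF f xF(1)] diff_mult [OF xF(1), of f] xF(2) by (simp add: filt_cycles_def)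
qed

lemma F_zero_mult:
  assumes f: "f \<in> sym_power G k" "Ad_invariant G f" and x: "x \<in> F 0 (n - 2 * int k)"
  shows "(\<lambda>X Ys x'. f X * x X Ys x') \<in> F 0 n"
proof -
  have "x \<in> F (0 - 2 * int k) (n - 2 * int k)"
    using x cartan_filt_nonpos [of "0 - 2 * int k" G M act] by simp
  then show ?thesis
    by (rule filt_mult [OF f])
qed

lemma boundaries_mult:
  assumes f: "f \<in> sym_power G k" "Ad_invariant G f" and x: "x \<in> boundaries (n - 2 * int k)"
  shows "(\<lambda>X Ys x'. f X * x X Ys x') \<in> boundaries n"
proof -
  obtain y where y: "y \<in> F 0 (n - 2 * int k - 1)" "x = d y"
    using x by blast
  have "(\<lambda>X Ys x'. f X * y X Ys x') \<in> F 0 (n - 1)"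
    using y(1) by (intro F_zero_mult [OF f]) (simp add: algebra_simps)
  then show ?thesis
    unfolding y(2) diff_mult [OF y(1), symmetric] by (rule imageI)
qed

lemma filt_boundaries_mult:
  assumes f: "f \<in> sym_power G k" "Ad_invariant G f" and x: "x \<in> filt_boundaries (p - 2 * int k) (n - 2 * int k)"
  shows "(\<lambda>X Ys x'. f X * x X Ys x') \<in> filt_boundaries p n"
proof -
  obtain y z where y: "y \<in> filt_cycles (p - 2 * int k + 1) (n - 2 * int k)" "z \<in> F 0 (n - 2 * int k - 1)"
    "d z \<in> F (p - 2 * int k) (n - 2 * int k)" "x = (\<lambda>X Ys p. y X Ys p + d z X Ys p)"
    using x unfolding filt_boundaries_def by auto
  let ?y = "\<lambda>X Ys x'. f X * y X Ys x'" and ?z = "\<lambda>X Ys x'. f X * z X Ys x'"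
  have dz: "d ?z = (\<lambda>X Ys x'. f X * d z X Ys x')"
    by (rule diff_mult [OF y(2)])
  have "?y \<in> filt_cycles (p + 1) n"
    using y(1) by (intro filt_cycles_mult [OF f]) (simp add: algebra_simps)
  moreover have "?z \<in> F 0 (n - 1)"
    using y(2) by (intro F_zero_mult [OF f]) (simp add: algebra_simps)
  moreover have "d ?z \<in> F p n"
    unfolding dz by (rule filt_mult [OF f y(3)])
  moreover have "(\<lambda>X Ys x'. f X * x X Ys x') = (\<lambda>X Ys x'. ?y X Ys x' + d ?z X Ys x')"
    unfolding dz by (simp add: y(4) algebra_simps)
  ultimately show ?thesis
    unfolding filt_boundaries_def by (intro CollectI exI conjI)
qed

lemma equiv_cohomology_eq:
  "equiv_cohomology G M act = (\<lambda>n. quotient_space cform_space (filt_cycles 0 n) (boundaries n))"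
  by (simp add: fun_eq_iff equiv_cohomology_def cartan_deg_def filt_cycles_def)

text \<open>
  For the page number in the definition of \<open>E_inf\<close>, the condition on differentials of cycles lands in a
  filtration step above the total degree, which is \<open>0\<close>, and the boundaries come from a step below
  \<open>0\<close>, which is the whole complex.
\<close>

lemma E_inf_eq:
  "E_inf G M act p q = quotient_space cform_space (filt_cycles p (p + q)) (filt_boundaries p (p + q))"
proof -
  let ?r = "\<bar>p\<bar> + \<bar>q\<bar> + 2"
  have cyc: "ss_cycles G M act s a b = filt_cycles a (a + b)" if "s \<ge> b + 2" for s a b
    using that by (simp add: ss_cycles_def filt_cycles_def cartan_filt_above)
  have "ss_cycles G M act ?r p q = filt_cycles p (p + q)"
    by (rule cyc) simp
  moreover have "ss_cycles G M act (?r - 1) (p + 1) (q - 1) = filt_cycles (p + 1) (p + q)"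
    using cyc [of "q - 1" "?r - 1" "p + 1"] by (simp add: algebra_simps)
  moreover have "ss_cycles G M act (?r - 1) (p - ?r + 1) (q + ?r - 2) = {x \<in> F 0 (p + q - 1). d x \<in> F p (p + q)}"
  proof -
    have e: "(p - ?r + 1) + (q + ?r - 2) = p + q - 1" "(p - ?r + 1) + (?r - 1) = p" "p + q - 1 + 1 = p + q"
      by simp_all
    have "F (p - ?r + 1) (p + q - 1) = F 0 (p + q - 1)"
      by (intro cartan_filt_nonpos) linarith
    then show ?thesis
      unfolding ss_cycles_def e by simp
  qed
  moreover have "filt_cycles (p + 1) (p + q) <+>\<^bsub>cform_space\<^esub> d ` {x \<in> F 0 (p + q - 1). d x \<in> F p (p + q)} =
      filt_boundaries p (p + q)"
    unfolding cform_set_add filt_boundaries_def by (intro equalityI subsetI; clarsimp; fastforce)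
  ultimately show ?thesis
    unfolding E_inf_def ss_page_def by simp
qed

text \<open>
  The unit of the ring of invariant polynomials is \<open>0\<close> outside the Lie algebra, so that it acts as
  the identity only on forms that vanish there.
\<close>

lemma filt_cycles_outside:
  "filt_cycles p n \<subseteq> {z. \<forall>X. X \<notin> lie_algebra G \<longrightarrow> z X = (\<lambda>Ys p. 0)}"
proof
  fix z assume z: "z \<in> filt_cycles p n"
  have "\<forall>X. X \<notin> lie_algebra G \<longrightarrow> z X = (\<lambda>Ys p. 0)"
  proof (intro allI impI)
    fix X assume X: "X \<notin> lie_algebra G"
    show "z X = (\<lambda>Ys p. 0)"
      using cartan_filt_outside [of z G M act p n X] z X by (simp add: filt_cycles_def fun_eq_iff)
  qed
  then show "z \<in> {z. \<forall>X. X \<notin> lie_algebra G \<longrightarrow> z X = (\<lambda>Ys p. 0)}"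
    by simp
qed

context
  fixes P :: "int \<Rightarrow> bool"
  assumes P: "\<And>n k. P (n - 2 * int k) \<longleftrightarrow> P n"
begin

interpretation H: graded_subquotient G "filt_cycles 0" boundaries "\<lambda>k n. n - 2 * int k" P
proof (rule graded_subquotient.intro)
  show "lie_group G" by (rule G)
  show "domain (inv_poly_ring G)" by (rule domain_inv_poly_ring [OF G])
  show "cform_subspace (filt_cycles 0 i)" for i by (rule filt_cycles_subspace)
  show "cform_subspace (boundaries i)" for i by (rule boundaries_subspace)
  show "filt_cycles 0 i \<subseteq> {z. \<forall>X. X \<notin> lie_algebra G \<longrightarrow> z X = (\<lambda>Ys p. 0)}" for i
    by (rule filt_cycles_outside)
  show "(\<lambda>X Ys p. f X * z X Ys p) \<in> filt_cycles 0 i"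
    if "f \<in> sym_power G k" "Ad_invariant G f" "z \<in> filt_cycles 0 (i - 2 * int k)" for k f i z
  proof -
    have "z \<in> filt_cycles (0 - 2 * int k) (i - 2 * int k)"
      using that(3) cartan_filt_nonpos [of "0 - 2 * int k" G M act] by (simp add: filt_cycles_def)
    then show ?thesis
      by (rule filt_cycles_mult [OF that(1,2)])
  qed
  show "(\<lambda>X Ys p. f X * z X Ys p) \<in> boundaries i"
    if "f \<in> sym_power G k" "Ad_invariant G f" "z \<in> boundaries (i - 2 * int k)" for k f i z
    by (rule boundaries_mult [OF that])
qed (auto simp: P inj_def)

interpretation E: graded_subquotient G "\<lambda>(p, q). filt_cycles p (p + q)" "\<lambda>(p, q). filt_boundaries p (p + q)"
  "\<lambda>k (p, q). (p - 2 * int k, q)" "\<lambda>(p, q). P (p + q)"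
proof (rule graded_subquotient.intro)
  show "lie_group G" by (rule G)
  show "domain (inv_poly_ring G)" by (rule domain_inv_poly_ring [OF G])
  show "cform_subspace (case i of (p, q) \<Rightarrow> filt_cycles p (p + q))" for i
    by (cases i) (simp add: filt_cycles_subspace)
  show "cform_subspace (case i of (p, q) \<Rightarrow> filt_boundaries p (p + q))" for i
    by (cases i) (simp add: filt_boundaries_subspace)
  show "(case i of (p, q) \<Rightarrow> filt_cycles p (p + q)) \<subseteq> {z. \<forall>X. X \<notin> lie_algebra G \<longrightarrow> z X = (\<lambda>Ys p. 0)}" for i
    by (cases i) (simp add: filt_cycles_outside)
  show "(\<lambda>X Ys p. f X * z X Ys p) \<in> (case i of (p, q) \<Rightarrow> filt_cycles p (p + q))"
    if "f \<in> sym_power G k" "Ad_invariant G f"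
      "z \<in> (case case i of (p, q) \<Rightarrow> (p - 2 * int k, q) of (p, q) \<Rightarrow> filt_cycles p (p + q))" for k f i z
    using that filt_cycles_mult [OF that(1,2), of z "fst i" "fst i + snd i"]
    by (cases i) (simp add: algebra_simps)
  show "(\<lambda>X Ys p. f X * z X Ys p) \<in> (case i of (p, q) \<Rightarrow> filt_boundaries p (p + q))"
    if "f \<in> sym_power G k" "Ad_invariant G f"
      "z \<in> (case case i of (p, q) \<Rightarrow> (p - 2 * int k, q) of (p, q) \<Rightarrow> filt_boundaries p (p + q))" for k f i z
    using that filt_boundaries_mult [OF that(1,2), of z "fst i" "fst i + snd i"]
    by (cases i) (simp add: algebra_simps)
  show "(case (case i of (p, q) \<Rightarrow> (p - 2 * int k, q)) of (p, q) \<Rightarrow> P (p + q)) \<longleftrightarrow> (case i of (p, q) \<Rightarrow> P (p + q))" for k i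
    using P [of "fst i + snd i" k] by (cases i) (simp add: algebra_simps)
qed (auto simp: inj_def)

lemma equiv_cohomology_sum_eq: "equiv_cohomology_sum G M act P = H.total"
  by (simp add: equiv_cohomology_sum_def equiv_cohomology_eq)

lemma E_inf_sum_eq: "E_inf_sum G M act P = E.total"
proof -
  have "(\<lambda>(p, q). E_inf G M act p q) = (\<lambda>i. quotient_space cform_space
      (case i of (p, q) \<Rightarrow> filt_cycles p (p + q)) (case i of (p, q) \<Rightarrow> filt_boundaries p (p + q)))"
    by (simp add: fun_eq_iff E_inf_eq)
  then show ?thesis
    by (simp add: E_inf_sum_def)
qed

text \<open>
  Families of cocycles whose member in degree \<open>n\<close> has filtration degree at least \<open>n - q\<close>, that is,
  fibre degree at most \<open>q\<close>.
\<close>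

definition low_reps :: "nat \<Rightarrow> (int \<Rightarrow> ('g, 'm) cform) set" where
  "low_reps q = {w \<in> H.reps. \<forall>n. w n \<in> F (n - int q) n}"

text \<open>
  A family of cocycles in fibre degree at most \<open>q\<close> represents an element of the row \<open>q\<close> of \<open>E\<^sub>\<infinity>\<close>.
\<close>

definition to_row :: "nat \<Rightarrow> (int \<Rightarrow> ('g, 'm) cform) \<Rightarrow> int \<times> int \<Rightarrow> ('g, 'm) cform" where
  "to_row q w = (\<lambda>(p, q'). if q' = int q then w (p + q') else (\<lambda>X Ys x. 0))"

definition low_rows :: "nat \<Rightarrow> (int \<times> int \<Rightarrow> ('g, 'm) cform) set" where
  "low_rows q = {w \<in> E.reps. \<forall>p q'. q' > int q \<longrightarrow> w (p, q') = (\<lambda>X Ys x. 0)}"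

definition row :: "nat \<Rightarrow> (int \<times> int \<Rightarrow> ('g, 'm) cform) \<Rightarrow> int \<times> int \<Rightarrow> ('g, 'm) cform" where
  "row q w = (\<lambda>(p, q'). if q' = int q then w (p, q') else (\<lambda>X Ys x. 0))"

lemma zero_filt_cycles: "(\<lambda>X Ys x. 0) \<in> filt_cycles p n"
  by (rule cform_subspaceD(1) [OF filt_cycles_subspace])

lemma zero_filt_boundaries: "(\<lambda>X Ys x. 0) \<in> filt_boundaries p n"
  by (rule cform_subspaceD(1) [OF filt_boundaries_subspace])

lemma boundary_in_filt_boundaries:
  assumes "z \<in> F 0 (n - 1)" "d z \<in> F p n"
  shows "d z \<in> filt_boundaries p n"
  unfolding filt_boundaries_def using assms zero_filt_cycles
  by (intro CollectI exI [of _ "\<lambda>X Ys x. 0"] exI [of _ z]) simp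

lemma cycle_in_filt_boundaries:
  assumes "y \<in> filt_cycles (p + 1) n"
  shows "y \<in> filt_boundaries p n"
  unfolding filt_boundaries_def using assms zero_F
  by (intro CollectI exI [of _ y] exI [of _ "\<lambda>X Ys x. 0"]) (simp add: cartan_diff_zero)

lemma E_cls_zero_iff:
  "E.cls w = \<zero>\<^bsub>E.total\<^esub> \<longleftrightarrow> (\<forall>p q. w (p, q) \<in> filt_boundaries p (p + q))"
  by (simp add: E.cls_zero_iff)

lemma E_reps_cycle: "w \<in> E.reps \<Longrightarrow> w (p, q) \<in> filt_cycles p (p + q)"
  by (simp add: E.reps_def)

lemma to_row_reps:
  assumes w: "w \<in> low_reps q"
  shows "to_row q w \<in> E.reps"
proof -
  have wH: "w \<in> H.reps" and wF: "\<And>n. w n \<in> F (n - int q) n"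
    using w by (auto simp: low_reps_def)
  have "to_row q w i \<in> (case i of (p, q) \<Rightarrow> filt_cycles p (p + q))" for i
  proof (cases i)
    case (Pair p q')
    have "d (w n) = (\<lambda>X Ys x. 0)" for n
      using wH by (auto simp: H.reps_def filt_cycles_def)
    then show ?thesis
      using wF [of "p + q'"] zero_filt_cycles by (auto simp: Pair to_row_def filt_cycles_def)
  qed
  moreover have "finite {i. to_row q w i \<noteq> (\<lambda>X Ys x. 0)}"
  proof (rule finite_subset)
    show "{i. to_row q w i \<noteq> (\<lambda>X Ys x. 0)} \<subseteq> (\<lambda>n. (n - int q, int q)) ` {n. w n \<noteq> (\<lambda>X Ys x. 0)}"
    proof
      fix i assume i: "i \<in> {i. to_row q w i \<noteq> (\<lambda>X Ys x. 0)}"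
      obtain p q' where pq: "i = (p, q')" by (cases i)
      then have "q' = int q" "w (p + q') \<noteq> (\<lambda>X Ys x. 0)"
        using i by (auto simp: to_row_def split: if_splits)
      then show "i \<in> (\<lambda>n. (n - int q, int q)) ` {n. w n \<noteq> (\<lambda>X Ys x. 0)}"
        by (intro image_eqI [of _ _ "p + q'"]) (auto simp: pq)
    qed
    show "finite ((\<lambda>n. (n - int q, int q)) ` {n. w n \<noteq> (\<lambda>X Ys x. 0)})"
      using wH by (simp add: H.reps_def)
  qed
  moreover have "to_row q w i = (\<lambda>X Ys x. 0)" if "\<not> (case i of (p, q) \<Rightarrow> P (p + q))" for i
    using wH that by (cases i) (auto simp: to_row_def H.reps_def)
  ultimately show ?thesis
    unfolding E.reps_def by blast
qed

lemma row_reps: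
  assumes w: "w \<in> E.reps"
  shows "row q w \<in> E.reps"
proof -
  have "{i. row q w i \<noteq> (\<lambda>X Ys x. 0)} \<subseteq> {i. w i \<noteq> (\<lambda>X Ys x. 0)}"
    by (auto simp: row_def split: if_splits)
  then have "finite {i. row q w i \<noteq> (\<lambda>X Ys x. 0)}"
    using w finite_subset by (auto simp: E.reps_def)
  moreover have "row q w i \<in> (case i of (p, q) \<Rightarrow> filt_cycles p (p + q))" for i
  proof (cases i)
    case (Pair p q')
    have "w i \<in> (case i of (p, q) \<Rightarrow> filt_cycles p (p + q))"
      using w unfolding E.reps_def by blast
    then show ?thesis
      using zero_filt_cycles by (auto simp: row_def Pair)
  qed
  moreover have "row q w i = (\<lambda>X Ys x. 0)" if "\<not> (case i of (p, q) \<Rightarrow> P (p + q))" for i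
    using w that unfolding E.reps_def by (cases i) (auto simp: row_def)
  ultimately show ?thesis
    unfolding E.reps_def by blast
qed

lemma to_row_add:
  "to_row q (\<lambda>i X Ys x. v i X Ys x + w i X Ys x) = (\<lambda>i X Ys x. to_row q v i X Ys x + to_row q w i X Ys x)"
  by (auto simp: to_row_def fun_eq_iff)

lemma row_add:
  "row q (\<lambda>i X Ys x. v i X Ys x + w i X Ys x) = (\<lambda>i X Ys x. row q v i X Ys x + row q w i X Ys x)"
  by (auto simp: row_def fun_eq_iff)

lemma to_row_scal: "to_row q (H.scal a w) = E.scal a (to_row q w)"
  by (auto simp: to_row_def H.scal_def E.scal_def fun_eq_iff diff_add_eq)

lemma row_scal: "row q (E.scal a w) = E.scal a (row q w)"
  by (auto simp: row_def E.scal_def fun_eq_iff)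

lemma low_reps_submodule: "LinearCombinations.submodule (inv_poly_ring G) (low_reps q) H.rep_module"
proof (rule LinearCombinations.submodule.intro, unfold H.rep_module_simps)
  show "module (inv_poly_ring G) H.rep_module" by (rule H.module_rep_module)
  show "low_reps q \<subseteq> H.reps" by (auto simp: low_reps_def)
  show "(\<lambda>i X Ys p. 0) \<in> low_reps q"
    by (simp add: low_reps_def H.reps_def zero_F zero_filt_cycles)
  show "(\<lambda>i X Ys p. v i X Ys p + w i X Ys p) \<in> low_reps q" if "v \<in> low_reps q" "w \<in> low_reps q" for v w
    using that H.reps_add [of v w 1 1]
    by (auto simp: low_reps_def intro: cform_subspaceD(3) [OF cartan_filt_subspace])
  show "H.scal c v \<in> low_reps q" if c: "c \<in> carrier (inv_poly_ring G)" and v: "v \<in> low_reps q" for c v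
  proof -
    have "H.scal c v n \<in> F (n - int q) n" for n
      unfolding H.scal_def
    proof (rule cform_subspace_sum [OF cartan_filt_subspace])
      fix k
      have "v (n - 2 * int k) \<in> F (n - 2 * int k - int q) (n - 2 * int k)"
        using v by (auto simp: low_reps_def)
      moreover have "n - 2 * int k - int q = n - int q - 2 * int k"
        by simp
      ultimately have "v (n - 2 * int k) \<in> F (n - int q - 2 * int k) (n - 2 * int k)"
        by (simp only:)
      then show "(\<lambda>X Ys p. hom_component G c k X * v (n - 2 * int k) X Ys p) \<in> F (n - int q) n"
        by (rule filt_mult [OF hom_component_sym_power [OF G c] hom_component_invariant [OF G c]])
    qed
    then show ?thesis
      using H.reps_scal [OF c] v by (simp add: low_reps_def)
  qed
qed

lemma low_rows_submodule: "LinearCombinations.submodule (inv_poly_ring G) (low_rows q) E.rep_module"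
proof (rule LinearCombinations.submodule.intro, unfold E.rep_module_simps)
  show "module (inv_poly_ring G) E.rep_module" by (rule E.module_rep_module)
  show "low_rows q \<subseteq> E.reps" by (auto simp: low_rows_def)
  show "(\<lambda>i X Ys p. 0) \<in> low_rows q"
    by (simp add: low_rows_def E.reps_def zero_filt_cycles split: prod.splits)
  show "(\<lambda>i X Ys p. v i X Ys p + w i X Ys p) \<in> low_rows q" if "v \<in> low_rows q" "w \<in> low_rows q" for v w
    using that E.reps_add [of v w 1 1] by (simp add: low_rows_def)
  show "E.scal c v \<in> low_rows q" if c: "c \<in> carrier (inv_poly_ring G)" and v: "v \<in> low_rows q" for c v
    using E.reps_scal [OF c] v by (simp add: low_rows_def E.scal_def)
qed

lemma to_row_hom:
  "(\<lambda>w. E.cls (to_row q w)) \<in> module_hom (inv_poly_ring G) (H.rep_module\<lparr>carrier := low_reps q\<rparr>) E.total"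
  using E.cls_hom to_row_reps
  by (auto simp: module_hom_def H.rep_module_simps E.rep_module_simps to_row_add to_row_scal)

lemma row_hom:
  "(\<lambda>w. E.cls (row q w)) \<in> module_hom (inv_poly_ring G) (E.rep_module\<lparr>carrier := low_rows q\<rparr>) E.total"
  using E.cls_hom row_reps
  by (auto simp: module_hom_def E.rep_module_simps row_add row_scal low_rows_def)

text \<open>
  The row \<open>q\<close> of \<open>E\<^sub>\<infinity>\<close> is the subquotient in step \<open>q\<close> both of the filtration of equivariant cohomology and of
  the filtration of \<open>E\<^sub>\<infinity>\<close> by rows.  A single choice of rank bases of the rows therefore serves for both.
\<close>

lemma row_images:
  "(\<lambda>w. E.cls (to_row q w)) ` low_reps q = (\<lambda>w. E.cls (row q w)) ` low_rows q"
proof (intro equalityI subsetI)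
  fix e assume "e \<in> (\<lambda>w. E.cls (to_row q w)) ` low_reps q"
  then obtain w where w: "w \<in> low_reps q" "e = E.cls (to_row q w)" by blast
  have "row q (to_row q w) = to_row q w"
    by (auto simp: row_def to_row_def fun_eq_iff)
  moreover have "to_row q w \<in> low_rows q"
    using to_row_reps [OF w(1)] by (auto simp: low_rows_def to_row_def)
  ultimately show "e \<in> (\<lambda>w. E.cls (row q w)) ` low_rows q"
    unfolding w(2) by (metis (no_types, lifting) imageI)
next
  fix e assume "e \<in> (\<lambda>w. E.cls (row q w)) ` low_rows q"
  then obtain w where w: "w \<in> E.reps" "e = E.cls (row q w)" by (auto simp: low_rows_def)
  let ?v = "\<lambda>n. w (n - int q, int q)"
  have cyc: "w (a, b) \<in> filt_cycles a (a + b)" for a b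
    using w(1) by (rule E_reps_cycle)
  have "?v n \<in> filt_cycles (n - int q) n" for n
    using cyc [of "n - int q" "int q"] by simp
  moreover have "F (n - int q) n \<subseteq> F 0 n" for n
    by (rule F_subset_F_zero)
  moreover have "finite {n. ?v n \<noteq> (\<lambda>X Ys x. 0)}"
  proof -
    have "finite ((\<lambda>n. (n - int q, int q)) -` {i. w i \<noteq> (\<lambda>X Ys x. 0)})"
      using w(1) by (intro finite_vimageI) (auto simp: E.reps_def inj_def)
    then show ?thesis by (simp add: vimage_def)
  qed
  moreover have "?v n = (\<lambda>X Ys x. 0)" if "\<not> P n" for n
    using w(1) that by (auto simp: E.reps_def)
  ultimately have "?v \<in> low_reps q"
    by (auto simp: low_reps_def H.reps_def filt_cycles_def)
  moreover have "to_row q ?v = row q w"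
    by (auto simp: row_def to_row_def fun_eq_iff)
  ultimately show "e \<in> (\<lambda>w. E.cls (to_row q w)) ` low_reps q"
    unfolding w(2) by (metis (no_types, lifting) imageI)
qed

text \<open>
  The lemma \<open>rank_basis_of_filtration\<close> is applied to equivariant cohomology, filtered by fibre degree,
  and to \<open>E\<^sub>\<infinity>\<close>, filtered by rows.  The resulting rank bases have the same index set.
\<close>

lemma rank_E_inf_sum:
  "module_rank (inv_poly_ring G) (E_inf_sum G M act P) =
   module_rank (inv_poly_ring G) (equiv_cohomology_sum G M act P)"
proof -
  let ?R = "inv_poly_ring G"
  interpret HM: module_over_domain ?R H.total
    by (simp add: module_over_domain_def H.module_total domain_inv_poly_ring [OF G])
  interpret EM: module_over_domain ?R E.total
    by (simp add: module_over_domain_def E.module_total domain_inv_poly_ring [OF G])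
  let ?S = "\<lambda>q. (\<lambda>w. E.cls (to_row q w)) ` low_reps q"
  have "?S q \<subseteq> carrier E.total" for q
    using module_hom_closed [OF to_row_hom [of q]] by auto
  then have "\<exists>B. B \<subseteq> ?S q \<and> independent_family ?R E.total B (\<lambda>x. x) \<and>
      (\<forall>x\<in>?S q. \<exists>r\<in>EM.nonzeros. r \<odot>\<^bsub>E.total\<^esub> x \<in> EM.span B)" for q
    by (rule EM.maximal_independent_subset_exists)
  then have "\<forall>q. \<exists>B. B \<subseteq> ?S q \<and> independent_family ?R E.total B (\<lambda>x. x) \<and>
      (\<forall>x\<in>?S q. \<exists>r\<in>EM.nonzeros. r \<odot>\<^bsub>E.total\<^esub> x \<in> EM.span B)"
    by blast
  from choice [OF this] obtain B where "\<forall>q. B q \<subseteq> ?S q \<and> independent_family ?R E.total (B q) (\<lambda>x. x) \<and>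
      (\<forall>x\<in>?S q. \<exists>r\<in>EM.nonzeros. r \<odot>\<^bsub>E.total\<^esub> x \<in> EM.span (B q))"
    by (rule exE)
  then have B: "\<And>q. B q \<subseteq> ?S q" "\<And>q. independent_family ?R E.total (B q) (\<lambda>x. x)"
    "\<And>q y. y \<in> ?S q \<Longrightarrow> \<exists>r\<in>EM.nonzeros. r \<odot>\<^bsub>E.total\<^esub> y \<in> EM.span (B q)"
    by blast+
  have "\<exists>h. rank_basis ?R H.total (SIGMA q:UNIV. B q) h"
  proof (rule rank_basis_of_filtration [OF HM.module_over_domain_axioms EM.module_over_domain_axioms
        H.module_rep_module H.cls_hom _ low_reps_submodule _ _ to_row_hom _ _ _ _ B])
    show "H.cls ` carrier H.rep_module = carrier H.total"
      by (simp add: H.rep_module_simps H.cls_onto)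
    show "low_reps q \<subseteq> low_reps (Suc q)" for q
      using cartan_filt_antimono [of "n - int (Suc q)" "n - int q" for n]
      by (fastforce simp: low_reps_def)
    show "carrier H.rep_module \<subseteq> (\<Union>q. low_reps q)"
    proof
      fix w assume "w \<in> carrier H.rep_module"
      then have w: "w \<in> H.reps" by (simp add: H.rep_module_simps)
      then have "finite (nat ` {n. w n \<noteq> (\<lambda>X Ys x. 0)})"
        by (simp add: H.reps_def)
      then obtain q where q: "\<And>n. w n \<noteq> (\<lambda>X Ys x. 0) \<Longrightarrow> nat n \<le> q"
        by (auto simp: finite_nat_set_iff_bounded_le)
      have "w n \<in> F (n - int q) n" for n
      proof (cases "w n = (\<lambda>X Ys x. 0)")
        case True
        then show ?thesis by (simp add: zero_F)
      next
        case False
        then have "n - int q \<le> 0" using q [of n] by linarith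
        moreover have "w n \<in> F 0 n"
          using w by (auto simp: H.reps_def filt_cycles_def)
        ultimately show ?thesis
          using cartan_filt_nonpos by blast
      qed
      then show "w \<in> (\<Union>q. low_reps q)"
        using w by (auto simp: low_reps_def)
    qed
    show "E.cls (to_row q w) = \<zero>\<^bsub>E.total\<^esub>" if w: "w \<in> low_reps q" and 0: "H.cls w = \<zero>\<^bsub>H.total\<^esub>" for q w
      unfolding E.cls_zero_iff
    proof (clarify)
      fix p q'
      show "to_row q w (p, q') \<in> filt_boundaries p (p + q')"
      proof (cases "q' = int q")
        case True
        have "w (p + q') \<in> F p (p + q')"
          using w True by (auto simp: low_reps_def dest: spec [of _ "p + q'"])
        moreover obtain x where "x \<in> F 0 (p + q' - 1)" "w (p + q') = d x"
          using 0 unfolding H.cls_zero_iff by blast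
        ultimately show ?thesis
          using True boundary_in_filt_boundaries [of x "p + q'" p] by (simp add: to_row_def)
      next
        case False
        then show ?thesis by (simp add: to_row_def zero_filt_boundaries)
      qed
    qed
    show "E.cls (to_row (Suc q) w) = \<zero>\<^bsub>E.total\<^esub>" if w: "w \<in> low_reps q" for q w
      unfolding E.cls_zero_iff
    proof (clarify)
      fix p q'
      show "to_row (Suc q) w (p, q') \<in> filt_boundaries p (p + q')"
      proof (cases "q' = int (Suc q)")
        case True
        have "w (p + q') \<in> filt_cycles (p + 1) (p + q')"
          using w True by (auto simp: low_reps_def H.reps_def filt_cycles_def dest!: spec [of _ "p + q'"])
        then show ?thesis
          using True cycle_in_filt_boundaries by (simp add: to_row_def)
      next
        case False
        then show ?thesis by (simp add: to_row_def zero_filt_boundaries)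
      qed
    qed
    show "H.cls w = \<zero>\<^bsub>H.total\<^esub>" if w: "w \<in> low_reps 0" and 0: "E.cls (to_row 0 w) = \<zero>\<^bsub>E.total\<^esub>" for w
      unfolding H.cls_zero_iff
    proof
      fix n
      have "to_row 0 w (n, 0) \<in> filt_boundaries n (n + 0)"
        using 0 unfolding E_cls_zero_iff by blast
      then have "w n \<in> filt_boundaries n n"
        by (simp add: to_row_def)
      then obtain y x where y: "y \<in> filt_cycles (n + 1) n" and x: "x \<in> F 0 (n - 1)"
        and e: "w n = (\<lambda>X Ys p. y X Ys p + d x X Ys p)"
        unfolding filt_boundaries_def by auto
      have "y = (\<lambda>X Ys p. 0)"
        using y cartan_filt_above [of n "n + 1" G M act] by (simp add: filt_cycles_def)
      then show "w n \<in> boundaries n"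
        using x e by auto
    qed
    show "H.cls w \<in> H.cls ` low_reps q"
      if w: "w \<in> low_reps (Suc q)" and 0: "E.cls (to_row (Suc q) w) = \<zero>\<^bsub>E.total\<^esub>" for q w
    proof -
      have wH: "w \<in> H.reps"
        using w by (simp add: low_reps_def)
      have "\<exists>y. y \<in> filt_cycles (n - int q) n \<and> (\<lambda>X Ys p. w n X Ys p - y X Ys p) \<in> boundaries n" for n
      proof -
        have "to_row (Suc q) w (n - int (Suc q), int (Suc q)) \<in>
            filt_boundaries (n - int (Suc q)) (n - int (Suc q) + int (Suc q))"
          using 0 unfolding E_cls_zero_iff by blast
        then have "w n \<in> filt_boundaries (n - int (Suc q)) n"
          by (simp add: to_row_def)
        then obtain y x where y: "y \<in> filt_cycles (n - int (Suc q) + 1) n" and x: "x \<in> F 0 (n - 1)"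
          and e: "w n = (\<lambda>X Ys p. y X Ys p + d x X Ys p)"
          unfolding filt_boundaries_def by auto
        have "(\<lambda>X Ys p. w n X Ys p - y X Ys p) = d x"
          by (simp add: e)
        then have "(\<lambda>X Ys p. w n X Ys p - y X Ys p) \<in> boundaries n"
          using imageI [OF x, of d] by (simp only:)
        moreover have "y \<in> filt_cycles (n - int q) n"
          using y by (simp add: algebra_simps)
        ultimately show ?thesis by blast
      qed
      then have "\<forall>n. \<exists>y. y \<in> filt_cycles (n - int q) n \<and> (\<lambda>X Ys p. w n X Ys p - y X Ys p) \<in> boundaries n"
        by blast
      from choice [OF this]
      obtain y where "\<forall>n. y n \<in> filt_cycles (n - int q) n \<and> (\<lambda>X Ys p. w n X Ys p - y n X Ys p) \<in> boundaries n"
        by (rule exE)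
      then have y: "\<And>n. y n \<in> filt_cycles (n - int q) n"
        "\<And>n. (\<lambda>X Ys p. w n X Ys p - y n X Ys p) \<in> boundaries n"
        by blast+
      \<comment> \<open>The case distinction keeps the support finite.\<close>
      let ?y = "\<lambda>n. if w n = (\<lambda>X Ys p. 0) then (\<lambda>X Ys p. 0) else y n"
      have "finite {n. ?y n \<noteq> (\<lambda>X Ys p. 0)}"
        by (rule finite_subset [of _ "{n. w n \<noteq> (\<lambda>X Ys p. 0)}"]) (use wH in \<open>auto simp: H.reps_def\<close>)
      moreover have "F (n - int q) n \<subseteq> F 0 n" for n
        by (rule F_subset_F_zero)
      ultimately have "?y \<in> low_reps q"
        using y(1) wH zero_F zero_filt_cycles
        by (auto simp: low_reps_def H.reps_def filt_cycles_def)
      moreover have "H.cls w = H.cls ?y"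
        unfolding H.cls_eq_iff using y(2) cform_subspaceD(1) [OF boundaries_subspace] by auto
      ultimately show ?thesis
        by (metis (no_types, lifting) imageI)
    qed
  qed
  then obtain h where h: "rank_basis ?R H.total (SIGMA q:UNIV. B q) h" by blast
  have "\<exists>h. rank_basis ?R E.total (SIGMA q:UNIV. B q) h"
  proof (rule rank_basis_of_filtration [OF EM.module_over_domain_axioms EM.module_over_domain_axioms
        E.module_rep_module E.cls_hom _ low_rows_submodule _ _ row_hom _ _ _ _ _ B(2)])
    show "E.cls ` carrier E.rep_module = carrier E.total"
      by (simp add: E.rep_module_simps E.cls_onto)
    show "low_rows q \<subseteq> low_rows (Suc q)" for q
      by (auto simp: low_rows_def)
    show "carrier E.rep_module \<subseteq> (\<Union>q. low_rows q)"
    proof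
      fix w assume "w \<in> carrier E.rep_module"
      then have w: "w \<in> E.reps" by (simp add: E.rep_module_simps)
      then have "finite ((\<lambda>i. nat (snd i)) ` {i. w i \<noteq> (\<lambda>X Ys x. 0)})"
        by (simp add: E.reps_def)
      then obtain q where q: "\<forall>m \<in> (\<lambda>i. nat (snd i)) ` {i. w i \<noteq> (\<lambda>X Ys x. 0)}. m \<le> q"
        unfolding finite_nat_set_iff_bounded_le by (rule exE)
      have "w (p, q') = (\<lambda>X Ys x. 0)" if "q' > int q" for p q'
      proof (rule ccontr)
        assume "w (p, q') \<noteq> (\<lambda>X Ys x. 0)"
        then have "(p, q') \<in> {i. w i \<noteq> (\<lambda>X Ys x. 0)}"
          by simp
        from bspec [OF q imageI [OF this]] show False
          using that by simp
      qed
      then show "w \<in> (\<Union>q. low_rows q)"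
        using w by (auto simp: low_rows_def)
    qed
    show "E.cls (row q w) = \<zero>\<^bsub>E.total\<^esub>" if "w \<in> low_rows q" and 0: "E.cls w = \<zero>\<^bsub>E.total\<^esub>" for q w
      using 0 zero_filt_boundaries unfolding E.cls_zero_iff by (auto simp: row_def)
    show "E.cls (row (Suc q) w) = \<zero>\<^bsub>E.total\<^esub>" if "w \<in> low_rows q" for q w
      using that zero_filt_boundaries unfolding E.cls_zero_iff by (auto simp: row_def low_rows_def)
    show "E.cls w = \<zero>\<^bsub>E.total\<^esub>" if w: "w \<in> low_rows 0" and 0: "E.cls (row 0 w) = \<zero>\<^bsub>E.total\<^esub>" for w
      unfolding E.cls_zero_iff
    proof (clarify)
      fix p q' :: int
      have cyc: "w (p, q') \<in> filt_cycles p (p + q')"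
        using w by (intro E_reps_cycle) (simp add: low_rows_def)
      have r: "row 0 w (p, q') \<in> filt_boundaries p (p + q')"
        using 0 unfolding E_cls_zero_iff by blast
      consider "q' > 0" | "q' = 0" | "q' < 0" by linarith
      then show "w (p, q') \<in> filt_boundaries p (p + q')"
      proof cases
        case 1
        then show ?thesis using w zero_filt_boundaries by (auto simp: low_rows_def)
      next
        case 2
        then show ?thesis using r by (simp add: row_def)
      next
        case 3
        then have "w (p, q') = (\<lambda>X Ys x. 0)"
          using cyc cartan_filt_above [of "p + q'" p G M act] by (simp add: filt_cycles_def)
        then show ?thesis by (simp add: zero_filt_boundaries)
      qed
    qed
    show "E.cls w \<in> E.cls ` low_rows q"
      if w: "w \<in> low_rows (Suc q)" and 0: "E.cls (row (Suc q) w) = \<zero>\<^bsub>E.total\<^esub>" for q w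
    proof -
      let ?y = "\<lambda>(p, q'). if q' = int (Suc q) then (\<lambda>X Ys x. 0) else w (p, q')"
      have wE: "w \<in> E.reps"
        using w by (simp add: low_rows_def)
      have "{i. ?y i \<noteq> (\<lambda>X Ys x. 0)} \<subseteq> {i. w i \<noteq> (\<lambda>X Ys x. 0)}"
        by (auto split: if_splits)
      then have "finite {i. ?y i \<noteq> (\<lambda>X Ys x. 0)}"
        using wE finite_subset by (auto simp: E.reps_def)
      moreover have "?y i \<in> (case i of (p, q) \<Rightarrow> filt_cycles p (p + q))" for i
      proof (cases i)
        case (Pair p q')
        have "w i \<in> (case i of (p, q) \<Rightarrow> filt_cycles p (p + q))"
          using wE unfolding E.reps_def by blast
        then show ?thesis
          using zero_filt_cycles by (simp add: Pair)
      qed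
      moreover have "?y i = (\<lambda>X Ys x. 0)" if "\<not> (case i of (p, q) \<Rightarrow> P (p + q))" for i
        using wE that unfolding E.reps_def by (cases i) auto
      ultimately have "?y \<in> E.reps"
        unfolding E.reps_def by blast
      moreover have "?y (p, q') = (\<lambda>X Ys x. 0)" if "q' > int q" for p q'
        using w that by (cases "q' = int (Suc q)") (auto simp: low_rows_def)
      ultimately have "?y \<in> low_rows q"
        unfolding low_rows_def by blast
      moreover have "E.cls w = E.cls ?y"
        unfolding E.cls_eq_iff
      proof (clarify)
        fix p q'
        have "row (Suc q) w (p, q') \<in> filt_boundaries p (p + q')"
          using 0 unfolding E_cls_zero_iff by blast
        then show "(\<lambda>X Ys x. w (p, q') X Ys x - (if q' = int (Suc q) then \<lambda>X Ys x. 0 else w (p, q')) X Ys x)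
            \<in> filt_boundaries p (p + q')"
          using zero_filt_boundaries by (auto simp: row_def)
      qed
      ultimately show ?thesis
        by (metis (no_types, lifting) imageI)
    qed
    show "B q \<subseteq> (\<lambda>w. E.cls (row q w)) ` low_rows q" for q
      using B(1) [of q] by (simp only: row_images)
    show "\<exists>r\<in>carrier ?R - {\<zero>\<^bsub>?R\<^esub>}. r \<odot>\<^bsub>E.total\<^esub> y \<in> EM.span (B q)"
      if "y \<in> (\<lambda>w. E.cls (row q w)) ` low_rows q" for q y
      using B(3) [of y q] that by (simp only: row_images)
  qed
  then obtain e where e: "rank_basis ?R E.total (SIGMA q:UNIV. B q) e" by blast
  show ?thesis
    unfolding E_inf_sum_eq equiv_cohomology_sum_eq
    by (simp only: HM.module_rank_eq_card [OF h] EM.module_rank_eq_card [OF e])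
qed

end

end

theorem corollaryA19:
  fixes G :: "'g lie_group_data" and M :: "'m mfd" and act :: "'g \<Rightarrow> 'm \<Rightarrow> 'm"
  assumes "lie_group G"
    and "compact_space (mtop (mfd_of G))"
    and "connected_space (mtop (mfd_of G))"
    and "smooth_manifold M"
    and "smooth_action G M act"
    and "vectorspace.fin_dim real_ring (de_rham_cohomology M)"
  shows "module_rank (inv_poly_ring G) (E_inf_sum G M act even) =
           module_rank (inv_poly_ring G) (equiv_cohomology_sum G M act even) \<and>
         module_rank (inv_poly_ring G) (E_inf_sum G M act odd) =
           module_rank (inv_poly_ring G) (equiv_cohomology_sum G M act odd)"
  by (intro conjI rank_E_inf_sum assms) auto

end
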